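(* Let $(X,\mathcal F)$ be a compact minimal equicontinuous Polish foliated space whose holonomy pseudogroup has strongly quasi-analytic closure. Fix a defining cocycle $\{U_i,p_i,h_{ij}\}$ of $\mathcal F$ induced by a regular foliated atlas, and let $x_0,x_1\in X$. Let $(\widehat X_0,\widehat{\mathcal F}_0)$, $\hat\pi_0:\widehat X_0\to X$ and $(\widehat X_1,\widehat{\mathcal F}_1)$, $\hat\pi_1:\widehat X_1\to X$ be the foliated spaces and maps constructed from this cocycle and the points $x_0$ and $x_1$, respectively (construction in the context). Then there is a foliated homeomorphism $\hat\theta:(\widehat X_0,\widehat{\mathcal F}_0)\to(\widehat X_1,\widehat{\mathcal F}_1)$ such that $\hat\pi_1\hat\theta=\hat\pi_0$.
   Context: **Pseudogroups.** All pseudogroups act on locally compact Polish spaces. For a space $T$, $\mathrm{Loct}(T)$ is the set of homeomorphisms between open subsets of $T$ (local transformations); the composite $h'h$ has domain $h^{-1}(\operatorname{im}h\cap\operatorname{dom}h')$. A pseudogroup on $T$ is a set $\mathcal H\subset\mathrm{Loct}(T)$ containing $\mathrm{id}_T$, closed under composition, inversion and restriction to open subsets of domains, and containing every homeomorphism in $\mathrm{Loct}(T)$ that is a union of elements of $\mathcal H$. A pseudo$*$group is a set $S\subset\mathrm{Loct}(T)$ closed under composition and inversion; it is local if also closed under restriction to open subsets of domains. The pseudogroup generated by a set is the smallest pseudogroup containing it. $\mathcal H|_U=\{h\in\mathcal H\mid \operatorname{dom}h\cup\operatorname{im}h\subset U\}$. Orbits: $\mathcal H(x)=\{h(x)\mid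 h\in\mathcal H,\ x\in\operatorname{dom}h\}$; $\mathcal H$ is minimal if all orbits are dense. The germ of $h$ at $x$ is $\gamma(h,x)$. $\mathcal H$ is compactly generated if there is a relatively compact open $U\subset T$ meeting all orbits and a finite set $\{h_1,\dots,h_n\}\subset\mathcal H|_U$ generating $\mathcal H|_U$ such that each $h_i$ is the restriction of some $\tilde h_i\in\mathcal H$ with $\overline{\operatorname{dom}h_i}\subset\operatorname{dom}\tilde h_i$. $\mathcal H$ is strongly quasi-analytic if it is generated by a sub-pseudo$*$group $S\subset\mathcal H$ such that any $h\in S$ that is the identity on some non-empty open subset of its domain is the identity on its domain. A cover of $T$ by quasi-locally equal metric spaces is a family $\{T_i,d_i\}$ of metric spaces such that $\{T_i\}$ covers $T$, each $T_i\cap T_j$ is open in $(T_i,d_i)$ and $(T_j,d_j)$, and for all $\epsilon>0$ there is $\delta(\epsilon)>0$ such that for all $i,j$, $z\in T_i\cap T_j$ there is an open neighborhood $U_{i,j,z}$ of $z$ in $T_i\cap T_j$ with $d_i(x,y)<\delta(\epsilon)\Rightarrow d_j(x,y)<\epsilon$ for all $\epsilon>0$, $x,y\in U_{i,j,z}$; it induces the topology with basis all open balls of the $(T_i,d_i)$. $\mathcal H$ is equicontinuous if there is such a cover inducing the topology of $T$ and a sub-pseudo$*$group $S\subset\mathcal H$ generating $\mathcal H$ such that for every $\epsilon>0$ there is $\delta(\epsilon)>0$ with $d_i(x,y)<\delta(\epsilon)\Rightarrow d_j(h(x),h(y))<\epsilon$ for all $h\in S$, all $i,j$, and $x,y\in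 T_i\cap h^{-1}(T_j\cap\operatorname{im}h)$. **Closure.** Let $\mathcal H$ be compactly generated, equicontinuous and strongly quasi-analytic, the last two conditions holding with a sub-pseudo$*$group $S$ generating $\mathcal H$. $\overline{\mathcal H}$ is the set of $h\in\mathrm{Loct}(T)$ such that every $x\in\operatorname{dom}h$ has an open neighborhood $O_x\subset\operatorname{dom}h$ with $h|_{O_x}$ in the closure of $\{f\in S\mid\operatorname{dom}f=O_x\}$ in $C(O_x,T)$ with the compact-open topology. It is a pseudogroup containing $\mathcal H$, independent of $S$. Strong quasi-analyticity of $\overline{\mathcal H}$ includes that $\mathcal H$ satisfies these conditions. **Foliated spaces.** Let $X$ and $Z$ be locally compact Polish. A foliated chart of leaf dimension $n$, transversely modeled on $Z$, is $(U,\phi)$ with $U\subset X$ open and $\phi:U\to B\times T$ a homeomorphism, $B$ an open ball in $\mathbb R^n$, $T\subset Z$ open; the $\phi^{-1}(B\times\{y\})$ are its plaques, and $p=\mathrm{pr}_2\phi:U\to T$ its distinguished submersion. A foliated atlas is a family of such charts covering $X$ for which plaques of different charts intersect in sets open in both; a maximal one is a foliated structure $\mathcal F$. The plaques form a basis of the leaf topology, whose components are the leaves. A foliated map sends leaves into leaves. A foliated atlas $\{U_i,\phi_i\}$ is regular if each $\overline{U_i}$ is a compact subset of the domain of a foliated chart $(W_i,\psi_i)$ with $\phi_i=\psi_i|_{U_i}$, $\{U_i\}$ is locally finite, and each plaque of $(U_i,\phi_i)$ meets at most one plaque of $(U_j,\phi_j)$. It induces a defining cocycle $\{U_i,p_i,h_{ij}\}$: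 $p_i:U_i\to T_i$ distinguished submersions, $T_{ij}=p_i(U_i\cap U_j)$, $h_{ij}:T_{ij}\to T_{ji}$ homeomorphisms with $h_{ij}p_i=p_j$ on $U_i\cap U_j$. The pseudogroup $\mathcal H$ on $T=\bigsqcup_iT_i$ generated by the $h_{ij}$ represents the holonomy pseudogroup; it is compactly generated if $X$ is compact. The foliated space is minimal, respectively equicontinuous, if $\mathcal H$ is. **Construction of $\widehat T_0$.** Let $\mathcal H$ be the representative of the holonomy pseudogroup of $(X,\mathcal F)$ on $T=\bigsqcup_iT_i$ generated by the maps $h_{ij}$ of the defining cocycle $\{U_i,p_i,h_{ij}\}$, and $t_0\in T$ a base point. Let $U\subset T$ be a relatively compact open set containing $t_0$, meeting all orbits, with which compact generation holds. Let $S\subset\mathcal H$ be a local sub-pseudo$*$group generating $\mathcal H$ with which equicontinuity (with a cover $\{T'_a,d_a\}$) and strong quasi-analyticity hold, and let $\overline S$ be the pseudo$*$group of local transformations of $T$ lying, for some open $O\subset T$, in the closure of $\{f\in S\mid\operatorname{dom}f=O\}$ in $C(O,T)$ with the compact-open topology; it generates $\overline{\mathcal H}$. $S$ and the cover are chosen so that: $\overline U$ is covered by finitely many $T'_{a_1},\dots,T'_{a_r}$ such that the closure of $\{h\in S\mid\operatorname{dom}h=T'_{a_k},\ h(T'_{a_k})\cap\overline U\ne\emptyset\}$ in $C(T'_{a_k},T)$ is contained in $\overline S$; for all $h\in\overline{\mathcal H}$ and $x\in T'_{a_k}\cap U\cap\operatorname{dom}h$ with $h(x)\in U$ there is $\tilde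 h\in\overline S$ with domain $T'_{a_k}$ and $\gamma(\tilde h,x)=\gamma(h,x)$; and strong quasi-analyticity of $\overline{\mathcal H}$ holds with $\overline S$. Give $\overline S$ the topology with subbasis $\{h\in\overline S\mid K\subset\operatorname{dom}h,\ h(K)\subset O\}$ ($K$ compact, $O$ open in $T$), and the set $\widehat T$ of germs of $\overline{\mathcal H}$ the quotient topology of the germ map $\{(f,x)\in\overline S\times T\mid x\in\operatorname{dom}f\}\to\widehat T$ (this topology does not depend on the choice of $S$). Let $\widehat T_0=\{\gamma(g,x)\in\widehat T\mid g(x)=t_0\}$ and $\hat\pi_0:\widehat T_0\to T$, $\gamma(g,x)\mapsto x$. For $h\in\mathcal H$ let $\hat h:\hat\pi_0^{-1}(\operatorname{dom}h)\to\hat\pi_0^{-1}(\operatorname{im}h)$, $\hat h(\gamma(g,x))=\gamma(gh^{-1},h(x))$. **Construction of $\widehat X_0$.** Given $x_0\in X$, choose $i_0$ with $x_0\in U_{i_0}$ and take $t_0=p_{i_0}(x_0)\in T_{i_0}\subset T$. Let $\widehat T_{i,0}=\hat\pi_0^{-1}(T_i)$, $\check X_0=\bigsqcup_iU_i\times\widehat T_{i,0}=\bigcup_iU_i\times\widehat T_{i,0}\times\{i\}$ (topological sum of products), and $\widetilde X_0=\{(x,\gamma,i)\in\check X_0\mid p_i(x)=\hat\pi_0(\gamma)\}$. Put $(x,\gamma,i)\sim(y,\delta,j)$ if $x=y$ and $\gamma=\widehat{h_{ji}}(\delta)$; $\widehat X_0$ is the quotient space, $q:\widetilde X_0\to\widehat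 X_0$ the quotient map, $[x,\gamma,i]$ the class of $(x,\gamma,i)$. Let $\widehat U_{i,0}=\{[x,\gamma,i]\in\widehat X_0\mid x\in U_i,\ \gamma\in\widehat T_{i,0},\ p_i(x)=\hat\pi_0(\gamma)\}$, and $\hat p_{i,0}:\widehat U_{i,0}\to\widehat T_{i,0}$, $\hat p_{i,0}([x,\gamma,i])=\gamma$. The foliated structure $\widehat{\mathcal F}_0$ on $\widehat X_0$ is the one with defining cocycle $\{\widehat U_{i,0},\hat p_{i,0},\widehat{h_{ij}}\}$. The map $\hat\pi_0:\widehat X_0\to X$ is $\hat\pi_0([x,\gamma,i])=x$. The objects $\widehat X_1,\widehat{\mathcal F}_1,\hat\pi_1:\widehat X_1\to X$ are defined in the same way using $x_1$ and an index $i_1$ with $x_1\in U_{i_1}$. *)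

theory Defs
  imports "HOL-Analysis.Analysis"
begin

section \<open>Topological preliminaries\<close>

definition lc_polish_space :: "'a topology \<Rightarrow> bool" where
  "lc_polish_space X \<longleftrightarrow>
     locally_compact_space X \<and> completely_metrizable_space X \<and> separable_space X"

definition quotient_topology :: "'a topology \<Rightarrow> ('a \<Rightarrow> 'b) \<Rightarrow> 'b topology" where
  "quotient_topology X f =
     topology (\<lambda>V. V \<subseteq> f ` topspace X \<and> openin X {x \<in> topspace X. f x \<in> V})"

lemma istopology_quotient_topology:
  "istopology (\<lambda>V. V \<subseteq> f ` topspace X \<and> openin X {x \<in> topspace X. f x \<in> V})"
  unfolding istopology_def
proof (intro conjI allI impI)
  fix S S'
  assume S: "S \<subseteq> f ` topspace X \<and> openin X {x \<in> topspace X. f x \<in> S}"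
    and S': "S' \<subseteq> f ` topspace X \<and> openin X {x \<in> topspace X. f x \<in> S'}"
  have "{x \<in> topspace X. f x \<in> S \<inter> S'} = {x \<in> topspace X. f x \<in> S} \<inter> {x \<in> topspace X. f x \<in> S'}"
    by auto
  then show "openin X {x \<in> topspace X. f x \<in> S \<inter> S'}"
    using S S' by (simp add: openin_Int)
  show "S \<inter> S' \<subseteq> f ` topspace X"
    using S by (simp add: le_infI1)
next
  fix \<K>
  assume \<K>: "\<forall>K\<in>\<K>. K \<subseteq> f ` topspace X \<and> openin X {x \<in> topspace X. f x \<in> K}"
  have "{x \<in> topspace X. f x \<in> \<Union>\<K>} = \<Union>((\<lambda>K. {x \<in> topspace X. f x \<in> K}) ` \<K>)"
    by auto
  moreover have "openin X (\<Union>((\<lambda>K. {x \<in> topspace X. f x \<in> K}) ` \<K>))"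
    by (rule openin_Union) (use \<K> in auto)
  ultimately show "openin X {x \<in> topspace X. f x \<in> \<Union>\<K>}"
    by simp
  show "\<Union>\<K> \<subseteq> f ` topspace X"
    using \<K> by (simp add: Sup_le_iff)
qed

lemma openin_quotient_topology:
  "openin (quotient_topology X f) V \<longleftrightarrow>
     V \<subseteq> f ` topspace X \<and> openin X {x \<in> topspace X. f x \<in> V}"
  unfolding quotient_topology_def topology_inverse'[OF istopology_quotient_topology] ..

lemma topspace_quotient_topology [simp]:
  "topspace (quotient_topology X f) = f ` topspace X"
proof (rule subset_antisym)
  show "topspace (quotient_topology X f) \<subseteq> f ` topspace X"
    using openin_topspace[of "quotient_topology X f"] unfolding openin_quotient_topology by (rule conjunct1)
  have "{x \<in> topspace X. f x \<in> f ` topspace X} = topspace X"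
    by auto
  then have "openin (quotient_topology X f) (f ` topspace X)"
    unfolding openin_quotient_topology by simp
  then show "f ` topspace X \<subseteq> topspace (quotient_topology X f)"
    by (rule openin_subset)
qed

lemma quotient_map_quotient_topology: "quotient_map X (quotient_topology X f) f"
  unfolding quotient_map_def openin_quotient_topology topspace_quotient_topology by blast


section \<open>Local transformations and pseudogroups\<close>

text \<open>A local transformation of \<open>T\<close> is a partial function \<open>h\<close>; its domain and image are
  \<open>dom h\<close> and \<open>ran h\<close>, the composite of partial functions is \<open>h' \<circ>\<^sub>m h\<close>, with domain
  \<open>h\<inverse>(im h \<inter> dom h')\<close>, and restriction is \<open>h |` V\<close>.\<close>

definition loct :: "'t topology \<Rightarrow> ('t \<rightharpoonup> 't) set" where
  "loct T = {h. openin T (dom h) \<and> openin T (ran h) \<and>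
     homeomorphic_map (subtopology T (dom h)) (subtopology T (ran h)) (the \<circ> h)}"

definition lid :: "'t topology \<Rightarrow> 't \<rightharpoonup> 't" where
  "lid T = (\<lambda>x. if x \<in> topspace T then Some x else None)"

definition linv :: "('t \<rightharpoonup> 't) \<Rightarrow> ('t \<rightharpoonup> 't)" where
  "linv h = (\<lambda>y. if y \<in> ran h then Some (THE x. h x = Some y) else None)"

definition pseudo_star_group :: "'t topology \<Rightarrow> ('t \<rightharpoonup> 't) set \<Rightarrow> bool" where
  "pseudo_star_group T S \<longleftrightarrow>
     S \<subseteq> loct T \<and> (\<forall>h\<in>S. \<forall>h'\<in>S. h' \<circ>\<^sub>m h \<in> S) \<and> (\<forall>h\<in>S. linv h \<in> S)"

definition restriction_closed :: "'t topology \<Rightarrow> ('t \<rightharpoonup> 't) set \<Rightarrow> bool" where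
  "restriction_closed T S \<longleftrightarrow> (\<forall>h\<in>S. \<forall>V. openin T V \<and> V \<subseteq> dom h \<longrightarrow> h |` V \<in> S)"

definition local_pseudo_star_group :: "'t topology \<Rightarrow> ('t \<rightharpoonup> 't) set \<Rightarrow> bool" where
  "local_pseudo_star_group T S \<longleftrightarrow> pseudo_star_group T S \<and> restriction_closed T S"

definition pseudogroup :: "'t topology \<Rightarrow> ('t \<rightharpoonup> 't) set \<Rightarrow> bool" where
  "pseudogroup T H \<longleftrightarrow>
     local_pseudo_star_group T H \<and> lid T \<in> H \<and>
     (\<forall>h\<in>loct T. (\<exists>C\<subseteq>H. Map.graph h = (\<Union>f\<in>C. Map.graph f)) \<longrightarrow> h \<in> H)"

definition generated_pseudogroup :: "'t topology \<Rightarrow> ('t \<rightharpoonup> 't) set \<Rightarrow> ('t \<rightharpoonup> 't) set" where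
  "generated_pseudogroup T G = \<Inter>{P. pseudogroup T P \<and> G \<subseteq> P}"

definition generating_sub_pseudo_star_group ::
  "'t topology \<Rightarrow> ('t \<rightharpoonup> 't) set \<Rightarrow> ('t \<rightharpoonup> 't) set \<Rightarrow> bool" where
  "generating_sub_pseudo_star_group T H S \<longleftrightarrow>
     pseudo_star_group T S \<and> S \<subseteq> H \<and> generated_pseudogroup T S = H"

definition pg_restrict :: "('t \<rightharpoonup> 't) set \<Rightarrow> 't set \<Rightarrow> ('t \<rightharpoonup> 't) set" where
  "pg_restrict H V = {h \<in> H. dom h \<union> ran h \<subseteq> V}"

definition orbit :: "('t \<rightharpoonup> 't) set \<Rightarrow> 't \<Rightarrow> 't set" where
  "orbit H x = {y. \<exists>h\<in>H. h x = Some y}"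

definition minimal_pseudogroup :: "'t topology \<Rightarrow> ('t \<rightharpoonup> 't) set \<Rightarrow> bool" where
  "minimal_pseudogroup T H \<longleftrightarrow> (\<forall>x\<in>topspace T. T closure_of orbit H x = topspace T)"

definition compactly_generated_with ::
  "'t topology \<Rightarrow> ('t \<rightharpoonup> 't) set \<Rightarrow> 't set \<Rightarrow> bool" where
  "compactly_generated_with T H V \<longleftrightarrow>
     openin T V \<and> compactin T (T closure_of V) \<and>
     (\<forall>x\<in>topspace T. orbit H x \<inter> V \<noteq> {}) \<and>
     (\<exists>G. finite G \<and> G \<subseteq> pg_restrict H V \<and>
        generated_pseudogroup (subtopology T V) G = pg_restrict H V \<and>
        (\<forall>g\<in>G. \<exists>g'\<in>H. T closure_of dom g \<subseteq> dom g' \<and> g = g' |` dom g))"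

definition strongly_quasi_analytic_with ::
  "'t topology \<Rightarrow> ('t \<rightharpoonup> 't) set \<Rightarrow> ('t \<rightharpoonup> 't) set \<Rightarrow> bool" where
  "strongly_quasi_analytic_with T H S \<longleftrightarrow>
     generating_sub_pseudo_star_group T H S \<and>
     (\<forall>h\<in>S. (\<exists>V. openin T V \<and> V \<noteq> {} \<and> V \<subseteq> dom h \<and> (\<forall>x\<in>V. h x = Some x)) \<longrightarrow>
        (\<forall>x\<in>dom h. h x = Some x))"

definition strongly_quasi_analytic :: "'t topology \<Rightarrow> ('t \<rightharpoonup> 't) set \<Rightarrow> bool" where
  "strongly_quasi_analytic T H \<longleftrightarrow> (\<exists>S. strongly_quasi_analytic_with T H S)"


section \<open>Equicontinuity\<close>

text \<open>A family \<open>{T\<^sub>i, d\<^sub>i}\<close> of metric spaces is given as the set \<open>\<C>\<close> of its members; all the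
  conditions depend only on the members. The topologies of \<open>d\<^sub>i\<close> and \<open>d\<^sub>j\<close> on \<open>T\<^sub>i \<inter> T\<^sub>j\<close> agree as
  a consequence of the last condition for \<open>(i, j)\<close> and \<open>(j, i)\<close>, so it does not matter with
  respect to which of them the neighbourhoods \<open>N\<close> are open.\<close>

definition quasi_locally_equal_cover :: "'t set \<Rightarrow> 't metric set \<Rightarrow> bool" where
  "quasi_locally_equal_cover A \<C> \<longleftrightarrow>
     (\<Union>m\<in>\<C>. mspace m) = A \<and>
     (\<forall>m\<in>\<C>. \<forall>m'\<in>\<C>. openin (mtopology_of m) (mspace m \<inter> mspace m') \<and>
                      openin (mtopology_of m') (mspace m \<inter> mspace m')) \<and>
     (\<exists>\<delta> :: real \<Rightarrow> real. (\<forall>\<epsilon>>0. \<delta> \<epsilon> > 0) \<and>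
        (\<forall>m\<in>\<C>. \<forall>m'\<in>\<C>. \<forall>z \<in> mspace m \<inter> mspace m'.
           \<exists>N. openin (mtopology_of m) N \<and> z \<in> N \<and> N \<subseteq> mspace m \<inter> mspace m' \<and>
              (\<forall>\<epsilon>>0. \<forall>x\<in>N. \<forall>y\<in>N. mdist m x y < \<delta> \<epsilon> \<longrightarrow> mdist m' x y < \<epsilon>)))"

definition cover_induces_topology :: "'t topology \<Rightarrow> 't metric set \<Rightarrow> bool" where
  "cover_induces_topology T \<C> \<longleftrightarrow>
     openin T = arbitrary union_of (\<lambda>B. \<exists>m\<in>\<C>. \<exists>x\<in>mspace m. \<exists>r>0. B = mball_of m x r)"

definition equicontinuous_with ::
  "'t topology \<Rightarrow> ('t \<rightharpoonup> 't) set \<Rightarrow> 't metric set \<Rightarrow> ('t \<rightharpoonup> 't) set \<Rightarrow> bool" where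
  "equicontinuous_with T H \<C> S \<longleftrightarrow>
     quasi_locally_equal_cover (topspace T) \<C> \<and> cover_induces_topology T \<C> \<and>
     generating_sub_pseudo_star_group T H S \<and>
     (\<forall>\<epsilon>>0. \<exists>\<delta>>0. \<forall>h\<in>S. \<forall>m\<in>\<C>. \<forall>m'\<in>\<C>. \<forall>x y x' y'.
        x \<in> mspace m \<and> y \<in> mspace m \<and> h x = Some x' \<and> h y = Some y' \<and>
        x' \<in> mspace m' \<and> y' \<in> mspace m' \<and> mdist m x y < \<delta> \<longrightarrow> mdist m' x' y' < \<epsilon>)"

definition equicontinuous_pseudogroup :: "'t topology \<Rightarrow> ('t \<rightharpoonup> 't) set \<Rightarrow> bool" where
  "equicontinuous_pseudogroup T H \<longleftrightarrow> (\<exists>\<C> S. equicontinuous_with T H \<C> S)"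


section \<open>The closure of a pseudogroup\<close>

text \<open>\<open>co_topology T \<A>\<close> is the topology on a set \<open>\<A>\<close> of partial functions with subbasis
  \<open>{h \<in> \<A> | K \<subseteq> dom h, h(K) \<subseteq> V}\<close>, where \<open>K\<close> is compact and \<open>V\<close> is open in \<open>T\<close>. If \<open>\<A>\<close> is the
  set \<open>C(Q,T)\<close> of continuous maps with domain \<open>Q\<close>, this is the compact-open topology.\<close>

definition co_topology :: "'t topology \<Rightarrow> ('t \<rightharpoonup> 't) set \<Rightarrow> ('t \<rightharpoonup> 't) topology" where
  "co_topology T \<A> = topology_generated_by
     {{h \<in> \<A>. \<forall>x\<in>K. \<exists>y\<in>V. h x = Some y} | K V. compactin T K \<and> openin T V}"

definition cmaps :: "'t topology \<Rightarrow> 't set \<Rightarrow> ('t \<rightharpoonup> 't) set" where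
  "cmaps T Q = {f. dom f = Q \<and> continuous_map (subtopology T Q) T (the \<circ> f)}"

text \<open>\<open>closure_pseudogroup T S\<close> and \<open>closure_star T S\<close> are the pseudogroup and the
  pseudo\<open>*\<close>group usually written as an overlined \<open>\<H>\<close> and an overlined \<open>S\<close>.\<close>

definition closure_pseudogroup :: "'t topology \<Rightarrow> ('t \<rightharpoonup> 't) set \<Rightarrow> ('t \<rightharpoonup> 't) set" where
  "closure_pseudogroup T S = {h \<in> loct T. \<forall>x\<in>dom h. \<exists>Q. openin T Q \<and> x \<in> Q \<and> Q \<subseteq> dom h \<and>
     h |` Q \<in> co_topology T (cmaps T Q) closure_of {f \<in> S. dom f = Q}}"

definition closure_star :: "'t topology \<Rightarrow> ('t \<rightharpoonup> 't) set \<Rightarrow> ('t \<rightharpoonup> 't) set" where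
  "closure_star T S = {h \<in> loct T. \<exists>Q. openin T Q \<and>
     h \<in> co_topology T (cmaps T Q) closure_of {f \<in> S. dom f = Q}}"

definition has_strongly_quasi_analytic_closure :: "'t topology \<Rightarrow> ('t \<rightharpoonup> 't) set \<Rightarrow> bool" where
  "has_strongly_quasi_analytic_closure T H \<longleftrightarrow>
     (\<exists>V. compactly_generated_with T H V) \<and>
     (\<exists>\<C> S. equicontinuous_with T H \<C> S \<and> strongly_quasi_analytic_with T H S \<and>
        strongly_quasi_analytic T (closure_pseudogroup T S))"


section \<open>Germs and the space of germs over a base point\<close>

text \<open>The germ of \<open>h\<close> at \<open>x\<close> is the class of all \<open>(f, x)\<close> with \<open>f\<close> equal to \<open>h\<close> near \<open>x\<close>.\<close>

definition germ :: "'t topology \<Rightarrow> ('t \<rightharpoonup> 't) \<Rightarrow> 't \<Rightarrow> (('t \<rightharpoonup> 't) \<times> 't) set" where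
  "germ T h x = {(f, y). y = x \<and> f \<in> loct T \<and> x \<in> dom f \<and>
     (\<exists>V. openin T V \<and> x \<in> V \<and> (\<forall>z\<in>V. f z = h z))}"

definition germ_source :: "(('t \<rightharpoonup> 't) \<times> 't) set \<Rightarrow> 't" where
  "germ_source \<gamma> = (THE x. \<exists>f. (f, x) \<in> \<gamma>)"

text \<open>The choices of \<open>V\<close>, \<open>\<C>\<close> and \<open>S\<close> from which the space of germs based at \<open>t\<close> is
  constructed.\<close>

definition admissible_choice ::
  "'t topology \<Rightarrow> ('t \<rightharpoonup> 't) set \<Rightarrow> 't \<Rightarrow> 't set \<Rightarrow> 't metric set \<Rightarrow> ('t \<rightharpoonup> 't) set \<Rightarrow> bool" where
  "admissible_choice T H t V \<C> S \<longleftrightarrow>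
     t \<in> V \<and> compactly_generated_with T H V \<and>
     local_pseudo_star_group T S \<and>
     equicontinuous_with T H \<C> S \<and>
     strongly_quasi_analytic_with T H S \<and>
     (\<exists>\<D>\<subseteq>\<C>. finite \<D> \<and> T closure_of V \<subseteq> (\<Union>m\<in>\<D>. mspace m) \<and>
        (\<forall>m\<in>\<D>.
           co_topology T (cmaps T (mspace m)) closure_of
             {h \<in> S. dom h = mspace m \<and> ran h \<inter> T closure_of V \<noteq> {}} \<subseteq> closure_star T S \<and>
           (\<forall>h\<in>closure_pseudogroup T S. \<forall>x\<in>mspace m \<inter> V. \<forall>y\<in>V. h x = Some y \<longrightarrow>
              (\<exists>h'\<in>closure_star T S. dom h' = mspace m \<and> germ T h' x = germ T h x)))) \<and>
     strongly_quasi_analytic_with T (closure_pseudogroup T S) (closure_star T S)"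

definition germ_space :: "'t topology \<Rightarrow> ('t \<rightharpoonup> 't) set \<Rightarrow> (('t \<rightharpoonup> 't) \<times> 't) set topology" where
  "germ_space T S = quotient_topology
     (subtopology (prod_topology (co_topology T (closure_star T S)) T) {(f, x). x \<in> dom f})
     (\<lambda>(f, x). germ T f x)"

definition germ_space_at ::
  "'t topology \<Rightarrow> ('t \<rightharpoonup> 't) set \<Rightarrow> 't \<Rightarrow> (('t \<rightharpoonup> 't) \<times> 't) set topology" where
  "germ_space_at T S t = subtopology (germ_space T S)
     {germ T g x | g x. g \<in> closure_pseudogroup T S \<and> g x = Some t}"

text \<open>The map \<open>\<gamma>(g,x) \<mapsto> \<gamma>(g h\<inverse>, h(x))\<close>, which does not depend on the representative \<open>(g,x)\<close>;
  it is meaningful only on germs with source in \<open>dom h\<close>.\<close>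

definition germ_lift ::
  "'t topology \<Rightarrow> ('t \<rightharpoonup> 't) \<Rightarrow> (('t \<rightharpoonup> 't) \<times> 't) set \<Rightarrow> (('t \<rightharpoonup> 't) \<times> 't) set" where
  "germ_lift T h \<gamma> = (case (SOME p. p \<in> \<gamma>) of (g, x) \<Rightarrow> germ T (g \<circ>\<^sub>m linv h) (the (h x)))"


section \<open>Foliated spaces\<close>

text \<open>Euclidean space of dimension \<open>n\<close> (\<open>n = 0\<close> included) is \<open>Euclidean_space n\<close>, the set of
  real sequences vanishing from the index \<open>n\<close> on.\<close>

definition euclidean_ball :: "nat \<Rightarrow> (nat \<Rightarrow> real) \<Rightarrow> real \<Rightarrow> (nat \<Rightarrow> real) set" where
  "euclidean_ball n c r = {x \<in> topspace (Euclidean_space n). sqrt (\<Sum>k<n. (x k - c k)\<^sup>2) < r}"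

type_synonym ('x, 'z) chart = "'x set \<times> ('x \<Rightarrow> (nat \<Rightarrow> real) \<times> 'z)"

definition foliated_chart :: "'x topology \<Rightarrow> nat \<Rightarrow> 'z topology \<Rightarrow> ('x, 'z) chart \<Rightarrow> bool" where
  "foliated_chart X n Z = (\<lambda>(U, \<phi>). openin X U \<and>
     (\<exists>c r A. c \<in> topspace (Euclidean_space n) \<and> 0 < r \<and> openin Z A \<and>
        homeomorphic_map (subtopology X U)
          (prod_topology (subtopology (Euclidean_space n) (euclidean_ball n c r)) (subtopology Z A))
          \<phi>))"

definition plaques :: "('x, 'z) chart \<Rightarrow> 'x set set" where
  "plaques = (\<lambda>(U, \<phi>). {{x \<in> U. snd (\<phi> x) = y} | y. y \<in> (snd \<circ> \<phi>) ` U})"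

definition compatible_charts :: "'x topology \<Rightarrow> ('x, 'z) chart \<Rightarrow> ('x, 'z) chart \<Rightarrow> bool" where
  "compatible_charts X c c' \<longleftrightarrow>
     (\<forall>P\<in>plaques c. \<forall>P'\<in>plaques c'.
        openin (subtopology X P) (P \<inter> P') \<and> openin (subtopology X P') (P \<inter> P'))"

definition foliated_atlas :: "'x topology \<Rightarrow> nat \<Rightarrow> 'z topology \<Rightarrow> ('x, 'z) chart set \<Rightarrow> bool" where
  "foliated_atlas X n Z A \<longleftrightarrow>
     (\<forall>c\<in>A. foliated_chart X n Z c) \<and> (\<Union>c\<in>A. fst c) = topspace X \<and>
     (\<forall>c\<in>A. \<forall>c'\<in>A. compatible_charts X c c')"

definition foliated_structure ::
  "'x topology \<Rightarrow> nat \<Rightarrow> 'z topology \<Rightarrow> ('x, 'z) chart set \<Rightarrow> bool" where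
  "foliated_structure X n Z F \<longleftrightarrow>
     foliated_atlas X n Z F \<and> (\<forall>A. foliated_atlas X n Z A \<and> F \<subseteq> A \<longrightarrow> A = F)"

text \<open>The maximal atlas containing an atlas \<open>A\<close>.\<close>

definition structure_of_atlas ::
  "'x topology \<Rightarrow> nat \<Rightarrow> 'z topology \<Rightarrow> ('x, 'z) chart set \<Rightarrow> ('x, 'z) chart set" where
  "structure_of_atlas X n Z A =
     {c. foliated_chart X n Z c \<and> (\<forall>a\<in>A. compatible_charts X c a)}"

definition leaf_topology :: "('x, 'z) chart set \<Rightarrow> 'x topology" where
  "leaf_topology F = topology_generated_by (\<Union>c\<in>F. plaques c)"

definition leaves :: "('x, 'z) chart set \<Rightarrow> 'x set set" where
  "leaves F = connected_components_of (leaf_topology F)"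

definition foliated_map ::
  "'x topology \<Rightarrow> ('x, 'z) chart set \<Rightarrow> 'y topology \<Rightarrow> ('y, 'w) chart set \<Rightarrow> ('x \<Rightarrow> 'y) \<Rightarrow> bool" where
  "foliated_map X F Y G f \<longleftrightarrow>
     continuous_map X Y f \<and> (\<forall>L\<in>leaves F. \<exists>L'\<in>leaves G. f ` L \<subseteq> L')"

definition foliated_homeomorphism ::
  "'x topology \<Rightarrow> ('x, 'z) chart set \<Rightarrow> 'y topology \<Rightarrow> ('y, 'w) chart set \<Rightarrow> ('x \<Rightarrow> 'y) \<Rightarrow> bool" where
  "foliated_homeomorphism X F Y G f \<longleftrightarrow>
     (\<exists>g. homeomorphic_maps X Y f g \<and> foliated_map X F Y G f \<and> foliated_map Y G X F g)"

text \<open>A regular atlas of the foliated structure \<open>F\<close>, as a family of charts \<open>(U i, \<phi> i)\<close>. The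
  distinguished submersion of the chart \<open>i\<close> is \<open>snd \<circ> \<phi> i\<close>.\<close>

definition regular_foliated_atlas ::
  "'x topology \<Rightarrow> ('x, 'z) chart set \<Rightarrow> 'i set \<Rightarrow>
   ('i \<Rightarrow> 'x set) \<Rightarrow> ('i \<Rightarrow> 'x \<Rightarrow> (nat \<Rightarrow> real) \<times> 'z) \<Rightarrow> bool" where
  "regular_foliated_atlas X F I U \<phi> \<longleftrightarrow>
     (\<forall>i\<in>I. (U i, \<phi> i) \<in> F) \<and> (\<Union>i\<in>I. U i) = topspace X \<and>
     (\<forall>i\<in>I. compactin X (X closure_of U i) \<and>
        (\<exists>(W, \<psi>)\<in>F. X closure_of U i \<subseteq> W \<and> (\<forall>x\<in>U i. \<phi> i x = \<psi> x))) \<and>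
     (\<forall>x\<in>topspace X. \<exists>N. openin X N \<and> x \<in> N \<and> finite {i \<in> I. U i \<inter> N \<noteq> {}}) \<and>
     (\<forall>i\<in>I. \<forall>j\<in>I. \<forall>P\<in>plaques (U i, \<phi> i). \<forall>P'\<in>plaques (U j, \<phi> j). \<forall>P''\<in>plaques (U j, \<phi> j).
        P \<inter> P' \<noteq> {} \<and> P \<inter> P'' \<noteq> {} \<longrightarrow> P' = P'')"

text \<open>\<open>(snd \<circ> \<phi> i) ` (U i \<inter> U j)\<close> is \<open>T\<^sub>i\<^sub>j\<close>.\<close>

definition defining_cocycle ::
  "'z topology \<Rightarrow> 'i set \<Rightarrow> ('i \<Rightarrow> 'x set) \<Rightarrow> ('i \<Rightarrow> 'x \<Rightarrow> (nat \<Rightarrow> real) \<times> 'z) \<Rightarrow>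
   ('i \<Rightarrow> 'i \<Rightarrow> 'z \<Rightarrow> 'z) \<Rightarrow> bool" where
  "defining_cocycle Z I U \<phi> h \<longleftrightarrow>
     (\<forall>i\<in>I. \<forall>j\<in>I.
        homeomorphic_map (subtopology Z ((snd \<circ> \<phi> i) ` (U i \<inter> U j)))
                         (subtopology Z ((snd \<circ> \<phi> j) ` (U i \<inter> U j))) (h i j) \<and>
        (\<forall>x\<in>U i \<inter> U j. h i j (snd (\<phi> i x)) = snd (\<phi> j x)))"

text \<open>The disjoint union of the \<open>T\<^sub>i\<close> consists of the pairs \<open>(i, y)\<close> with \<open>y \<in> T\<^sub>i\<close>;
  \<open>cocycle_map\<close> is \<open>h\<^sub>i\<^sub>j\<close> as a local transformation of it.\<close>

definition transversal ::
  "'z topology \<Rightarrow> 'i set \<Rightarrow> ('i \<Rightarrow> 'x set) \<Rightarrow> ('i \<Rightarrow> 'x \<Rightarrow> (nat \<Rightarrow> real) \<times> 'z) \<Rightarrow>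
   ('i \<times> 'z) topology" where
  "transversal Z I U \<phi> = sum_topology (\<lambda>i. subtopology Z ((snd \<circ> \<phi> i) ` U i)) I"

definition cocycle_map ::
  "('i \<Rightarrow> 'x set) \<Rightarrow> ('i \<Rightarrow> 'x \<Rightarrow> (nat \<Rightarrow> real) \<times> 'z) \<Rightarrow> ('i \<Rightarrow> 'i \<Rightarrow> 'z \<Rightarrow> 'z) \<Rightarrow>
   'i \<Rightarrow> 'i \<Rightarrow> ('i \<times> 'z) \<rightharpoonup> ('i \<times> 'z)" where
  "cocycle_map U \<phi> h i j = (\<lambda>(k, y).
     if k = i \<and> y \<in> (snd \<circ> \<phi> i) ` (U i \<inter> U j) then Some (j, h i j y) else None)"

definition holonomy_pseudogroup ::
  "'z topology \<Rightarrow> 'i set \<Rightarrow> ('i \<Rightarrow> 'x set) \<Rightarrow> ('i \<Rightarrow> 'x \<Rightarrow> (nat \<Rightarrow> real) \<times> 'z) \<Rightarrow>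
   ('i \<Rightarrow> 'i \<Rightarrow> 'z \<Rightarrow> 'z) \<Rightarrow> (('i \<times> 'z) \<rightharpoonup> ('i \<times> 'z)) set" where
  "holonomy_pseudogroup Z I U \<phi> h =
     generated_pseudogroup (transversal Z I U \<phi>) {cocycle_map U \<phi> h i j | i j. i \<in> I \<and> j \<in> I}"


section \<open>The foliated space over a base point\<close>

text \<open>All constructions below depend on a topology \<open>E\<close>, which is meant to be the space of germs
  \<open>germ_space_at (transversal Z I U \<phi>) S t\<close>. A triple \<open>(x, \<gamma>, i)\<close> is written \<open>(i, x, \<gamma>)\<close>, in
  the order of \<open>sum_topology\<close>.\<close>

type_synonym ('i, 'z) trgerm = "((('i \<times> 'z) \<rightharpoonup> ('i \<times> 'z)) \<times> ('i \<times> 'z)) set"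

definition check_space ::
  "'x topology \<Rightarrow> 'i set \<Rightarrow> ('i \<Rightarrow> 'x set) \<Rightarrow> ('i \<Rightarrow> 'x \<Rightarrow> (nat \<Rightarrow> real) \<times> 'z) \<Rightarrow>
   ('i, 'z) trgerm topology \<Rightarrow> ('i \<times> 'x \<times> ('i, 'z) trgerm) topology" where
  "check_space X I U \<phi> E = sum_topology
     (\<lambda>i. prod_topology (subtopology X (U i))
            (subtopology E {\<gamma> \<in> topspace E. germ_source \<gamma> \<in> {i} \<times> (snd \<circ> \<phi> i) ` U i})) I"

definition tilde_space ::
  "'x topology \<Rightarrow> 'i set \<Rightarrow> ('i \<Rightarrow> 'x set) \<Rightarrow> ('i \<Rightarrow> 'x \<Rightarrow> (nat \<Rightarrow> real) \<times> 'z) \<Rightarrow>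
   ('i, 'z) trgerm topology \<Rightarrow> ('i \<times> 'x \<times> ('i, 'z) trgerm) topology" where
  "tilde_space X I U \<phi> E =
     subtopology (check_space X I U \<phi> E) {(i, x, \<gamma>). (i, snd (\<phi> i x)) = germ_source \<gamma>}"

definition tilde_rel ::
  "'x topology \<Rightarrow> 'z topology \<Rightarrow> 'i set \<Rightarrow> ('i \<Rightarrow> 'x set) \<Rightarrow> ('i \<Rightarrow> 'x \<Rightarrow> (nat \<Rightarrow> real) \<times> 'z) \<Rightarrow>
   ('i \<Rightarrow> 'i \<Rightarrow> 'z \<Rightarrow> 'z) \<Rightarrow> ('i, 'z) trgerm topology \<Rightarrow> ('i \<times> 'x \<times> ('i, 'z) trgerm) rel" where
  "tilde_rel X Z I U \<phi> h E =
     {((i, x, \<gamma>), (j, y, \<delta>)). (i, x, \<gamma>) \<in> topspace (tilde_space X I U \<phi> E) \<and>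
        (j, y, \<delta>) \<in> topspace (tilde_space X I U \<phi> E) \<and>
        x = y \<and> \<gamma> = germ_lift (transversal Z I U \<phi>) (cocycle_map U \<phi> h j i) \<delta>}"

definition hat_class ::
  "'x topology \<Rightarrow> 'z topology \<Rightarrow> 'i set \<Rightarrow> ('i \<Rightarrow> 'x set) \<Rightarrow> ('i \<Rightarrow> 'x \<Rightarrow> (nat \<Rightarrow> real) \<times> 'z) \<Rightarrow>
   ('i \<Rightarrow> 'i \<Rightarrow> 'z \<Rightarrow> 'z) \<Rightarrow> ('i, 'z) trgerm topology \<Rightarrow>
   'i \<times> 'x \<times> ('i, 'z) trgerm \<Rightarrow> ('i \<times> 'x \<times> ('i, 'z) trgerm) set" where
  "hat_class X Z I U \<phi> h E p = tilde_rel X Z I U \<phi> h E `` {p}"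

definition hat_space ::
  "'x topology \<Rightarrow> 'z topology \<Rightarrow> 'i set \<Rightarrow> ('i \<Rightarrow> 'x set) \<Rightarrow> ('i \<Rightarrow> 'x \<Rightarrow> (nat \<Rightarrow> real) \<times> 'z) \<Rightarrow>
   ('i \<Rightarrow> 'i \<Rightarrow> 'z \<Rightarrow> 'z) \<Rightarrow> ('i, 'z) trgerm topology \<Rightarrow>
   ('i \<times> 'x \<times> ('i, 'z) trgerm) set topology" where
  "hat_space X Z I U \<phi> h E =
     quotient_topology (tilde_space X I U \<phi> E) (hat_class X Z I U \<phi> h E)"

definition hat_proj :: "('i \<times> 'x \<times> ('i, 'z) trgerm) set \<Rightarrow> 'x" where
  "hat_proj \<xi> = (THE x. \<exists>i \<gamma>. (i, x, \<gamma>) \<in> \<xi>)"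

text \<open>The foliated chart with plaques the fibres of the submersion \<open>[x, \<gamma>, i] \<mapsto> \<gamma>\<close>, whose
  first component is that of \<open>\<phi> i\<close>. Every class contains at most one triple with a given \<open>i\<close>.\<close>

definition hat_chart ::
  "'x topology \<Rightarrow> 'z topology \<Rightarrow> 'i set \<Rightarrow> ('i \<Rightarrow> 'x set) \<Rightarrow> ('i \<Rightarrow> 'x \<Rightarrow> (nat \<Rightarrow> real) \<times> 'z) \<Rightarrow>
   ('i \<Rightarrow> 'i \<Rightarrow> 'z \<Rightarrow> 'z) \<Rightarrow> ('i, 'z) trgerm topology \<Rightarrow> 'i \<Rightarrow>
   (('i \<times> 'x \<times> ('i, 'z) trgerm) set, ('i, 'z) trgerm) chart" where
  "hat_chart X Z I U \<phi> h E i =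
     ({hat_class X Z I U \<phi> h E (i, x, \<gamma>) | x \<gamma>. (i, x, \<gamma>) \<in> topspace (tilde_space X I U \<phi> E)},
      \<lambda>\<xi>. case (THE (x, \<gamma>). (i, x, \<gamma>) \<in> \<xi>) of (x, \<gamma>) \<Rightarrow> (fst (\<phi> i x), \<gamma>))"

text \<open>The foliated structure with defining cocycle given by the submersions \<open>[x, \<gamma>, i] \<mapsto> \<gamma>\<close>.\<close>

definition hat_structure ::
  "'x topology \<Rightarrow> nat \<Rightarrow> 'z topology \<Rightarrow> 'i set \<Rightarrow> ('i \<Rightarrow> 'x set) \<Rightarrow>
   ('i \<Rightarrow> 'x \<Rightarrow> (nat \<Rightarrow> real) \<times> 'z) \<Rightarrow> ('i \<Rightarrow> 'i \<Rightarrow> 'z \<Rightarrow> 'z) \<Rightarrow> ('i, 'z) trgerm topology \<Rightarrow>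
   (('i \<times> 'x \<times> ('i, 'z) trgerm) set, ('i, 'z) trgerm) chart set" where
  "hat_structure X n Z I U \<phi> h E =
     structure_of_atlas (hat_space X Z I U \<phi> h E) n E (hat_chart X Z I U \<phi> h E ` I)"

end

theory Submission
  imports Defs
begin

text \<open>By minimality and equicontinuity the closure of the holonomy pseudogroup contains some \<open>f\<close>
  with \<open>f(t\<^sub>0) = t\<^sub>1\<close>, and \<open>\<gamma>(g, x) \<mapsto> \<gamma>(f g, x)\<close> is then a homeomorphism between the spaces of germs
  based at \<open>t\<^sub>0\<close> and \<open>t\<^sub>1\<close> which preserves sources and commutes with the lifts of the holonomy maps;
  hence it induces a homeomorphism of the foliated spaces. The main difficulty is that the two spaces
  are built from different choices \<open>S\<^sub>0\<close> and \<open>S\<^sub>1\<close>. Both are compared with \<open>S\<^sub>0 \<inter> S\<^sub>1\<close>, which still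
  generates the pseudogroup. Compact generation and equicontinuity extend every germ of the pseudogroup to
  an element of \<open>S\<^sub>0 \<inter> S\<^sub>1\<close> on a domain of uniform size, and quasi-analyticity identifies an element of
  \<open>S\<^sub>0\<close> or \<open>S\<^sub>1\<close> with such an extension on a neighbourhood of uniform size. So the three closures have
  the same germs and define the same topology on them.\<close>

text \<open>Generation is used only through germs: a germ of a generated pseudogroup is a word in
  germs of the generators and their inverses. This makes \<open>S0 \<inter> S1\<close> usable. Both
  choices are closed under restriction, so representatives in \<open>S0\<close> and
  \<open>S1\<close> of one germ have a common restriction, which lies in both. The approximants of
  an element of \<open>closure_star T S\<close> have exactly its domain, and nothing makes an
  approximant in \<open>S0\<close> an element of \<open>S1\<close>. Hence closures are compared only
  after restriction to a small open set, which changes neither the germs nor, near a given germ, the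
  topology. The metrics of the cover are comparable only near common points, so all sizes are
  measured by one auxiliary metric \<open>d\<close> of \<open>T\<close>. The price is that
  equicontinuity in terms of \<open>d\<close> holds only for images already known to be closer than
  a fixed \<open>\<epsilon>0\<close>; each construction first secures this crude bound and then
  sharpens it. A limit of homeomorphisms need not be injective or open, so sequences are taken to
  the limit together with their inverses, along the same indices.\<close>

section \<open>Local transformations\<close>

text \<open>This form avoids subtopologies and \<open>the\<close>: preimages and images are sets of
  points related by \<open>h x = Some y\<close>, which unfold well under
  \<open>\<circ>\<^sub>m\<close>, \<open>linv\<close> and restriction. Taking
  \<open>V = topspace T\<close> recovers openness of \<open>dom h\<close> and
  \<open>ran h\<close>.\<close>

lemma loct_iff:
  "h \<in> loct T \<longleftrightarrow> dom h \<subseteq> topspace T \<and> ran h \<subseteq> topspace T \<and>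
     (\<forall>x x' y. h x = Some y \<longrightarrow> h x' = Some y \<longrightarrow> x = x') \<and>
     (\<forall>V. openin T V \<longrightarrow> openin T {x. \<exists>y\<in>V. h x = Some y}) \<and>
     (\<forall>V. openin T V \<longrightarrow> openin T {y. \<exists>x\<in>V. h x = Some y})" (is "_ \<longleftrightarrow> ?R")
proof
  assume h: "h \<in> loct T"
  let ?f = "the \<circ> h"
  have od: "openin T (dom h)" and oran: "openin T (ran h)"
    and hm: "homeomorphic_map (subtopology T (dom h)) (subtopology T (ran h)) ?f"
    using h by (auto simp: loct_def)
  have sub: "dom h \<subseteq> topspace T" "ran h \<subseteq> topspace T"
    using od oran by (auto dest: openin_subset)
  have inj: "inj_on ?f (dom h)"
    using homeomorphic_imp_injective_map[OF hm] sub by (simp add: topspace_subtopology inf.absorb2)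
  have cont: "continuous_map (subtopology T (dom h)) (subtopology T (ran h)) ?f"
    and opn: "open_map (subtopology T (dom h)) (subtopology T (ran h)) ?f"
    using hm by (auto intro: homeomorphic_imp_continuous_map homeomorphic_imp_open_map)
  show ?R
  proof (intro conjI allI impI sub)
    fix x x' y assume "h x = Some y" "h x' = Some y"
    then show "x = x'" using inj_onD[OF inj, of x x'] by (simp add: domI)
  next
    fix V assume V: "openin T V"
    have "openin (subtopology T (ran h)) (ran h \<inter> V)"
      by (rule openin_subtopology_Int2[OF V])
    then have "openin (subtopology T (dom h)) {x \<in> topspace (subtopology T (dom h)). ?f x \<in> ran h \<inter> V}"
      using cont openin_continuous_map_preimage by blast
    moreover have "{x \<in> topspace (subtopology T (dom h)). ?f x \<in> ran h \<inter> V} = {x. \<exists>y\<in>V. h x = Some y}"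
      using sub by (auto simp: ran_def)
    ultimately show "openin T {x. \<exists>y\<in>V. h x = Some y}"
      using openin_trans_full[OF _ od] by simp
  next
    fix V assume V: "openin T V"
    have "openin (subtopology T (dom h)) (dom h \<inter> V)"
      by (rule openin_subtopology_Int2[OF V])
    then have "openin (subtopology T (ran h)) (?f ` (dom h \<inter> V))"
      using opn by (auto simp: open_map_def)
    moreover have "?f ` (dom h \<inter> V) = {y. \<exists>x\<in>V. h x = Some y}"
      by (force simp: image_iff)
    ultimately show "openin T {y. \<exists>x\<in>V. h x = Some y}"
      using openin_trans_full[OF _ oran] by simp
  qed
next
  assume R: ?R
  let ?f = "the \<circ> h"
  have sub: "dom h \<subseteq> topspace T" "ran h \<subseteq> topspace T"
    and inj: "\<And>x x' y. h x = Some y \<Longrightarrow> h x' = Some y \<Longrightarrow> x = x'"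
    and cont: "\<And>V. openin T V \<Longrightarrow> openin T {x. \<exists>y\<in>V. h x = Some y}"
    and opn: "\<And>V. openin T V \<Longrightarrow> openin T {y. \<exists>x\<in>V. h x = Some y}"
  proof -
    show "dom h \<subseteq> topspace T" "ran h \<subseteq> topspace T" using R by auto
    note R3 = R[THEN conjunct2, THEN conjunct2]
    show "x = x'" if "h x = Some y" "h x' = Some y" for x x' y
      using R3[THEN conjunct1] that by auto
    show "openin T {x. \<exists>y\<in>V. h x = Some y}" if "openin T V" for V
      using R3[THEN conjunct2, THEN conjunct1] that by simp
    show "openin T {y. \<exists>x\<in>V. h x = Some y}" if "openin T V" for V
      using R3[THEN conjunct2, THEN conjunct2] that by simp
  qed
  have "{x. \<exists>y\<in>topspace T. h x = Some y} = dom h"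
    using sub by (auto simp: ran_def)
  then have od: "openin T (dom h)" using cont[of "topspace T"] by simp
  have "{y. \<exists>x\<in>topspace T. h x = Some y} = ran h"
    using sub by (auto simp: ran_def)
  then have oran: "openin T (ran h)" using opn[of "topspace T"] by simp
  have ts: "topspace (subtopology T (dom h)) = dom h" "topspace (subtopology T (ran h)) = ran h"
    using sub by auto
  have "homeomorphic_map (subtopology T (dom h)) (subtopology T (ran h)) ?f"
  proof (rule bijective_open_imp_homeomorphic_map)
    show "inj_on ?f (topspace (subtopology T (dom h)))"
      unfolding ts inj_on_def using inj by fastforce
    show "?f ` topspace (subtopology T (dom h)) = topspace (subtopology T (ran h))"
      unfolding ts by (force simp: ran_def image_iff)
    show "continuous_map (subtopology T (dom h)) (subtopology T (ran h)) ?f"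
      unfolding continuous_map_def ts
    proof (intro conjI allI impI)
      show "?f \<in> dom h \<rightarrow> ran h" by (auto simp: ran_def)
      fix V assume "openin (subtopology T (ran h)) V"
      then have V: "openin T V" "V \<subseteq> ran h" using openin_open_subtopology[OF oran] by auto
      have "{x \<in> dom h. ?f x \<in> V} = {x. \<exists>y\<in>V. h x = Some y}" by auto
      then show "openin (subtopology T (dom h)) {x \<in> dom h. ?f x \<in> V}"
        using cont[OF V(1)] openin_open_subtopology[OF od] by auto
    qed
    show "open_map (subtopology T (dom h)) (subtopology T (ran h)) ?f"
      unfolding open_map_def
    proof (intro allI impI)
      fix V assume "openin (subtopology T (dom h)) V"
      then have V: "openin T V" "V \<subseteq> dom h" using openin_open_subtopology[OF od] by auto
      have "?f ` V = {y. \<exists>x\<in>V. h x = Some y}" using V by (force simp: image_iff)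
      then show "openin (subtopology T (ran h)) (?f ` V)"
        using opn[OF V(1)] openin_open_subtopology[OF oran] V(2) by (auto simp: ran_def)
    qed
  qed
  then show "h \<in> loct T" using od oran by (simp add: loct_def)
qed

lemma loctD:
  assumes "h \<in> loct T"
  shows loct_dom: "openin T (dom h)" and loct_ran: "openin T (ran h)"
    and loct_inj: "\<And>x x' y. h x = Some y \<Longrightarrow> h x' = Some y \<Longrightarrow> x = x'"
    and loct_preimage: "\<And>V. openin T V \<Longrightarrow> openin T {x. \<exists>y\<in>V. h x = Some y}"
    and loct_image: "\<And>V. openin T V \<Longrightarrow> openin T {y. \<exists>x\<in>V. h x = Some y}"
proof -
  show "openin T (dom h)" "openin T (ran h)" using assms by (auto simp: loct_def)
  note R = assms[unfolded loct_iff, THEN conjunct2, THEN conjunct2]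
  show "x = x'" if "h x = Some y" "h x' = Some y" for x x' y
    using R[THEN conjunct1] that by auto
  show "openin T {x. \<exists>y\<in>V. h x = Some y}" if "openin T V" for V
    using R[THEN conjunct2, THEN conjunct1] that by simp
  show "openin T {y. \<exists>x\<in>V. h x = Some y}" if "openin T V" for V
    using R[THEN conjunct2, THEN conjunct2] that by simp
qed

lemma loct_in_topspace:
  assumes "h \<in> loct T" "h x = Some y"
  shows "x \<in> topspace T" "y \<in> topspace T"
  using assms unfolding loct_iff by (auto simp: dom_def ran_def)

lemma linv_eq_Some:
  assumes "h \<in> loct T"
  shows "linv h y = Some x \<longleftrightarrow> h x = Some y"
proof
  assume "linv h y = Some x"
  then have y: "y \<in> ran h" and x: "x = (THE x. h x = Some y)"
    by (auto simp: linv_def split: if_splits)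
  from y obtain x' where "h x' = Some y" by (auto simp: ran_def)
  then have "\<exists>!x. h x = Some y" using loct_inj[OF assms] by blast
  then show "h x = Some y" unfolding x by (rule theI')
next
  assume h: "h x = Some y"
  then have "(THE x. h x = Some y) = x" using loct_inj[OF assms] by blast
  then show "linv h y = Some x" using h by (auto simp: linv_def ran_def)
qed

lemma dom_linv: "dom (linv h) = ran h"
  by (auto simp: linv_def dom_def)

lemma linv_in_loct:
  assumes "h \<in> loct T" shows "linv h \<in> loct T"
  unfolding loct_iff linv_eq_Some[OF assms]
proof (intro conjI allI impI)
  show "dom (linv h) \<subseteq> topspace T"
    using loct_in_topspace[OF assms] by (auto simp: dom_linv ran_def)
  show "ran (linv h) \<subseteq> topspace T"
    using loct_in_topspace[OF assms] by (auto simp: ran_def linv_eq_Some[OF assms])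
qed (use loct_image[OF assms] loct_preimage[OF assms] in simp_all)

lemma linv_linv:
  assumes "h \<in> loct T" shows "linv (linv h) = h"
proof
  fix x
  show "linv (linv h) x = h x"
    using linv_eq_Some[OF linv_in_loct[OF assms]] linv_eq_Some[OF assms]
    by (metis not_Some_eq)
qed

lemma map_comp_in_loct:
  assumes h: "h \<in> loct T" and k: "k \<in> loct T" shows "k \<circ>\<^sub>m h \<in> loct T"
  unfolding loct_iff
proof (intro conjI allI impI)
  show "dom (k \<circ>\<^sub>m h) \<subseteq> topspace T"
    using loct_in_topspace[OF h] by (auto simp: dom_def map_comp_Some_iff)
  show "ran (k \<circ>\<^sub>m h) \<subseteq> topspace T"
    using loct_in_topspace[OF k] by (auto simp: ran_def map_comp_Some_iff)
  show "x = x'" if "(k \<circ>\<^sub>m h) x = Some y" "(k \<circ>\<^sub>m h) x' = Some y" for x x' y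
    using that loct_inj[OF h] loct_inj[OF k] unfolding map_comp_Some_iff by blast
  fix V assume V: "openin T V"
  have "{x. \<exists>y\<in>V. (k \<circ>\<^sub>m h) x = Some y} = {x. \<exists>y\<in>{x. \<exists>y\<in>V. k x = Some y}. h x = Some y}"
    by (auto simp: map_comp_Some_iff)
  then show "openin T {x. \<exists>y\<in>V. (k \<circ>\<^sub>m h) x = Some y}"
    using loct_preimage[OF h loct_preimage[OF k V]] by simp
  have "{y. \<exists>x\<in>V. (k \<circ>\<^sub>m h) x = Some y} = {y. \<exists>x\<in>{y. \<exists>x\<in>V. h x = Some y}. k x = Some y}"
    by (auto simp: map_comp_Some_iff)
  then show "openin T {y. \<exists>x\<in>V. (k \<circ>\<^sub>m h) x = Some y}"
    using loct_image[OF k loct_image[OF h V]] by simp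
qed

lemma restrict_map_eq_Some: "(h |` V) x = Some y \<longleftrightarrow> x \<in> V \<and> h x = Some y"
  by (auto simp: restrict_map_def)

lemma restrict_map_in_loct:
  assumes h: "h \<in> loct T" and V: "openin T V" shows "h |` V \<in> loct T"
  unfolding loct_iff
proof (intro conjI allI impI)
  show "dom (h |` V) \<subseteq> topspace T"
    using loct_in_topspace[OF h] by (auto simp: restrict_map_eq_Some dom_def)
  show "ran (h |` V) \<subseteq> topspace T"
    using loct_in_topspace[OF h] by (auto simp: restrict_map_eq_Some ran_def)
  show "x = x'" if "(h |` V) x = Some y" "(h |` V) x' = Some y" for x x' y
    using that loct_inj[OF h] unfolding restrict_map_eq_Some by blast
  fix W assume W: "openin T W"
  have "{x. \<exists>y\<in>W. (h |` V) x = Some y} = V \<inter> {x. \<exists>y\<in>W. h x = Some y}"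
    by (auto simp: restrict_map_eq_Some)
  then show "openin T {x. \<exists>y\<in>W. (h |` V) x = Some y}"
    using loct_preimage[OF h W] V by auto
  have "{y. \<exists>x\<in>W. (h |` V) x = Some y} = {y. \<exists>x\<in>W \<inter> V. h x = Some y}"
    by (auto simp: restrict_map_eq_Some)
  then show "openin T {y. \<exists>x\<in>W. (h |` V) x = Some y}"
    using loct_image[OF h, of "W \<inter> V"] V W by auto
qed

lemma lid_eq_Some: "lid T x = Some y \<longleftrightarrow> x \<in> topspace T \<and> y = x"
  by (auto simp: lid_def)

lemma lid_in_loct: "lid T \<in> loct T"
proof -
  have "{x. \<exists>y\<in>V. lid T x = Some y} = V" "{y. \<exists>x\<in>V. lid T x = Some y} = V" if "openin T V" for V
    using openin_subset[OF that] by (auto simp: lid_eq_Some)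
  then show ?thesis unfolding loct_iff by (auto simp: lid_eq_Some dom_def ran_def)
qed

lemma loct_subtopology:
  assumes V: "openin T V"
  shows "loct (subtopology T V) = {h \<in> loct T. dom h \<union> ran h \<subseteq> V}"
proof -
  have "(V \<inter> dom h) = dom h" "(V \<inter> ran h) = ran h" if "dom h \<union> ran h \<subseteq> V" for h :: "'a \<rightharpoonup> 'a"
    using that by auto
  then show ?thesis
    unfolding loct_def by (auto simp: openin_open_subtopology[OF V] subtopology_subtopology)
qed

text \<open>Equality of germs without forming classes. It makes sense for arbitrary partial
  functions, and two functions undefined near \<open>x\<close> agree there, so composing on the left
  needs no domain condition.\<close>

definition agree :: "'t topology \<Rightarrow> ('t \<rightharpoonup> 't) \<Rightarrow> ('t \<rightharpoonup> 't) \<Rightarrow> 't \<Rightarrow> bool" where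
  "agree T f g x \<longleftrightarrow> (\<exists>V. openin T V \<and> x \<in> V \<and> (\<forall>z\<in>V. f z = g z))"

lemma agree_refl: "x \<in> topspace T \<Longrightarrow> agree T f f x"
  unfolding agree_def by (intro exI[of _ "topspace T"]) auto

lemma agree_sym: "agree T f g x \<Longrightarrow> agree T g f x"
  unfolding agree_def by metis

lemma agree_trans: "agree T f g x \<Longrightarrow> agree T g k x \<Longrightarrow> agree T f k x"
  unfolding agree_def by (metis Int_iff openin_Int)

lemma agree_eq: "agree T f g x \<Longrightarrow> f x = g x"
  unfolding agree_def by auto

lemma agree_restrict: "openin T V \<Longrightarrow> x \<in> V \<Longrightarrow> agree T (f |` V) f x"
  unfolding agree_def by (intro exI[of _ V]) auto

lemma agree_comp_left:
  assumes "agree T f g x" shows "agree T (k \<circ>\<^sub>m f) (k \<circ>\<^sub>m g) x"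
  using assms unfolding agree_def map_comp_def by metis

lemma agree_comp_right:
  assumes f: "f \<in> loct T" "f x = Some y" and "agree T k k' y"
  shows "agree T (k \<circ>\<^sub>m f) (k' \<circ>\<^sub>m f) x"
proof -
  obtain V where V: "openin T V" "y \<in> V" "\<And>z. z \<in> V \<Longrightarrow> k z = k' z"
    using assms unfolding agree_def by blast
  show ?thesis unfolding agree_def
    by (intro exI[of _ "{x. \<exists>y\<in>V. f x = Some y}"]) (use V f loct_preimage[OF f(1) V(1)] in auto)
qed

lemma agree_comp:
  assumes "f \<in> loct T" "f x = Some y" "agree T f g x" "agree T k k' y"
  shows "agree T (k \<circ>\<^sub>m f) (k' \<circ>\<^sub>m g) x"
  using agree_trans[OF agree_comp_right[OF assms(1,2,4)] agree_comp_left[OF assms(3)]] .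

lemma agree_linv:
  assumes f: "f \<in> loct T" and g: "g \<in> loct T" and x: "f x = Some y" and a: "agree T f g x"
  shows "agree T (linv f) (linv g) y"
proof -
  obtain V where V: "openin T V" "x \<in> V" "\<And>z. z \<in> V \<Longrightarrow> f z = g z"
    using a unfolding agree_def by blast
  have "linv f w = linv g w" if "\<exists>x\<in>V. f x = Some w" for w
    using that V(3) by (metis linv_eq_Some[OF f] linv_eq_Some[OF g])
  then show ?thesis unfolding agree_def
    by (intro exI[of _ "{y. \<exists>x\<in>V. f x = Some y}"]) (use V x loct_image[OF f V(1)] in auto)
qed

lemma linv_comp_agree:
  assumes f: "f \<in> loct T" and x: "f x = Some y"
  shows "agree T (linv f \<circ>\<^sub>m f) (lid T) x"
proof -
  have "(linv f \<circ>\<^sub>m f) z = lid T z" if "z \<in> dom f" for z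
    using that loct_in_topspace[OF f] linv_eq_Some[OF f] by (auto simp: lid_def map_comp_def)
  then show ?thesis unfolding agree_def
    using loct_dom[OF f] x by (intro exI[of _ "dom f"]) auto
qed

lemma comp_linv_agree:
  assumes f: "f \<in> loct T" and x: "f x = Some y"
  shows "agree T (f \<circ>\<^sub>m linv f) (lid T) y"
  using linv_comp_agree[OF linv_in_loct[OF f], of y x] linv_linv[OF f] x linv_eq_Some[OF f] by simp

lemma lid_comp_agree:
  assumes f: "f \<in> loct T" and x: "f x = Some y"
  shows "agree T (lid T \<circ>\<^sub>m f) f x"
  unfolding agree_def
  using loct_dom[OF f] x loct_in_topspace[OF f]
  by (intro exI[of _ "dom f"]) (auto simp: map_comp_def lid_def)

section \<open>Germs of a generated pseudogroup\<close>

lemma pseudo_star_groupD: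
  assumes "pseudo_star_group T S"
  shows psg_loct: "\<And>h. h \<in> S \<Longrightarrow> h \<in> loct T"
    and psg_comp: "\<And>h k. h \<in> S \<Longrightarrow> k \<in> S \<Longrightarrow> k \<circ>\<^sub>m h \<in> S"
    and psg_linv: "\<And>h. h \<in> S \<Longrightarrow> linv h \<in> S"
  using assms unfolding pseudo_star_group_def by auto

lemma pseudogroupD:
  assumes "pseudogroup T P"
  shows pseudogroup_psg: "pseudo_star_group T P"
    and pseudogroup_restrict: "\<And>h V. h \<in> P \<Longrightarrow> openin T V \<Longrightarrow> V \<subseteq> dom h \<Longrightarrow> h |` V \<in> P"
    and pseudogroup_lid: "lid T \<in> P"
    and pseudogroup_union: "\<And>h C. h \<in> loct T \<Longrightarrow> C \<subseteq> P \<Longrightarrow> Map.graph h = (\<Union>f\<in>C. Map.graph f) \<Longrightarrow> h \<in> P"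
  using assms unfolding pseudogroup_def local_pseudo_star_group_def restriction_closed_def by blast+

lemma generated_pseudogroup_minimal:
  "pseudogroup T P \<Longrightarrow> G \<subseteq> P \<Longrightarrow> generated_pseudogroup T G \<subseteq> P"
  unfolding generated_pseudogroup_def by blast

lemma generated_pseudogroup_superset: "G \<subseteq> generated_pseudogroup T G"
  unfolding generated_pseudogroup_def by blast

text \<open>The hypothesis deals with the case that no pseudogroup contains \<open>G\<close>, in
  which the intersection is the set of all partial functions.\<close>

lemma pseudogroup_generated:
  assumes "generated_pseudogroup T G \<subseteq> loct T"
  shows "pseudogroup T (generated_pseudogroup T G)"
proof -
  have D: "pseudogroup T P" if "P \<in> {P. pseudogroup T P \<and> G \<subseteq> P}" for P using that by auto
  show ?thesis
    unfolding pseudogroup_def local_pseudo_star_group_def restriction_closed_def pseudo_star_group_def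
  proof (intro conjI ballI allI impI assms)
    let ?P = "generated_pseudogroup T G"
    show "k \<circ>\<^sub>m h \<in> ?P" if "h \<in> ?P" "k \<in> ?P" for h k
      using that psg_comp[OF pseudogroup_psg[OF D]] unfolding generated_pseudogroup_def by blast
    show "linv h \<in> ?P" if "h \<in> ?P" for h
      using that psg_linv[OF pseudogroup_psg[OF D]] unfolding generated_pseudogroup_def by blast
    show "h |` V \<in> ?P" if "h \<in> ?P" "openin T V \<and> V \<subseteq> dom h" for h V
      using that pseudogroup_restrict[OF D] unfolding generated_pseudogroup_def by blast
    show "lid T \<in> ?P"
      using pseudogroup_lid[OF D] unfolding generated_pseudogroup_def by blast
    fix h assume h: "h \<in> loct T" and "\<exists>C\<subseteq>?P. Map.graph h = (\<Union>f\<in>C. Map.graph f)"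
    then obtain C where C: "C \<subseteq> ?P" "Map.graph h = (\<Union>f\<in>C. Map.graph f)" by blast
    show "h \<in> ?P" unfolding generated_pseudogroup_def
    proof
      fix P assume P: "P \<in> {P. pseudogroup T P \<and> G \<subseteq> P}"
      then have "C \<subseteq> P" using C unfolding generated_pseudogroup_def by blast
      then show "h \<in> P" using pseudogroup_union[OF D[OF P] h] C by blast
    qed
  qed
qed

text \<open>Induction over words at the level of germs: \<open>R\<close> is invariant under
  \<open>agree\<close>, so restrictions and unions cost nothing, and only identities, generators,
  their inverses and composites remain.\<close>

lemma generated_pseudogroup_germ_induct [consumes 2, case_names loct agree lid gen inv comp]:
  assumes k: "k \<in> generated_pseudogroup T G" and ky: "k x = Some y"
    and G: "G \<subseteq> loct T"
    and ag: "\<And>k k' x y. k \<in> loct T \<Longrightarrow> k' \<in> loct T \<Longrightarrow> k x = Some y \<Longrightarrow> agree T k k' x \<Longrightarrow> R k x \<Longrightarrow> R k' x"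
    and id: "\<And>x. x \<in> topspace T \<Longrightarrow> R (lid T) x"
    and gen: "\<And>g x y. g \<in> G \<Longrightarrow> g x = Some y \<Longrightarrow> R g x"
    and inv: "\<And>g x y. g \<in> G \<Longrightarrow> g x = Some y \<Longrightarrow> R (linv g) y"
    and comp: "\<And>k k' x y w. k \<in> loct T \<Longrightarrow> k' \<in> loct T \<Longrightarrow> k x = Some y \<Longrightarrow> k' y = Some w \<Longrightarrow> R k x \<Longrightarrow> R k' y \<Longrightarrow> R (k' \<circ>\<^sub>m k) x"
  shows "R k x"
proof -
  \<comment> \<open>Requiring \<open>R\<close> for the inverse as well makes the set closed under
    inversion; a composite is inverted by reversing the word.\<close>
  let ?P = "{k \<in> loct T. \<forall>x y. k x = Some y \<longrightarrow> R k x \<and> R (linv k) y}"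
  have "pseudogroup T ?P"
    unfolding pseudogroup_def local_pseudo_star_group_def restriction_closed_def pseudo_star_group_def
  proof (intro conjI ballI allI impI)
    show "?P \<subseteq> loct T" by auto
    show "k' \<circ>\<^sub>m k \<in> ?P" if k: "k \<in> ?P" and k': "k' \<in> ?P" for k k'
    proof -
      have kl: "k \<in> loct T" "k' \<in> loct T" using k k' by auto
      have l: "k' \<circ>\<^sub>m k \<in> loct T" using map_comp_in_loct kl by blast
      have eq: "linv (k' \<circ>\<^sub>m k) = linv k \<circ>\<^sub>m linv k'"
      proof
        fix w
        have "linv (k' \<circ>\<^sub>m k) w = Some x \<longleftrightarrow> (linv k \<circ>\<^sub>m linv k') w = Some x" for x
          by (auto simp: linv_eq_Some[OF l] map_comp_Some_iff linv_eq_Some[OF kl(1)] linv_eq_Some[OF kl(2)])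
        then show "linv (k' \<circ>\<^sub>m k) w = (linv k \<circ>\<^sub>m linv k') w" by (metis not_Some_eq)
      qed
      have "R (k' \<circ>\<^sub>m k) x \<and> R (linv (k' \<circ>\<^sub>m k)) w" if xw: "(k' \<circ>\<^sub>m k) x = Some w" for x w
      proof -
        obtain y where y: "k x = Some y" "k' y = Some w" using xw unfolding map_comp_Some_iff by blast
        have "R (linv k \<circ>\<^sub>m linv k') w"
          by (rule comp[where y = y]) (use y k k' kl linv_in_loct linv_eq_Some[OF kl(1)] linv_eq_Some[OF kl(2)] in auto)
        moreover have "R (k' \<circ>\<^sub>m k) x"
          by (rule comp[OF kl y]) (use y k k' in auto)
        ultimately show ?thesis using eq by simp
      qed
      then show ?thesis using l by blast
    qed
    show "linv k \<in> ?P" if "k \<in> ?P" for k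
    proof -
      have kl: "k \<in> loct T" using that by auto
      then show ?thesis using that by (simp add: linv_in_loct linv_linv linv_eq_Some)
    qed
    show "k |` V \<in> ?P" if k: "k \<in> ?P" and V: "openin T V \<and> V \<subseteq> dom k" for k V
    proof -
      have kl: "k \<in> loct T" using k by auto
      have l: "k |` V \<in> loct T" using restrict_map_in_loct[OF kl] V by auto
      have "R (k |` V) x \<and> R (linv (k |` V)) y" if xy: "(k |` V) x = Some y" for x y
      proof -
        have x: "x \<in> V" "k x = Some y" using xy by (auto simp: restrict_map_eq_Some)
        have a: "agree T k (k |` V) x" by (rule agree_sym[OF agree_restrict]) (use V x in auto)
        have "R (k |` V) x" using ag[OF kl l x(2) a] k x by auto
        moreover have "R (linv (k |` V)) y"
          using ag[OF linv_in_loct[OF kl] linv_in_loct[OF l] _ agree_linv[OF kl l x(2) a]]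
            k x linv_eq_Some[OF kl] by auto
        ultimately show ?thesis by simp
      qed
      then show ?thesis using l by blast
    qed
    have "linv (lid T) = lid T"
    proof
      fix x
      have "linv (lid T) x = Some y \<longleftrightarrow> lid T x = Some y" for y
        by (auto simp: linv_eq_Some[OF lid_in_loct] lid_eq_Some)
      then show "linv (lid T) x = lid T x" by (metis not_Some_eq)
    qed
    then show "lid T \<in> ?P" using id lid_in_loct by (auto simp: lid_eq_Some)
    fix h assume h: "h \<in> loct T" and "\<exists>C\<subseteq>?P. Map.graph h = (\<Union>f\<in>C. Map.graph f)"
    then obtain C where C: "C \<subseteq> ?P" "Map.graph h = (\<Union>f\<in>C. Map.graph f)" by blast
    have "R h x \<and> R (linv h) y" if xy: "h x = Some y" for x y
    proof -
      have "(x,y) \<in> (\<Union>f\<in>C. Map.graph f)" using xy unfolding C(2)[symmetric] by (simp add: graph_def)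
      then obtain f where f: "f \<in> C" "f x = Some y" unfolding graph_def by blast
      have fP: "f \<in> ?P" "f \<in> loct T" using f C by auto
      have "Map.graph f \<subseteq> Map.graph h" using C(2) f(1) by blast
      then have sub: "f z = Some w \<Longrightarrow> h z = Some w" for z w
        unfolding graph_def by blast
      have a: "agree T f h x" unfolding agree_def
        by (intro exI[of _ "dom f"]) (use sub f loct_dom[OF fP(2)] in auto)
      have "R h x" using ag[OF fP(2) h f(2) a] fP f by auto
      moreover have "R (linv h) y"
        using ag[OF linv_in_loct[OF fP(2)] linv_in_loct[OF h] _ agree_linv[OF fP(2) h f(2) a]]
          fP f linv_eq_Some[OF fP(2)] by auto
      ultimately show ?thesis by simp
    qed
    then show "h \<in> ?P" using h by blast
  qed
  moreover have "G \<subseteq> ?P" using G gen inv by auto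
  ultimately have "k \<in> ?P" using generated_pseudogroup_minimal k by blast
  then show ?thesis using ky by auto
qed

text \<open>\<open>S\<close> is closed under composition and inversion, so a word of germs is the
  germ of one element. The covering hypothesis supplies the identity germ, as that of an element
  composed with its inverse.\<close>

lemma generated_by_psg_germ:
  assumes S: "pseudo_star_group T S"
    and cov: "\<And>x. x \<in> topspace T \<Longrightarrow> \<exists>s\<in>S. x \<in> dom s"
    and k: "k \<in> generated_pseudogroup T S" "k x = Some y"
  shows "\<exists>s\<in>S. agree T s k x"
  using k
proof (induction rule: generated_pseudogroup_germ_induct)
  case loct then show ?case using psg_loct[OF S] by auto
next
  case (agree k k' x y)
  then obtain s where s: "s \<in> S" "agree T s k x" by blast
  from agree_trans[OF s(2) agree.hyps(4)] show ?case using s(1) by blast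
next
  case (lid x)
  then obtain s y where s: "s \<in> S" "s x = Some y" using cov by blast
  from linv_comp_agree[OF psg_loct[OF S s(1)] s(2)] psg_comp[OF S s(1) psg_linv[OF S s(1)]]
  show ?case by blast
next
  case (gen g x y)
  then show ?case using agree_refl[OF loct_in_topspace(1)[OF psg_loct[OF S]]] by blast
next
  case (inv g x y)
  then show ?case
    using agree_refl[OF loct_in_topspace(2)[OF psg_loct[OF S]]] psg_linv[OF S] by blast
next
  case (comp k k' x y w)
  then obtain s s' where s: "s \<in> S" "agree T s k x" "s' \<in> S" "agree T s' k' y" by blast
  then have "s x = Some y" using agree_eq[OF s(2)] comp.hyps by simp
  from agree_comp[OF psg_loct[OF S s(1)] this s(2,4)] show ?case
    using psg_comp[OF S s(1,3)] by blast
qed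

section \<open>Uniform extension of germs\<close>

lemma compactin_pointwise_subcover:
  assumes K: "compactin T K" and B: "\<And>v. v \<in> K \<Longrightarrow> openin T (B v) \<and> v \<in> B v"
  obtains F where "finite F" "F \<subseteq> K" "K \<subseteq> (\<Union>v\<in>F. B v)"
proof -
  have "\<exists>\<F>. finite \<F> \<and> \<F> \<subseteq> B ` K \<and> K \<subseteq> \<Union>\<F>"
    by (rule compactinD[OF K]) (use B in auto)
  then obtain \<F> where "finite \<F>" "\<F> \<subseteq> B ` K" "K \<subseteq> \<Union>\<F>" by blast
  then show ?thesis using that finite_subset_image by metis
qed

lemma finite_pos_lower_bound:
  assumes "finite F" "\<And>v. v \<in> F \<Longrightarrow> r v > (0::real)"
  obtains e where "e > 0" "\<And>v. v \<in> F \<Longrightarrow> e \<le> r v"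
proof
  \<comment> \<open>Inserting 1 keeps the set non-empty when \<open>F\<close> is empty.\<close>
  show "Min (insert 1 (r ` F)) > 0" using assms by (subst Min_gr_iff) auto
  show "Min (insert 1 (r ` F)) \<le> r v" if "v \<in> F" for v using assms that by (intro Min_le) auto
qed

lemma loct_continuous:
  assumes "h \<in> loct T" shows "continuous_map (subtopology T (dom h)) T (the \<circ> h)"
proof -
  have "continuous_map (subtopology T (dom h)) (subtopology T (ran h)) (the \<circ> h)"
    using assms homeomorphic_imp_continuous_map unfolding loct_def by blast
  then show ?thesis by (simp add: continuous_map_in_subtopology)
qed

lemma loct_compact_image:
  assumes "h \<in> loct T" "compactin T K" "K \<subseteq> dom h"
  shows "compactin T ((the \<circ> h) ` K)"
  by (rule image_compactin[OF _ loct_continuous]) (use assms compactin_subtopology in auto)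

lemma agree_dom:
  assumes "agree T f g x" shows "x \<in> dom f \<longleftrightarrow> x \<in> dom g"
  using agree_eq[OF assms] by (simp add: dom_def)

lemma map_comp_assoc3: "k \<circ>\<^sub>m (h \<circ>\<^sub>m f) = (k \<circ>\<^sub>m h) \<circ>\<^sub>m f"
  by (auto simp: map_comp_def split: option.splits)

section \<open>Equicontinuity measured by one metric\<close>

lemma mdist_self [simp]: "x \<in> mspace m \<Longrightarrow> mdist m x x = 0"
  by simp

text \<open>The inequality of \<open>equicontinuous_with\<close>, separated from the generation
  clause because it passes to subsets of \<open>S\<close>.\<close>

definition equicontinuous_family :: "'t metric set \<Rightarrow> ('t \<rightharpoonup> 't) set \<Rightarrow> bool" where
  "equicontinuous_family \<C> S \<longleftrightarrow> (\<forall>\<epsilon>>0. \<exists>\<delta>>0. \<forall>h\<in>S. \<forall>m\<in>\<C>. \<forall>m'\<in>\<C>. \<forall>x y x' y'.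
        x \<in> mspace m \<and> y \<in> mspace m \<and> h x = Some x' \<and> h y = Some y' \<and>
        x' \<in> mspace m' \<and> y' \<in> mspace m' \<and> mdist m x y < \<delta> \<longrightarrow> mdist m' x' y' < \<epsilon>)"

lemma equicontinuous_family_mono:
  assumes "equicontinuous_family \<C> S'" "S \<subseteq> S'" shows "equicontinuous_family \<C> S"
  unfolding equicontinuous_family_def
proof (intro allI impI)
  fix \<epsilon> :: real assume "\<epsilon> > 0"
  from assms(1)[unfolded equicontinuous_family_def, rule_format, OF this]
  obtain \<delta> where "\<delta> > 0" and \<delta>: "\<forall>h\<in>S'. \<forall>m\<in>\<C>. \<forall>m'\<in>\<C>. \<forall>x y x' y'.
        x \<in> mspace m \<and> y \<in> mspace m \<and> h x = Some x' \<and> h y = Some y' \<and>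
        x' \<in> mspace m' \<and> y' \<in> mspace m' \<and> mdist m x y < \<delta> \<longrightarrow> mdist m' x' y' < \<epsilon>"
    by (elim exE conjE)
  show "\<exists>\<delta>>0. \<forall>h\<in>S. \<forall>m\<in>\<C>. \<forall>m'\<in>\<C>. \<forall>x y x' y'.
        x \<in> mspace m \<and> y \<in> mspace m \<and> h x = Some x' \<and> h y = Some y' \<and>
        x' \<in> mspace m' \<and> y' \<in> mspace m' \<and> mdist m x y < \<delta> \<longrightarrow> mdist m' x' y' < \<epsilon>"
    by (rule exI, rule conjI[OF \<open>\<delta> > 0\<close>], rule ballI, rule bspec[OF \<delta>], erule subsetD[OF assms(2)])
qed

text \<open>\<open>d\<close> is an auxiliary metric of \<open>T\<close>, unrelated to the metrics of
  the cover, which are comparable with each other only near common points.\<close>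

locale metric_cover = Metric_space M d for M :: "'t set" and d +
  fixes T :: "'t topology" and \<C> :: "'t metric set" and S :: "('t \<rightharpoonup> 't) set"
  assumes T_def: "T = mtopology"
    and cover: "quasi_locally_equal_cover M \<C>"
    and induces: "cover_induces_topology T \<C>"
    and equi: "equicontinuous_family \<C> S"
begin

lemma topspace_T [simp]: "topspace T = M"
  by (simp add: T_def)

lemma openin_T: "openin T U \<longleftrightarrow> U \<subseteq> M \<and> (\<forall>x. x \<in> U \<longrightarrow> (\<exists>r>0. mball x r \<subseteq> U))"
  unfolding T_def by (rule openin_mtopology)

lemma openin_mball_T [simp]: "openin T (mball x r)"
  unfolding T_def by (rule openin_mball)

lemma open_contains_mball:
  assumes "openin T U" "x \<in> U" obtains r where "r > 0" "mball x r \<subseteq> U"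
  using assms unfolding openin_T by blast

lemma openin_mball_of:
  assumes "m \<in> \<C>" shows "openin T (mball_of m x r)"
proof (cases "x \<in> mspace m \<and> r > 0")
  case True
  let ?P = "\<lambda>B. \<exists>m\<in>\<C>. \<exists>x\<in>mspace m. \<exists>r>0. B = mball_of m x r"
  have "?P (mball_of m x r)" using True assms by blast
  then have "(arbitrary union_of ?P) (mball_of m x r)" by (rule arbitrary_union_of_inc)
  then show ?thesis using induces unfolding cover_induces_topology_def by simp
next
  case False
  have "mball_of m x r = {}"
  proof -
    have "\<not> mdist m x y < r" if "\<not> r > 0" for y
      using that Metric_space.nonneg[OF Metric_space_mspace_mdist, of m x y] by linarith
    then show ?thesis using False by (auto simp: set_eq_iff)
  qed
  then show ?thesis by simp
qed

lemma openin_mspace: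
  assumes "m \<in> \<C>" shows "openin T (mspace m)"
proof -
  have "mspace m = (\<Union>x\<in>mspace m. mball_of m x 1)"
  proof
    show "mspace m \<subseteq> (\<Union>x\<in>mspace m. mball_of m x 1)"
    proof
      fix x assume "x \<in> mspace m"
      then show "x \<in> (\<Union>x\<in>mspace m. mball_of m x 1)" by (intro UN_I[of x]) auto
    qed
  qed auto
  moreover have "openin T (\<Union>x\<in>mspace m. mball_of m x 1)"
    by (rule openin_Union) (use assms openin_mball_of in auto)
  ultimately show ?thesis by simp
qed

lemma cover_point:
  assumes "x \<in> M" obtains m where "m \<in> \<C>" "x \<in> mspace m"
  using assms cover unfolding quasi_locally_equal_cover_def by auto

text \<open>The topology is only known to have the balls of all members as a basis. Quasi-local
  equality is what replaces a ball of another member by one of \<open>m\<close> centred at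
  \<open>u\<close>.\<close>

lemma cover_ball:
  assumes U: "openin T U" "u \<in> U" and m: "m \<in> \<C>" "u \<in> mspace m"
  obtains r where "r > 0" "mball_of m u r \<subseteq> U"
proof -
  have "(arbitrary union_of (\<lambda>B. \<exists>m\<in>\<C>. \<exists>x\<in>mspace m. \<exists>r>0. B = mball_of m x r)) U"
    using U(1) induces unfolding cover_induces_topology_def by simp
  then obtain \<B> where B: "\<B> \<subseteq> {B. \<exists>m\<in>\<C>. \<exists>x\<in>mspace m. \<exists>r>0. B = mball_of m x r}" "\<Union>\<B> = U"
    by (auto simp: union_of_def)
  then obtain B where "B \<in> \<B>" "u \<in> B" using U(2) by auto
  moreover from this(1) have "B \<subseteq> U" using B(2) by auto
  moreover have "\<exists>m\<in>\<C>. \<exists>x\<in>mspace m. \<exists>r>0. B = mball_of m x r" using B(1) calculation(1) by blast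
  ultimately obtain m' x r where m': "m' \<in> \<C>" "x \<in> mspace m'" "u \<in> mball_of m' x r" "mball_of m' x r \<subseteq> U"
    by blast
  obtain \<delta> :: "real \<Rightarrow> real" where \<delta>: "\<forall>\<epsilon>>0. \<delta> \<epsilon> > 0"
    and qle: "\<forall>m\<in>\<C>. \<forall>m'\<in>\<C>. \<forall>z\<in>mspace m \<inter> mspace m'.
           \<exists>N. openin (mtopology_of m) N \<and> z \<in> N \<and> N \<subseteq> mspace m \<inter> mspace m' \<and>
              (\<forall>\<epsilon>>0. \<forall>x\<in>N. \<forall>y\<in>N. mdist m x y < \<delta> \<epsilon> \<longrightarrow> mdist m' x y < \<epsilon>)"
    using cover unfolding quasi_locally_equal_cover_def by (elim conjE exE) assumption
  have "u \<in> mspace m \<inter> mspace m'" using m m' by simp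
  from qle[rule_format, OF m(1) m'(1) this] obtain N where
    N: "openin (mtopology_of m) N" "u \<in> N" "N \<subseteq> mspace m \<inter> mspace m'"
    and N4: "\<forall>\<epsilon>>0. \<forall>x\<in>N. \<forall>y\<in>N. mdist m x y < \<delta> \<epsilon> \<longrightarrow> mdist m' x y < \<epsilon>"
    by (elim conjE exE) assumption
  interpret m: Metric_space "mspace m" "mdist m" by (rule Metric_space_mspace_mdist)
  interpret m': Metric_space "mspace m'" "mdist m'" by (rule Metric_space_mspace_mdist)
  obtain s where s: "s > 0" "m.mball u s \<subseteq> N"
    using N(1,2) unfolding mtopology_of_def m.openin_mtopology by blast
  \<comment> \<open>The distance left between \<open>u\<close> and the rim of the
    \<open>m'\<close>-ball.\<close>
  define e where "e = r - mdist m' x u"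
  have e: "e > 0" using m'(3) by (simp add: e_def)
  show thesis
  proof
    show "min s (\<delta> e) > 0" using s \<delta> e by simp
    show "mball_of m u (min s (\<delta> e)) \<subseteq> U"
    proof
      fix y assume y: "y \<in> mball_of m u (min s (\<delta> e))"
      then have "y \<in> N" using s(2) by auto
      then have "mdist m' u y < e" using N4[rule_format, OF e N(2)] y by auto
      then have "mdist m' x y < r"
        using m'.triangle[of x u y] subsetD[OF N(3) \<open>y \<in> N\<close>] subsetD[OF N(3,2)] m'(2)
        unfolding e_def by auto
      then have "y \<in> mball_of m' x r" using m'(2) \<open>y \<in> N\<close> N(3) by auto
      then show "y \<in> U" using m'(4) by blast
    qed
  qed
qed

text \<open>Passage from the cover metrics to \<open>d\<close>. Finitely many
  \<open>m'\<close>-balls around points of \<open>K\<close> give a number \<open>e\<close> such that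
  \<open>m'\<close>-distance below \<open>e\<close> from a point of \<open>K\<close> forces
  \<open>d\<close>-distance below \<open>\<epsilon>\<close>; equicontinuity for \<open>e\<close>
  then gives \<open>P\<close>, which does not depend on \<open>h\<close>.\<close>

lemma equicontinuous_on_compact_in_member:
  assumes m': "m' \<in> \<C>" and K: "compactin T K" "K \<subseteq> mspace m'" and \<epsilon>: "\<epsilon> > 0" and x: "x \<in> M"
  obtains P where "openin T P" "x \<in> P"
    "\<And>h x' z a b. h \<in> S \<Longrightarrow> x' \<in> P \<Longrightarrow> z \<in> P \<Longrightarrow> h x' = Some a \<Longrightarrow> h z = Some b \<Longrightarrow> a \<in> K \<Longrightarrow> b \<in> mspace m' \<Longrightarrow> d a b < \<epsilon>"
proof -
  interpret m': Metric_space "mspace m'" "mdist m'" by (rule Metric_space_mspace_mdist)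
  obtain m where m: "m \<in> \<C>" "x \<in> mspace m" using cover_point[OF x] .
  interpret m: Metric_space "mspace m" "mdist m" by (rule Metric_space_mspace_mdist)
  have KM: "K \<subseteq> M" using compactin_subset_topspace[OF K(1)] by simp
  \<comment> \<open>Radius \<open>2 * r\<close> leaves room: \<open>a\<close> lies within
    \<open>r\<close> of some centre and \<open>b\<close> within \<open>e \<le> r\<close> of
    \<open>a\<close>.\<close>
  have "\<exists>r>0. mball_of m' v (2 * r) \<subseteq> mball v (\<epsilon> / 2)" if v: "v \<in> K" for v
  proof -
    obtain r where "r > 0" "mball_of m' v r \<subseteq> mball v (\<epsilon> / 2)"
      by (rule cover_ball[OF openin_mball_T, of v v "\<epsilon>/2" m']) (use v KM K m' \<epsilon> in auto)
    then show ?thesis by (intro exI[of _ "r/2"]) auto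
  qed
  then obtain r where r: "\<And>v. v \<in> K \<Longrightarrow> r v > 0" "\<And>v. v \<in> K \<Longrightarrow> mball_of m' v (2 * r v) \<subseteq> mball v (\<epsilon> / 2)"
    by metis
  obtain F where F: "finite F" "F \<subseteq> K" "K \<subseteq> (\<Union>v\<in>F. mball_of m' v (r v))"
  proof (rule compactin_pointwise_subcover[OF K(1), of "\<lambda>v. mball_of m' v (r v)"])
    show "openin T (mball_of m' v (r v)) \<and> v \<in> mball_of m' v (r v)" if "v \<in> K" for v
      using that r(1) K(2) openin_mball_of[OF m'] by auto
  qed
  obtain e where e: "e > 0" "\<And>v. v \<in> F \<Longrightarrow> e \<le> r v"
    using finite_pos_lower_bound[OF F(1), of r] r(1) F(2) by blast
  obtain \<delta> where \<delta>: "\<delta> > 0" "\<And>h x y x' y'. h \<in> S \<Longrightarrow> x \<in> mspace m \<Longrightarrow> y \<in> mspace m \<Longrightarrow>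
     h x = Some x' \<Longrightarrow> h y = Some y' \<Longrightarrow> x' \<in> mspace m' \<Longrightarrow> y' \<in> mspace m' \<Longrightarrow> mdist m x y < \<delta> \<Longrightarrow> mdist m' x' y' < e"
    using equi[unfolded equicontinuous_family_def, rule_format, OF e(1)] m(1) m' by blast
  show thesis
  proof (rule that)
    show "openin T (mball_of m x (\<delta> / 2))" by (rule openin_mball_of[OF m(1)])
    show "x \<in> mball_of m x (\<delta> / 2)" using m \<delta>(1) by simp
    fix h x' z a b
    assume h: "h \<in> S" and x': "x' \<in> mball_of m x (\<delta> / 2)" and z: "z \<in> mball_of m x (\<delta> / 2)"
      and hx': "h x' = Some a" and hz: "h z = Some b" and a: "a \<in> K" and b: "b \<in> mspace m'"
    have "mdist m x' z < \<delta>" using m.triangle''[of x' x z] x' z by auto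
    then have ab: "mdist m' a b < e" using \<delta>(2)[OF h _ _ hx' hz] x' z a K b by auto
    obtain v where v: "v \<in> F" "a \<in> mball_of m' v (r v)" using F(3) a by blast
    have "mdist m' v b < 2 * r v" using m'.triangle[of v a b] v ab e(2)[OF v(1)] b by auto
    moreover have "mdist m' v a < 2 * r v" using v r(1) F(2) by (smt (verit) in_mball_of subsetD)
    ultimately have "a \<in> mball_of m' v (2 * r v)" "b \<in> mball_of m' v (2 * r v)"
      using v b by auto
    then have "a \<in> mball v (\<epsilon> / 2)" "b \<in> mball v (\<epsilon> / 2)"
      using r(2)[of v] v(1) F(2) by blast+
    then show "d a b < \<epsilon>" using triangle''[of a v b] by auto
  qed
qed

text \<open>The equicontinuity condition is void for points whose images lie in no common member of the
  cover. This is why images at distance at least \<open>\<epsilon>0\<close>, a Lebesgue number of the cover, are excluded.\<close>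

definition controlled :: "'t set \<Rightarrow> real \<Rightarrow> real \<Rightarrow> 't set \<Rightarrow> bool" where
  "controlled K \<epsilon>0 \<epsilon> P \<longleftrightarrow>
    (\<forall>h\<in>S. \<forall>x'\<in>P. \<forall>z\<in>P. \<forall>a b. h x' = Some a \<longrightarrow> h z = Some b \<longrightarrow> a \<in> K \<longrightarrow> b \<in> M \<longrightarrow> d a b < \<epsilon>0 \<longrightarrow> d a b < \<epsilon>)"

text \<open>\<open>\<epsilon>0\<close> is at most the radii of finitely many balls that cover
  \<open>K\<close> and whose doubles each lie in a member of the cover. So \<open>a \<in> K\<close>
  and \<open>d a b < \<epsilon>0\<close> put both images into one member, where the previous lemma
  applies.\<close>

lemma equicontinuous_compact:
  assumes K: "compactin T K"
  obtains \<epsilon>0 where "\<epsilon>0 > 0"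
    "\<forall>\<epsilon>>0. \<forall>x\<in>M. \<exists>P. openin T P \<and> x \<in> P \<and>
       controlled K \<epsilon>0 \<epsilon> P"
proof -
  have KM: "K \<subseteq> M" using compactin_subset_topspace[OF K(1)] by simp
  have "\<exists>m r. m \<in> \<C> \<and> r > 0 \<and> mball v (2 * r) \<subseteq> mspace m" if v: "v \<in> K" for v
  proof -
    obtain m where m: "m \<in> \<C>" "v \<in> mspace m" using cover_point v KM by blast
    obtain r where "r > 0" "mball v r \<subseteq> mspace m"
      using open_contains_mball[OF openin_mspace[OF m(1)] m(2)] .
    then show ?thesis using m by (intro exI[of _ m] exI[of _ "r/2"]) auto
  qed
  then obtain m r where mr: "\<And>v. v \<in> K \<Longrightarrow> m v \<in> \<C>" "\<And>v. v \<in> K \<Longrightarrow> r v > 0"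
      "\<And>v. v \<in> K \<Longrightarrow> mball v (2 * r v) \<subseteq> mspace (m v)"
    by metis
  obtain F where F: "finite F" "F \<subseteq> K" "K \<subseteq> (\<Union>v\<in>F. mball v (r v))"
  proof (rule compactin_pointwise_subcover[OF K(1), of "\<lambda>v. mball v (r v)"])
    show "openin T (mball v (r v)) \<and> v \<in> mball v (r v)" if "v \<in> K" for v
      using that mr(2) KM by auto
  qed
  obtain \<epsilon>0 where e: "\<epsilon>0 > 0" "\<And>v. v \<in> F \<Longrightarrow> \<epsilon>0 \<le> r v"
    using finite_pos_lower_bound[OF F(1), of r] mr(2) F(2) by blast
  show thesis
  proof (rule that[OF e(1)], intro allI impI ballI)
    fix \<epsilon> x assume \<epsilon>: "\<epsilon> > (0::real)" and x: "x \<in> M"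
    have "\<exists>P. openin T P \<and> x \<in> P \<and> (\<forall>h\<in>S. \<forall>x'\<in>P. \<forall>z\<in>P. \<forall>a b. h x' = Some a \<longrightarrow> h z = Some b \<longrightarrow>
        a \<in> K \<inter> mcball v (r v) \<longrightarrow> b \<in> mspace (m v) \<longrightarrow> d a b < \<epsilon>)" if v: "v \<in> F" for v
    proof -
      have vK: "v \<in> K" using v F by auto
      \<comment> \<open>The closed ball keeps the part of \<open>K\<close> near \<open>v\<close>
        compact and still inside \<open>m v\<close>, as it lies in the ball of radius
        \<open>2 * r v\<close>.\<close>
      have "compactin T (K \<inter> mcball v (r v))"
        unfolding T_def by (rule compact_Int_closedin) (use K T_def in auto)
      moreover have "K \<inter> mcball v (r v) \<subseteq> mspace (m v)"
        using mr(3)[OF vK] mr(2)[OF vK] by fastforce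
      ultimately show ?thesis
        using equicontinuous_on_compact_in_member[OF mr(1)[OF vK] _ _ \<epsilon> x] by metis
    qed
    then obtain P where P: "\<And>v. v \<in> F \<Longrightarrow> openin T (P v)" "\<And>v. v \<in> F \<Longrightarrow> x \<in> P v"
      "\<And>v h x' z a b. v \<in> F \<Longrightarrow> h\<in>S \<Longrightarrow> x'\<in>P v \<Longrightarrow> z\<in>P v \<Longrightarrow> h x' = Some a \<Longrightarrow> h z = Some b \<Longrightarrow>
        a \<in> K \<inter> mcball v (r v) \<Longrightarrow> b \<in> mspace (m v) \<Longrightarrow> d a b < \<epsilon>"
      by metis
    \<comment> \<open>\<open>M\<close> is inserted because the intersection over an empty
      \<open>F\<close> would be the whole type.\<close>
    let ?P = "\<Inter>(insert M (P ` F))"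
    show "\<exists>P. openin T P \<and> x \<in> P \<and>
       controlled K \<epsilon>0 \<epsilon> P"
    proof (unfold controlled_def, intro exI[of _ ?P] conjI ballI allI impI)
      have "openin T M" using openin_topspace[of T] by simp
      then show "openin T ?P" by (intro openin_Inter) (use F P in auto)
      show "x \<in> ?P" using x P(2) by auto
      fix h x' z a b
      assume A: "h \<in> S" "x' \<in> ?P" "z \<in> ?P" "h x' = Some a" "h z = Some b" "a \<in> K" "b \<in> M" "d a b < \<epsilon>0"
      obtain v where v: "v \<in> F" "a \<in> mball v (r v)" using F(3) A(6) by blast
      have "d v b < 2 * r v" using triangle[of v a b] v A(7,8) e(2)[OF v(1)] by auto
      then have "b \<in> mball v (2 * r v)" using v A(7) by auto
      then have "b \<in> mspace (m v)" using mr(3)[of v] v(1) F(2) by blast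
      then show "d a b < \<epsilon>" using P(3)[OF v(1) A(1) _ _ A(4,5)] A v by auto
    qed
  qed
qed

end

text \<open>Generation by \<open>S\<close> appears only as \<open>germS\<close>, because this is the
  form that can be checked for \<open>S0 \<inter> S1\<close>. The set \<open>V\<close> serves
  compact generation and is not tied to a base point.\<close>

locale equi_pg = metric_cover M d T \<C> S for M :: "'t set" and d T \<C> S +
  fixes H :: "('t \<rightharpoonup> 't) set" and V :: "'t set"
  assumes lc: "locally_compact_space T"
    and pgH: "pseudogroup T H"
    and cg: "compactly_generated_with T H V"
    and psgS: "pseudo_star_group T S"
    and resS: "restriction_closed T S"
    and SH: "S \<subseteq> H"
    and germS: "\<And>g x y. g \<in> H \<Longrightarrow> g x = Some y \<Longrightarrow> \<exists>s\<in>S. agree T s g x"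
begin

lemma H_loct: "g \<in> H \<Longrightarrow> g \<in> loct T"
  using psg_loct[OF pseudogroup_psg[OF pgH]] .

lemma S_loct: "g \<in> S \<Longrightarrow> g \<in> loct T"
  using psg_loct[OF psgS] .

lemma S_restrict:
  assumes "s \<in> S" "openin T W" shows "s |` W \<in> S"
proof -
  have "s |` (W \<inter> dom s) \<in> S"
    using resS assms loct_dom[OF S_loct[OF assms(1)]] unfolding restriction_closed_def by auto
  moreover have "s |` (W \<inter> dom s) = s |` W"
    by (auto simp: restrict_map_def fun_eq_iff)
  ultimately show ?thesis by simp
qed

lemma V_open: "openin T V" and clV_compact: "compactin T (T closure_of V)"
  and orbit_V: "\<And>x. x \<in> M \<Longrightarrow> orbit H x \<inter> V \<noteq> {}"
  using cg unfolding compactly_generated_with_def by auto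

text \<open>A Lebesgue number: near each point of \<open>K\<close> some element of \<open>S\<close>
  agrees with \<open>g\<close> on a ball of twice the radius used in a finite subcover. Keeping the
  images in an \<open>\<epsilon>0 / 2\<close>-ball provides the crude bound that
  \<open>controlled\<close> asks for.\<close>

lemma local_generator_extension:
  assumes g: "g \<in> H" and K: "compactin T K" "K \<subseteq> dom g" and \<epsilon>0: "\<epsilon>0 > 0"
  obtains \<rho> where "\<rho> > 0"
    "\<And>u. u \<in> K \<Longrightarrow> \<exists>s\<in>S. mball u \<rho> \<subseteq> dom s \<and> agree T s g u \<and>
       (\<forall>z\<in>mball u \<rho>. \<forall>a b. s u = Some a \<longrightarrow> s z = Some b \<longrightarrow> d a b < \<epsilon>0)"
proof -
  have "\<exists>s r. s \<in> S \<and> r > 0 \<and> (\<forall>z\<in>mball v (2 * r). s z = g z) \<and>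
      (\<exists>a. \<forall>z\<in>mball v (2 * r). \<exists>b\<in>mball a (\<epsilon>0 / 2). s z = Some b)" if v: "v \<in> K" for v
  proof -
    obtain a where a: "g v = Some a" using v K by auto
    obtain s where s: "s \<in> S" "agree T s g v" using germS[OF g a] by blast
    obtain W where W: "openin T W" "v \<in> W" "\<And>z. z \<in> W \<Longrightarrow> s z = g z"
      using s(2) unfolding agree_def by blast
    have sa: "s v = Some a" using a W by auto
    have sl: "s \<in> loct T" using S_loct s by auto
    have "openin T (W \<inter> {x. \<exists>y\<in>mball a (\<epsilon>0 / 2). s x = Some y})"
      by (intro openin_Int W loct_preimage[OF sl]) simp
    moreover have "a \<in> M" using loct_in_topspace[OF sl sa] by simp
    ultimately obtain r where r: "r > 0" "mball v r \<subseteq> W \<inter> {x. \<exists>y\<in>mball a (\<epsilon>0 / 2). s x = Some y}"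
    proof -
      assume o: "openin T (W \<inter> {x. \<exists>y\<in>mball a (\<epsilon>0 / 2). s x = Some y})" and "a \<in> M"
      then have "v \<in> W \<inter> {x. \<exists>y\<in>mball a (\<epsilon>0 / 2). s x = Some y}"
        using W(2) sa \<epsilon>0 by auto
      from open_contains_mball[OF o this] show thesis using that by blast
    qed
    show ?thesis
    proof (intro exI[of _ s] exI[of _ "r/2"] exI[of _ a] conjI ballI)
      fix z assume "z \<in> mball v (2 * (r/2))"
      then have z: "z \<in> W \<inter> {x. \<exists>y\<in>mball a (\<epsilon>0 / 2). s x = Some y}" using r(2) by auto
      then show "s z = g z" using W(3) by simp
      show "\<exists>b\<in>mball a (\<epsilon>0 / 2). s z = Some b" using z by blast
    qed (use s r in auto)
  qed
  then obtain s r where sr: "\<And>v. v \<in> K \<Longrightarrow> s v \<in> S" "\<And>v. v \<in> K \<Longrightarrow> r v > 0"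
    "\<And>v z. v \<in> K \<Longrightarrow> z\<in>mball v (2 * r v) \<Longrightarrow> s v z = g z"
    "\<And>v. v \<in> K \<Longrightarrow> \<exists>a. \<forall>z\<in>mball v (2 * r v). \<exists>b\<in>mball a (\<epsilon>0 / 2). s v z = Some b"
    by metis
  have KM: "K \<subseteq> M" using compactin_subset_topspace[OF K(1)] by simp
  obtain F where F: "finite F" "F \<subseteq> K" "K \<subseteq> (\<Union>v\<in>F. mball v (r v))"
  proof (rule compactin_pointwise_subcover[OF K(1), of "\<lambda>v. mball v (r v)"])
    show "openin T (mball v (r v)) \<and> v \<in> mball v (r v)" if "v \<in> K" for v
      using that sr(2) KM by auto
  qed
  obtain \<rho> where e: "\<rho> > 0" "\<And>v. v \<in> F \<Longrightarrow> \<rho> \<le> r v"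
    using finite_pos_lower_bound[OF F(1), of r] sr(2) F(2) by blast
  show thesis
  proof (rule that[OF e(1)])
    fix u assume u: "u \<in> K"
    then obtain v where v: "v \<in> F" "u \<in> mball v (r v)" using F(3) by blast
    have vK: "v \<in> K" using v F by auto
    have sub: "mball u \<rho> \<subseteq> mball v (2 * r v)"
      using triangle[of v u] v e(2)[OF v(1)] by fastforce
    obtain c where c: "\<And>z. z\<in>mball v (2 * r v) \<Longrightarrow> \<exists>b\<in>mball c (\<epsilon>0 / 2). s v z = Some b"
      using sr(4)[OF vK] by blast
    have uu: "u \<in> mball u \<rho>" using e v by auto
    show "\<exists>s\<in>S. mball u \<rho> \<subseteq> dom s \<and> agree T s g u \<and>
       (\<forall>z\<in>mball u \<rho>. \<forall>a b. s u = Some a \<longrightarrow> s z = Some b \<longrightarrow> d a b < \<epsilon>0)"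
    proof (intro bexI[OF _ sr(1)[OF vK]] conjI ballI allI impI)
      show "mball u \<rho> \<subseteq> dom (s v)" using c sub by blast
      show "agree T (s v) g u" unfolding agree_def
        by (intro exI[of _ "mball u \<rho>"]) (use uu sub sr(3)[OF vK] in auto)
      fix z a b assume z: "z \<in> mball u \<rho>" and ab: "s v u = Some a" "s v z = Some b"
      have "a \<in> mball c (\<epsilon>0 / 2)" "b \<in> mball c (\<epsilon>0 / 2)"
        using c[OF subsetD[OF sub uu]] c[OF subsetD[OF sub z]] ab by auto
      then show "d a b < \<epsilon>0" using triangle''[of a c b] by auto
    qed
  qed
qed

definition extends_near :: "real \<Rightarrow> real \<Rightarrow> ('t \<rightharpoonup> 't) \<Rightarrow> 't \<Rightarrow> bool" where
  "extends_near \<epsilon>0 \<rho> g u \<longleftrightarrow> (\<exists>s\<in>S. mball u \<rho> \<subseteq> dom s \<and> agree T s g u \<and>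
       (\<forall>z\<in>mball u \<rho>. \<forall>a b. s u = Some a \<longrightarrow> s z = Some b \<longrightarrow> d a b < \<epsilon>0))"

lemma extends_near_mono:
  assumes "extends_near \<epsilon>0 \<rho>' g u" "\<rho> \<le> \<rho>'" shows "extends_near \<epsilon>0 \<rho> g u"
proof -
  obtain s where s: "s \<in> S" "mball u \<rho>' \<subseteq> dom s" "agree T s g u"
    "\<forall>z\<in>mball u \<rho>'. \<forall>a b. s u = Some a \<longrightarrow> s z = Some b \<longrightarrow> d a b < \<epsilon>0"
    using assms(1) unfolding extends_near_def by (elim bexE conjE)
  show ?thesis unfolding extends_near_def
    using s mball_subset_concentric[OF assms(2), of u] by (intro bexI[OF _ s(1)]) blast
qed

lemma extends_near_agree:
  assumes "extends_near \<epsilon>0 \<rho> g' u" "agree T g' g u" shows "extends_near \<epsilon>0 \<rho> g u"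
proof -
  obtain s where s: "s \<in> S" "mball u \<rho> \<subseteq> dom s" "agree T s g' u"
    "\<forall>z\<in>mball u \<rho>. \<forall>a b. s u = Some a \<longrightarrow> s z = Some b \<longrightarrow> d a b < \<epsilon>0"
    using assms(1) unfolding extends_near_def by (elim bexE conjE)
  show ?thesis unfolding extends_near_def
    using s agree_trans[OF s(3) assms(2)] by (intro bexI[OF _ s(1)] conjI)
qed

text \<open>The radius stays away from 0 near the boundary of \<open>dom g\<close> because
  \<open>g'\<close> is defined on its compact closure. For the inverse the compact set is the image
  of that closure under \<open>g'\<close>.\<close>

lemma generator_extends_near:
  assumes \<epsilon>0: "\<epsilon>0 > 0" and g: "g \<in> pg_restrict H V"
    and g': "\<exists>g'\<in>H. T closure_of dom g \<subseteq> dom g' \<and> g = g' |` dom g"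
  shows "\<exists>\<rho>>0. \<forall>u w. g u = Some w \<longrightarrow> extends_near \<epsilon>0 \<rho> g u \<and> extends_near \<epsilon>0 \<rho> (linv g) w"
proof -
  obtain g' where g': "g' \<in> H" "T closure_of dom g \<subseteq> dom g'" "g = g' |` dom g" using g' by blast
  have gH: "g \<in> H" "dom g \<union> ran g \<subseteq> V" using g unfolding pg_restrict_def by auto
  have gl: "g \<in> loct T" "g' \<in> loct T" using H_loct gH g' by auto
  let ?C = "T closure_of dom g"
  have C: "compactin T ?C"
    by (rule closed_compactin[OF clV_compact]) (use gH in \<open>auto intro: closure_of_mono[THEN subsetD]\<close>)
  have gC: "dom g \<subseteq> ?C" using closure_of_subset openin_subset[OF loct_dom[OF gl(1)]] by blast
  let ?C' = "(the \<circ> g') ` ?C"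
  have C': "compactin T ?C'" by (rule loct_compact_image[OF gl(2) C g'(2)])
  have C'dom: "?C' \<subseteq> dom (linv g')"
  proof
    fix w assume "w \<in> ?C'"
    then obtain z where z: "z \<in> ?C" "w = the (g' z)" by auto
    then have "g' z = Some w" using g'(2) by auto
    then show "w \<in> dom (linv g')" unfolding dom_linv by (rule ranI)
  qed
  have lH: "linv g' \<in> H" using psg_linv[OF pseudogroup_psg[OF pgH] g'(1)] .
  obtain \<rho>1 where \<rho>1: "\<rho>1 > 0" "\<And>u. u \<in> ?C \<Longrightarrow> extends_near \<epsilon>0 \<rho>1 g' u"
    using local_generator_extension[OF g'(1) C g'(2) \<epsilon>0] unfolding extends_near_def by metis
  obtain \<rho>2 where \<rho>2: "\<rho>2 > 0" "\<And>u. u \<in> ?C' \<Longrightarrow> extends_near \<epsilon>0 \<rho>2 (linv g') u"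
    using local_generator_extension[OF lH C' C'dom \<epsilon>0] unfolding extends_near_def by metis
  show ?thesis
  proof (intro exI[of _ "min \<rho>1 \<rho>2"] conjI allI impI)
    show "min \<rho>1 \<rho>2 > 0" using \<rho>1 \<rho>2 by simp
    fix u w assume uw: "g u = Some w"
    then have u: "u \<in> dom g" by auto
    have a: "agree T g' g u"
      by (subst g'(3)) (rule agree_sym[OF agree_restrict[OF loct_dom[OF gl(1)] u]])
    have uw': "g' u = Some w" using agree_eq[OF a] uw by simp
    have al: "agree T (linv g') (linv g) w" by (rule agree_linv[OF gl(2,1) uw' a])
    have "w \<in> ?C'" using u gC uw' by (force simp: image_iff)
    then have "extends_near \<epsilon>0 \<rho>2 (linv g) w" using extends_near_agree[OF \<rho>2(2) al] by simp
    then show "extends_near \<epsilon>0 (min \<rho>1 \<rho>2) (linv g) w" by (rule extends_near_mono) simp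
    have "extends_near \<epsilon>0 \<rho>1 g u" using extends_near_agree[OF \<rho>1(2) a] u gC by auto
    then show "extends_near \<epsilon>0 (min \<rho>1 \<rho>2) g u" by (rule extends_near_mono) simp
  qed
qed

text \<open>The germs of \<open>H\<close> restricted to \<open>V\<close> are words in the finitely many generators, all of which extend to
  elements of \<open>S\<close> on balls of a common radius. As the extended word is again in \<open>S\<close>, equicontinuity keeps the
  image of \<open>P\<close> in such a ball, however long the word is.\<close>

lemma uniform_extension_in_V:
  assumes x: "x \<in> M" and \<epsilon>: "\<epsilon> > 0"
  obtains P where "openin T P" "x \<in> P"
    "\<And>x' k y. x' \<in> P \<Longrightarrow> k \<in> pg_restrict H V \<Longrightarrow> k x' = Some y \<Longrightarrow>
      \<exists>h\<in>S. dom h = P \<and> agree T h k x' \<and> (\<forall>z\<in>P. \<forall>b. h z = Some b \<longrightarrow> d y b < \<epsilon>)"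
proof -
  let ?K = "T closure_of V"
  have VK: "V \<subseteq> ?K" using closure_of_subset openin_subset[OF V_open] by blast
  obtain \<epsilon>0 where \<epsilon>0: "\<epsilon>0 > 0"
    and eq: "\<forall>\<epsilon>>0. \<forall>x\<in>M. \<exists>P. openin T P \<and> x \<in> P \<and>
       controlled ?K \<epsilon>0 \<epsilon> P"
    by (rule equicontinuous_compact[OF clV_compact])
  have "\<exists>G. finite G \<and> G \<subseteq> pg_restrict H V \<and>
        generated_pseudogroup (subtopology T V) G = pg_restrict H V \<and>
        (\<forall>g\<in>G. \<exists>g'\<in>H. T closure_of dom g \<subseteq> dom g' \<and> g = g' |` dom g)"
    using cg unfolding compactly_generated_with_def by (elim conjE) assumption
  then obtain G where G: "finite G" "G \<subseteq> pg_restrict H V"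
      "generated_pseudogroup (subtopology T V) G = pg_restrict H V"
      and G4: "\<forall>g\<in>G. \<exists>g'\<in>H. T closure_of dom g \<subseteq> dom g' \<and> g = g' |` dom g"
    by (elim exE conjE) assumption
  have "\<exists>\<rho>>0. \<forall>u w. g u = Some w \<longrightarrow> extends_near \<epsilon>0 \<rho> g u \<and> extends_near \<epsilon>0 \<rho> (linv g) w" if g: "g \<in> G" for g
    by (rule generator_extends_near[OF \<epsilon>0]) (use g G(2) G4 in auto)
  then have "\<forall>g\<in>G. \<exists>\<rho>>0. \<forall>u w. g u = Some w \<longrightarrow> extends_near \<epsilon>0 \<rho> g u \<and> extends_near \<epsilon>0 \<rho> (linv g) w"
    by blast
  from bchoice[OF this] obtain \<rho>0 where \<rho>0: "\<And>g. g \<in> G \<Longrightarrow> \<rho>0 g > 0"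
    "\<And>g u w. g \<in> G \<Longrightarrow> g u = Some w \<Longrightarrow> extends_near \<epsilon>0 (\<rho>0 g) g u \<and> extends_near \<epsilon>0 (\<rho>0 g) (linv g) w"
    by auto
  obtain \<rho> where \<rho>: "\<rho> > 0" "\<And>g. g \<in> G \<Longrightarrow> \<rho> \<le> \<rho>0 g"
    by (rule finite_pos_lower_bound[of G \<rho>0]) (use G(1) \<rho>0(1) in auto)
  \<comment> \<open>\<open>e \<le> \<rho>\<close> keeps the images of \<open>P\<close> in a ball to
    which the next letter extends; \<open>e \<le> \<epsilon>\<close> is the final bound.\<close>
  define e where "e = min \<epsilon> \<rho>"
  have e: "e > 0" "e \<le> \<epsilon>" "e \<le> \<rho>" using \<epsilon> \<rho> by (auto simp: e_def)
  obtain P0 where P0: "openin T P0" "x \<in> P0" and eqP0: "controlled ?K \<epsilon>0 e P0"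
    using eq[rule_format, OF e(1) x] by (elim exE conjE)
  note eqP = eqP0[unfolded controlled_def, rule_format]
  have "lid T x = Some x" using x by (simp add: lid_def)
  then obtain s0 where s0: "s0 \<in> S" "agree T s0 (lid T) x"
    using germS[OF pseudogroup_lid[OF pgH]] by blast
  then obtain W where W: "openin T W" "x \<in> W" "\<And>z. z \<in> W \<Longrightarrow> s0 z = lid T z"
    unfolding agree_def by blast
  \<comment> \<open>\<open>W\<close> makes the identity on \<open>P\<close> an element of
    \<open>S\<close>, and radius \<open>e/2\<close> makes it a lift at each point of
    \<open>P\<close>: the lift for the empty word.\<close>
  define P where "P = P0 \<inter> W \<inter> mball x (e/2)"
  have P: "openin T P" "x \<in> P" "P \<subseteq> P0" using P0 W x e by (auto simp: P_def)
  have PM: "P \<subseteq> M" using openin_subset[OF P(1)] by simp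
  let ?i = "s0 |` P"
  have i: "?i \<in> S" using S_restrict[OF s0(1) P(1)] .
  have i_eq: "?i z = (if z \<in> P then Some z else None)" for z
    using W(3)[of z] PM by (auto simp: P_def lid_def restrict_map_def)
  define lifts where "lifts x' u h \<longleftrightarrow> h \<in> S \<and> dom h = P \<and> h x' = Some u \<and> (\<forall>z\<in>P. \<forall>b. h z = Some b \<longrightarrow> d u b < e)"
    for x' u h
  \<comment> \<open>The invariant of the induction over words: a lift ending at \<open>u\<close> can
    be continued by \<open>k\<close> without shrinking \<open>P\<close>.\<close>
  define R where "R k u \<longleftrightarrow> (\<forall>x'\<in>P. \<forall>h w. lifts x' u h \<longrightarrow> k u = Some w \<longrightarrow>
      (\<exists>h2. lifts x' w h2 \<and> agree T h2 (k \<circ>\<^sub>m h) x'))" for k u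
  \<comment> \<open>One letter: \<open>s\<close> extends the germ of \<open>k\<close> over a ball
    that contains all images of \<open>h\<close>.\<close>
  have Rgood: "R k u" if k: "extends_near \<epsilon>0 \<rho> k u" and V: "ran k \<subseteq> V" for k u
    unfolding R_def
  proof (intro ballI allI impI)
    fix x' h w assume x': "x' \<in> P" and "lifts x' u h" and ku: "k u = Some w"
    then have h: "h \<in> S" "dom h = P" and hx': "h x' = Some u"
      and hz: "\<forall>z\<in>P. \<forall>b. h z = Some b \<longrightarrow> d u b < e" unfolding lifts_def by auto
    obtain s where s: "s \<in> S" "mball u \<rho> \<subseteq> dom s" "agree T s k u"
      "\<And>z a b. z\<in>mball u \<rho> \<Longrightarrow> s u = Some a \<Longrightarrow> s z = Some b \<Longrightarrow> d a b < \<epsilon>0"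
      using k unfolding extends_near_def by blast
    have hl: "h \<in> loct T" using S_loct h by auto
    have uM: "u \<in> M" using loct_in_topspace[OF hl hx'] by simp
    have hb: "\<exists>b. h z = Some b \<and> b \<in> mball u \<rho>" if z: "z \<in> P" for z
    proof -
      obtain b where b: "h z = Some b" using z h(2) by auto
      then have "d u b < e" "b \<in> M" using hz z loct_in_topspace[OF hl b] by auto
      then show ?thesis using b uM e by auto
    qed
    have su: "s u = Some w" using agree_eq[OF s(3)] ku by simp
    have S2: "s \<circ>\<^sub>m h \<in> S" using psg_comp[OF psgS h(1) s(1)] .
    have "lifts x' w (s \<circ>\<^sub>m h)"
      unfolding lifts_def
    proof (intro conjI ballI allI impI S2)
      show "dom (s \<circ>\<^sub>m h) = P"
      proof
        show "dom (s \<circ>\<^sub>m h) \<subseteq> P" using h(2) by (auto simp: map_comp_Some_iff dom_def)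
        show "P \<subseteq> dom (s \<circ>\<^sub>m h)"
        proof
          fix z assume "z \<in> P"
          then obtain b where b: "h z = Some b" "b \<in> mball u \<rho>" using hb by blast
          then obtain c where "s b = Some c" using s(2) by blast
          then show "z \<in> dom (s \<circ>\<^sub>m h)" using b by (simp add: dom_def)
        qed
      qed
      show a: "(s \<circ>\<^sub>m h) x' = Some w" using hx' su by simp
      fix z b assume z: "z \<in> P" and b: "(s \<circ>\<^sub>m h) z = Some b"
      obtain c where c: "h z = Some c" "c \<in> mball u \<rho>" using hb[OF z] by blast
      \<comment> \<open>Images of the ball under \<open>s\<close> are within
        \<open>\<epsilon>0\<close> of \<open>w\<close>. Since \<open>s \<circ>\<^sub>m h\<close> is
        again in \<open>S\<close> and \<open>w\<close> lies in the closure of \<open>V\<close>, the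
        control on \<open>P0\<close> improves this to \<open>e\<close>, the bound that
        \<open>h\<close> satisfied, so nothing is lost from letter to letter.\<close>
      have "d w b < \<epsilon>0" using s(4)[OF c(2) su] b c by simp
      moreover have "b \<in> M" using loct_in_topspace(2)[OF S_loct[OF S2] b] by simp
      moreover have "w \<in> ?K" using ranI[of k, OF ku] V VK by blast
      ultimately show "d w b < e" using eqP[OF S2 _ _ a b] x' z P(3) by blast
    qed
    then show "\<exists>h2. lifts x' w h2 \<and> agree T h2 (k \<circ>\<^sub>m h) x'"
      using agree_comp_right[OF hl hx' s(3)] by blast
  qed
  have ext: "R k u" if k: "k \<in> pg_restrict H V" and ku: "k u = Some w" for k u w
  proof -
    have k': "k \<in> generated_pseudogroup (subtopology T V) G" using k G(3) by simp
    \<comment> \<open>The restricted pseudogroup is generated in the subtopology of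
      \<open>V\<close>; as \<open>V\<close> is open, agreement there is agreement in
      \<open>T\<close>.\<close>
    have agT: "agree T f f' v" if "agree (subtopology T V) f f' v" for f f' v
      using that openin_open_subtopology[OF V_open] unfolding agree_def by blast
    have hl: "h \<in> loct T" "h x' = Some u" if "lifts x' u h" for h x' u
      using that S_loct unfolding lifts_def by auto
    show ?thesis using k' ku
    proof (induction rule: generated_pseudogroup_germ_induct)
      case loct
      then show ?case using G(2) H_loct unfolding loct_subtopology[OF V_open] pg_restrict_def by auto
    next
      case (agree k k' u w)
      show ?case unfolding R_def
      proof (intro ballI allI impI)
        fix x' h v assume h: "x' \<in> P" "lifts x' u h" "k' u = Some v"
        have "k u = Some v" using agree_eq[OF agree.hyps(4)] h(3) by simp
        then obtain h2 where h2: "lifts x' v h2" "agree T h2 (k \<circ>\<^sub>m h) x'"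
          using agree.IH h unfolding R_def by blast
        have "agree T h2 (k' \<circ>\<^sub>m h) x'"
          by (rule agree_trans[OF h2(2) agree_comp_right[OF hl[OF h(2)] agT[OF agree.hyps(4)]]])
        then show "\<exists>h2. lifts x' v h2 \<and> agree T h2 (k' \<circ>\<^sub>m h) x'" using h2 by blast
      qed
    next
      case (lid u)
      then have u: "u \<in> V" by simp
      have ag: "agree T (lid T) (lid (subtopology T V)) u"
        unfolding agree_def using V_open u openin_subset[OF V_open] by (intro exI[of _ V]) (auto simp: lid_def)
      show ?case unfolding R_def
      proof (intro ballI allI impI)
        fix x' h v assume h: "x' \<in> P" "lifts x' u h" "lid (subtopology T V) u = Some v"
        have "agree T h (lid (subtopology T V) \<circ>\<^sub>m h) x'"
          by (rule agree_trans[OF agree_sym[OF lid_comp_agree[OF hl[OF h(2)]]] agree_comp_right[OF hl[OF h(2)] ag]])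
        moreover have "v = u" using h(3) by (simp add: lid_eq_Some)
        ultimately show "\<exists>h2. lifts x' v h2 \<and> agree T h2 (lid (subtopology T V) \<circ>\<^sub>m h) x'" using h(2) by blast
      qed
    next
      case (gen g u w)
      have "extends_near \<epsilon>0 (\<rho>0 g) g u" using \<rho>0(2)[OF gen] by simp
      from extends_near_mono[OF this \<rho>(2)[OF gen(1)]] show ?case
        by (rule Rgood) (use G(2) gen in \<open>auto simp: pg_restrict_def\<close>)
    next
      case (inv g u w)
      have "extends_near \<epsilon>0 (\<rho>0 g) (linv g) w" using \<rho>0(2)[OF inv] by simp
      from extends_near_mono[OF this \<rho>(2)[OF inv(1)]] show ?case
      proof (rule Rgood)
        have gl: "g \<in> loct T" using inv(1) G(2) H_loct unfolding pg_restrict_def by auto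
        have "dom g \<subseteq> V" using G(2) inv(1) unfolding pg_restrict_def by auto
        then show "ran (linv g) \<subseteq> V" by (auto simp: ran_def linv_eq_Some[OF gl])
      qed
    next
      case (comp k k' u w v)
      show ?case unfolding R_def
      proof (intro ballI allI impI)
        fix x' h v' assume h: "x' \<in> P" "lifts x' u h" "(k' \<circ>\<^sub>m k) u = Some v'"
        have v': "k' w = Some v'" using h(3) comp.hyps(3) by simp
        obtain h2 where h2: "lifts x' w h2" "agree T h2 (k \<circ>\<^sub>m h) x'"
          using comp.IH(1) comp.hyps(3) h unfolding R_def by blast
        obtain h3 where h3: "lifts x' v' h3" "agree T h3 (k' \<circ>\<^sub>m h2) x'"
          using comp.IH(2) h(1) h2(1) v' unfolding R_def by blast
        have "agree T h3 ((k' \<circ>\<^sub>m k) \<circ>\<^sub>m h) x'"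
          unfolding map_comp_assoc3[symmetric]
          by (rule agree_trans[OF h3(2) agree_comp_left[OF h2(2)]])
        then show "\<exists>h2. lifts x' v' h2 \<and> agree T h2 ((k' \<circ>\<^sub>m k) \<circ>\<^sub>m h) x'" using h3 by blast
      qed
    qed
  qed
  show thesis
  proof (rule that[OF P(1,2)])
    fix x' k y assume x': "x' \<in> P" and k: "k \<in> pg_restrict H V" and kx: "k x' = Some y"
    have "d x' b < e" if "z \<in> P" "?i z = Some b" for z b
    proof -
      have "b = z" using that(2)[unfolded i_eq] that(1) by simp
      moreover have "d x x' < e/2" "d x z < e/2" "z \<in> M" "x' \<in> M"
        using that(1) x' PM by (auto simp: P_def)
      ultimately show ?thesis using triangle''[of x' x z] x by simp
    qed
    moreover have "dom ?i = P" by (auto simp: i_eq dom_def split: if_splits)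
    moreover have "?i x' = Some x'" using x' by (simp add: i_eq)
    ultimately have "lifts x' x' ?i" unfolding lifts_def using i by blast
    then obtain h where h: "lifts x' y h" "agree T h (k \<circ>\<^sub>m ?i) x'"
      using ext[OF k kx] x' kx unfolding R_def by blast
    have "agree T (k \<circ>\<^sub>m ?i) k x'"
      unfolding agree_def using P(1) x' by (intro exI[of _ P]) (auto simp: map_comp_def i_eq)
    then have "agree T h k x'" by (rule agree_trans[OF h(2)])
    moreover have "\<forall>z\<in>P. \<forall>b. h z = Some b \<longrightarrow> d y b < \<epsilon>"
      using h(1) e(2) unfolding lifts_def by fastforce
    ultimately show "\<exists>h\<in>S. dom h = P \<and> agree T h k x' \<and> (\<forall>z\<in>P. \<forall>b. h z = Some b \<longrightarrow> d y b < \<epsilon>)"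
      using h(1) unfolding lifts_def by blast
  qed
qed

lemma V_transport:
  assumes "x \<in> M" obtains a v where "a \<in> S" "a x = Some v" "v \<in> V"
proof -
  obtain g v where g: "g \<in> H" "g x = Some v" "v \<in> V"
    using orbit_V[OF assms] unfolding orbit_def by blast
  obtain s where s: "s \<in> S" "agree T s g x" using germS[OF g(1,2)] by blast
  show thesis using that[OF s(1) _ g(3)] agree_eq[OF s(2)] g(2) by simp
qed

text \<open>Conjugation by elements \<open>a\<close>, \<open>b\<close> of \<open>S\<close> that
  carry \<open>x\<close> and \<open>y\<close> into \<open>V\<close> reduces the claim to
  \<open>uniform_extension_in_V\<close>. \<open>P\<close> and \<open>R\<close> are chosen before
  \<open>g\<close>, so every germ from \<open>P\<close> to \<open>R\<close> extends to all of
  \<open>P\<close>.\<close>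

lemma uniform_extension:
  assumes x: "x \<in> M" and y: "y \<in> M" and W: "openin T W" "y \<in> W"
  obtains P R where "openin T P" "x \<in> P" "openin T R" "y \<in> R"
    "\<forall>g\<in>H. \<forall>x'\<in>P. \<forall>y'\<in>R. g x' = Some y' \<longrightarrow> (\<exists>h\<in>S. dom h = P \<and> ran h \<subseteq> W \<and> agree T h g x')"
proof -
  obtain a a0 where a: "a \<in> S" "a x = Some a0" "a0 \<in> V" using V_transport[OF x] .
  obtain b b0 where b: "b \<in> S" "b y = Some b0" "b0 \<in> V" using V_transport[OF y] .
  have al: "a \<in> loct T" and bl: "b \<in> loct T" using S_loct a b by auto
  have aM: "a0 \<in> M" and bM: "b0 \<in> M" using loct_in_topspace[OF al a(2)] loct_in_topspace[OF bl b(2)] by auto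
  \<comment> \<open>Extended images near \<open>b0\<close> are pulled back by \<open>b\<close> into
    \<open>W\<close>, so a ball around \<open>b0\<close> must lie in the image of \<open>W\<close>
    under \<open>b\<close>. Its radius is halved below: \<open>w\<close> lies within
    \<open>r/2\<close> of \<open>b0\<close>, and the extension within \<open>r/2\<close> of
    \<open>w\<close>.\<close>
  let ?B = "{w. \<exists>y\<in>W. b y = Some w}"
  obtain r where r: "r > 0" "mball b0 r \<subseteq> ?B"
    by (rule open_contains_mball[OF loct_image[OF bl W(1)], of b0]) (use W b in auto)
  have r2: "r/2 > 0" using r by simp
  obtain P0 where P0: "openin T P0" "a0 \<in> P0"
    and ext: "\<And>x' k y. x' \<in> P0 \<Longrightarrow> k \<in> pg_restrict H V \<Longrightarrow> k x' = Some y \<Longrightarrow>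
      \<exists>h\<in>S. dom h = P0 \<and> agree T h k x' \<and> (\<forall>z\<in>P0. \<forall>b. h z = Some b \<longrightarrow> d y b < r/2)"
    using uniform_extension_in_V[OF aM r2] by blast
  define P where "P = {z. \<exists>w\<in>P0 \<inter> V. a z = Some w}"
  define R where "R = {z. \<exists>w\<in>mball b0 (r/2) \<inter> V. b z = Some w}"
  have Po: "openin T P" unfolding P_def by (rule loct_preimage[OF al]) (use P0 V_open in auto)
  have Ro: "openin T R" unfolding R_def by (rule loct_preimage[OF bl]) (use V_open in auto)
  have psgH: "pseudo_star_group T H" using pseudogroup_psg[OF pgH] .
  show thesis
  proof (rule that[OF Po _ Ro], unfold Ball_def, safe)
    show "x \<in> P" using a P0 by (auto simp: P_def)
    show "y \<in> R" using b r2 bM by (auto simp: R_def)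
    fix g x' y' assume g: "g \<in> H" and x': "x' \<in> P" and gx: "g x' = Some y'" and y': "y' \<in> R"
    obtain v where v: "a x' = Some v" "v \<in> P0" "v \<in> V" using x' by (auto simp: P_def)
    obtain w where w: "b y' = Some w" "w \<in> V" "w \<in> mball b0 (r/2)" using y' by (auto simp: R_def)
    let ?k0 = "b \<circ>\<^sub>m (g \<circ>\<^sub>m linv a)"
    have k0: "?k0 \<in> H"
      by (intro psg_comp[OF psgH] psg_linv[OF psgH]) (use a b g SH in auto)
    have k0l: "?k0 \<in> loct T" using H_loct[OF k0] .
    \<comment> \<open>Restricting to points of \<open>V\<close> with image in \<open>V\<close> turns
      the conjugate into an element of \<open>pg_restrict H V\<close>.\<close>
    let ?N = "V \<inter> {z. \<exists>w\<in>V. ?k0 z = Some w}"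
    have No: "openin T ?N" using V_open loct_preimage[OF k0l V_open] by blast
    let ?k = "?k0 |` ?N"
    have k: "?k \<in> pg_restrict H V"
    proof -
      have "?N \<subseteq> dom ?k0" by (auto simp: dom_def)
      then have "?k \<in> H" using pseudogroup_restrict[OF pgH k0 No] by blast
      then show ?thesis unfolding pg_restrict_def by (auto simp: dom_def ran_def restrict_map_eq_Some)
    qed
    have k0v: "?k0 v = Some w" using v w gx linv_eq_Some[OF al] by simp
    then have kv: "?k v = Some w" using v w by (simp add: restrict_map_def)
    obtain h0 where h0: "h0 \<in> S" "dom h0 = P0" "agree T h0 ?k v" "\<forall>z\<in>P0. \<forall>b. h0 z = Some b \<longrightarrow> d w b < r/2"
      using ext[OF v(2) k kv] by blast
    have h0l: "h0 \<in> loct T" using S_loct h0 by auto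
    let ?h = "(linv b \<circ>\<^sub>m (h0 \<circ>\<^sub>m a)) |` P"
    have hS: "?h \<in> S"
      by (rule S_restrict[OF _ Po]) (intro psg_comp[OF psgS] psg_linv[OF psgS] a b h0)
    have hval: "\<exists>u\<in>W. ?h z = Some u \<and> (\<exists>c. (h0 \<circ>\<^sub>m a) z = Some c \<and> b u = Some c)" if z: "z \<in> P" for z
    proof -
      obtain c where c: "a z = Some c" "c \<in> P0" using z by (auto simp: P_def)
      obtain e where e: "h0 c = Some e" using c h0(2) by auto
      have "d w e < r/2" "e \<in> M" using h0(4) c e loct_in_topspace[OF h0l e] by auto
      then have "e \<in> mball b0 r" using triangle[of b0 w e] w(3) by auto
      then obtain u where u: "u \<in> W" "b u = Some e" using r(2) by blast
      then have "?h z = Some u" using c e z linv_eq_Some[OF bl] by (simp add: restrict_map_def)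
      then show ?thesis using u c e by auto
    qed
    show "\<exists>h\<in>S. dom h = P \<and> ran h \<subseteq> W \<and> agree T h g x'"
    proof (intro bexI[OF _ hS] conjI)
      show "dom ?h = P"
      proof
        show "dom ?h \<subseteq> P" by (auto simp: restrict_map_eq_Some dom_def)
        show "P \<subseteq> dom ?h" using hval by blast
      qed
      show "ran ?h \<subseteq> W"
      proof
        fix u assume "u \<in> ran ?h"
        then obtain z where z: "?h z = Some u" by (auto simp: ran_def)
        then have "z \<in> P" by (simp add: restrict_map_eq_Some)
        then show "u \<in> W" using hval z by fastforce
      qed
      obtain N where N: "openin T N" "v \<in> N" "\<And>z. z \<in> N \<Longrightarrow> h0 z = ?k z"
        using h0(3) unfolding agree_def by blast
      show "agree T ?h g x'" unfolding agree_def
      proof (intro exI[of _ "{z. \<exists>w\<in>N. a z = Some w} \<inter> P"] conjI ballI)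
        show "openin T ({z. \<exists>w\<in>N. a z = Some w} \<inter> P)" using loct_preimage[OF al N(1)] Po by blast
        show "x' \<in> {z. \<exists>w\<in>N. a z = Some w} \<inter> P" using v N x' by blast
        fix z assume z: "z \<in> {z. \<exists>w\<in>N. a z = Some w} \<inter> P"
        obtain c where c: "a z = Some c" "c \<in> N" using z by blast
        obtain u e where u: "?h z = Some u" "(h0 \<circ>\<^sub>m a) z = Some e" "b u = Some e" using hval z by blast
        have "?k c = Some e" using u(2) c N(3) by simp
        then have "(b \<circ>\<^sub>m (g \<circ>\<^sub>m linv a)) c = Some e" by (simp add: restrict_map_eq_Some)
        moreover have "linv a c = Some z" using linv_eq_Some[OF al] c by simp
        ultimately have "(b \<circ>\<^sub>m g) z = Some e" by (simp add: map_comp_def)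
        then obtain u' where "g z = Some u'" "b u' = Some e" unfolding map_comp_Some_iff by blast
        then show "?h z = g z" using loct_inj[OF bl u(3)] u(1) by simp
      qed
    qed
  qed
qed

end

section \<open>The closure and its space of germs\<close>

text \<open>A finite family of pairs stands for a basic open set of the compact-open topology. It
  does not mention a set of maps, so the same family can be imposed on maps with different
  domains.\<close>

definition co_pairs :: "'t topology \<Rightarrow> ('t set \<times> 't set) set \<Rightarrow> bool" where
  "co_pairs T \<K> \<longleftrightarrow> finite \<K> \<and> (\<forall>(K, V)\<in>\<K>. compactin T K \<and> openin T V)"

definition maps_pairs :: "('t set \<times> 't set) set \<Rightarrow> ('t \<rightharpoonup> 't) \<Rightarrow> bool" where
  "maps_pairs \<K> h \<longleftrightarrow> (\<forall>(K, V)\<in>\<K>. \<forall>x\<in>K. \<exists>y\<in>V. h x = Some y)"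

lemma maps_pairs_Un: "maps_pairs (\<K> \<union> \<L>) h \<longleftrightarrow> maps_pairs \<K> h \<and> maps_pairs \<L> h"
  by (simp add: maps_pairs_def ball_Un)

lemma co_pairs_Un: "co_pairs T (\<K> \<union> \<L>) \<longleftrightarrow> co_pairs T \<K> \<and> co_pairs T \<L>"
  by (auto simp: co_pairs_def)

lemma maps_pairs_single: "maps_pairs {(K, V)} h \<longleftrightarrow> (\<forall>x\<in>K. \<exists>y\<in>V. h x = Some y)"
  by (auto simp: maps_pairs_def)

lemma co_pairs_single: "co_pairs T {(K, V)} \<longleftrightarrow> compactin T K \<and> openin T V"
  by (auto simp: co_pairs_def)

lemma maps_pairs_empty [simp]: "maps_pairs {} h" and co_pairs_empty [simp]: "co_pairs T {}"
  by (auto simp: maps_pairs_def co_pairs_def)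

lemma openin_maps_pairs:
  assumes "co_pairs T \<K>" shows "openin (co_topology T \<A>) {h \<in> \<A>. maps_pairs \<K> h}"
proof -
  have base: "openin (co_topology T \<A>) {h \<in> \<A>. \<forall>x\<in>K. \<exists>y\<in>V. h x = Some y}"
    if "compactin T K" "openin T V" for K V
    unfolding co_topology_def by (rule topology_generated_by_Basis) (use that in blast)
  have "finite \<K>" using assms by (simp add: co_pairs_def)
  then show ?thesis using assms
  proof (induction \<K>)
    case empty
    \<comment> \<open>The pair of two empty sets imposes no condition, which makes all of
      \<open>\<A>\<close> open.\<close>
    have "openin (co_topology T \<A>) {h \<in> \<A>. \<forall>x\<in>{}. \<exists>y\<in>{}. h x = Some y}" by (rule base) auto
    then show ?case by simp
  next
    case (insert p \<K>)
    obtain K V where p: "p = (K, V)" by (cases p)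
    have "{h \<in> \<A>. maps_pairs (insert p \<K>) h} = {h \<in> \<A>. \<forall>x\<in>K. \<exists>y\<in>V. h x = Some y} \<inter> {h \<in> \<A>. maps_pairs \<K> h}"
      by (auto simp: maps_pairs_def p)
    moreover have "compactin T K" "openin T V" "co_pairs T \<K>"
      using insert.prems by (auto simp: co_pairs_def p)
    ultimately show ?case using insert.IH base by (simp add: openin_Int)
  qed
qed

lemma openin_co_topology:
  "openin (co_topology T \<A>) W \<longleftrightarrow>
     W \<subseteq> \<A> \<and> (\<forall>f\<in>W. \<exists>\<K>. co_pairs T \<K> \<and> maps_pairs \<K> f \<and> (\<forall>h\<in>\<A>. maps_pairs \<K> h \<longrightarrow> h \<in> W))"
  (is "_ \<longleftrightarrow> ?R W")
proof
  assume "openin (co_topology T \<A>) W"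
  then have "generate_topology_on {{h \<in> \<A>. \<forall>x\<in>K. \<exists>y\<in>V. h x = Some y} | K V. compactin T K \<and> openin T V} W"
    unfolding co_topology_def by (rule openin_topology_generated_by)
  then show "?R W"
  proof (induction rule: generate_topology_on.induct)
    case Empty then show ?case by simp
  next
    case (Int a b)
    show ?case
    proof (intro conjI ballI)
      show "a \<inter> b \<subseteq> \<A>" using Int by blast
      fix f assume f: "f \<in> a \<inter> b"
      obtain \<K> where K: "co_pairs T \<K>" "maps_pairs \<K> f" "\<forall>h\<in>\<A>. maps_pairs \<K> h \<longrightarrow> h \<in> a" using Int f by blast
      obtain \<L> where L: "co_pairs T \<L>" "maps_pairs \<L> f" "\<forall>h\<in>\<A>. maps_pairs \<L> h \<longrightarrow> h \<in> b" using Int f by blast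
      show "\<exists>\<K>. co_pairs T \<K> \<and> maps_pairs \<K> f \<and> (\<forall>h\<in>\<A>. maps_pairs \<K> h \<longrightarrow> h \<in> a \<inter> b)"
        by (rule exI[of _ "\<K> \<union> \<L>"]) (use K L in \<open>simp add: maps_pairs_Un co_pairs_Un\<close>)
    qed
  next
    case (UN \<W>)
    show ?case
    proof (intro conjI ballI)
      show "\<Union>\<W> \<subseteq> \<A>" using UN by blast
      fix f assume "f \<in> \<Union>\<W>"
      then obtain W where W: "W \<in> \<W>" "f \<in> W" by blast
      then obtain \<K> where K: "co_pairs T \<K>" "maps_pairs \<K> f" "\<forall>h\<in>\<A>. maps_pairs \<K> h \<longrightarrow> h \<in> W"
        using UN.IH by blast
      then show "\<exists>\<K>. co_pairs T \<K> \<and> maps_pairs \<K> f \<and> (\<forall>h\<in>\<A>. maps_pairs \<K> h \<longrightarrow> h \<in> \<Union>\<W>)"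
        using W(1) by blast
    qed
  next
    case (Basis s)
    then obtain K V where s: "s = {h \<in> \<A>. \<forall>x\<in>K. \<exists>y\<in>V. h x = Some y}" "compactin T K" "openin T V" by blast
    show ?case
    proof (intro conjI ballI)
      show "s \<subseteq> \<A>" using s(1) by blast
      fix f assume "f \<in> s"
      then show "\<exists>\<K>. co_pairs T \<K> \<and> maps_pairs \<K> f \<and> (\<forall>h\<in>\<A>. maps_pairs \<K> h \<longrightarrow> h \<in> s)"
        by (intro exI[of _ "{(K, V)}"]) (use s in \<open>simp add: maps_pairs_single co_pairs_single\<close>)
    qed
  qed
next
  assume R: "?R W"
  let ?\<W> = "{{h \<in> \<A>. maps_pairs \<K> h} | \<K>. co_pairs T \<K> \<and> {h \<in> \<A>. maps_pairs \<K> h} \<subseteq> W}"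
  have "W = \<Union>?\<W>"
  proof
    show "W \<subseteq> \<Union>?\<W>"
    proof
      fix f assume f: "f \<in> W"
      then obtain \<K> where "co_pairs T \<K>" "maps_pairs \<K> f" "\<forall>h\<in>\<A>. maps_pairs \<K> h \<longrightarrow> h \<in> W" using R by blast
      then show "f \<in> \<Union>?\<W>" using f R by (intro UnionI[of "{h \<in> \<A>. maps_pairs \<K> h}"]) blast+
    qed
  qed auto
  moreover have "openin (co_topology T \<A>) (\<Union>?\<W>)"
    by (rule openin_Union) (use openin_maps_pairs in blast)
  ultimately show "openin (co_topology T \<A>) W" by simp
qed

lemma topspace_co_topology [simp]: "topspace (co_topology T \<A>) = \<A>"
proof
  show "topspace (co_topology T \<A>) \<subseteq> \<A>"
    using openin_topspace[of "co_topology T \<A>"] unfolding openin_co_topology by blast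
  have "openin (co_topology T \<A>) \<A>" unfolding openin_co_topology by (auto intro: exI[of _ "{}"])
  then show "\<A> \<subseteq> topspace (co_topology T \<A>)" by (rule openin_subset)
qed

lemma in_closure_of_co_topology:
  "f \<in> co_topology T \<A> closure_of \<B> \<longleftrightarrow>
     f \<in> \<A> \<and> (\<forall>\<K>. co_pairs T \<K> \<longrightarrow> maps_pairs \<K> f \<longrightarrow> (\<exists>h\<in>\<B> \<inter> \<A>. maps_pairs \<K> h))"
proof (intro iffI conjI allI impI)
  assume f: "f \<in> co_topology T \<A> closure_of \<B>"
  then show fA: "f \<in> \<A>" unfolding in_closure_of by simp
  fix \<K> assume "co_pairs T \<K>" "maps_pairs \<K> f"
  then have "f \<in> {h \<in> \<A>. maps_pairs \<K> h} \<and> openin (co_topology T \<A>) {h \<in> \<A>. maps_pairs \<K> h}"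
    using openin_maps_pairs fA by simp
  then have "\<exists>y. y \<in> \<B> \<and> y \<in> {h \<in> \<A>. maps_pairs \<K> h}"
    using f[unfolded in_closure_of, THEN conjunct2, THEN spec[of _ "{h \<in> \<A>. maps_pairs \<K> h}"]] by simp
  then show "\<exists>h\<in>\<B> \<inter> \<A>. maps_pairs \<K> h" by blast
next
  assume R: "f \<in> \<A> \<and> (\<forall>\<K>. co_pairs T \<K> \<longrightarrow> maps_pairs \<K> f \<longrightarrow> (\<exists>h\<in>\<B> \<inter> \<A>. maps_pairs \<K> h))"
  show "f \<in> co_topology T \<A> closure_of \<B>"
    unfolding in_closure_of
  proof (intro conjI allI impI)
    show "f \<in> topspace (co_topology T \<A>)" using R by simp
    fix W assume W: "f \<in> W \<and> openin (co_topology T \<A>) W"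
    then obtain \<K> where "co_pairs T \<K>" "maps_pairs \<K> f" "\<forall>h\<in>\<A>. maps_pairs \<K> h \<longrightarrow> h \<in> W"
      unfolding openin_co_topology by blast
    then show "\<exists>y. y \<in> \<B> \<and> y \<in> W" using R by blast
  qed
qed

lemma loct_in_cmaps: "h \<in> loct T \<Longrightarrow> h \<in> cmaps T (dom h)"
  unfolding cmaps_def using loct_continuous by blast

text \<open>Elements of \<open>cmaps T Q\<close> have domain \<open>Q\<close>, so \<open>Q\<close>
  must be \<open>dom h\<close>: approximants share the domain of \<open>h\<close> exactly.\<close>

lemma in_closure_star:
  assumes S: "S \<subseteq> loct T"
  shows "h \<in> closure_star T S \<longleftrightarrow> h \<in> loct T \<and>
    (\<forall>\<K>. co_pairs T \<K> \<longrightarrow> maps_pairs \<K> h \<longrightarrow> (\<exists>f\<in>S. dom f = dom h \<and> maps_pairs \<K> f))"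
proof
  assume "h \<in> closure_star T S"
  then obtain Q where Q: "h \<in> loct T" "h \<in> co_topology T (cmaps T Q) closure_of {f \<in> S. dom f = Q}"
    unfolding closure_star_def by blast
  then have "dom h = Q" unfolding in_closure_of_co_topology cmaps_def by blast
  then show "h \<in> loct T \<and> (\<forall>\<K>. co_pairs T \<K> \<longrightarrow> maps_pairs \<K> h \<longrightarrow> (\<exists>f\<in>S. dom f = dom h \<and> maps_pairs \<K> f))"
    using Q unfolding in_closure_of_co_topology by blast
next
  assume R: "h \<in> loct T \<and> (\<forall>\<K>. co_pairs T \<K> \<longrightarrow> maps_pairs \<K> h \<longrightarrow> (\<exists>f\<in>S. dom f = dom h \<and> maps_pairs \<K> f))"
  have "h \<in> co_topology T (cmaps T (dom h)) closure_of {f \<in> S. dom f = dom h}"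
    unfolding in_closure_of_co_topology
  proof (intro conjI allI impI)
    show "h \<in> cmaps T (dom h)" using R loct_in_cmaps by blast
    fix \<K> assume "co_pairs T \<K>" "maps_pairs \<K> h"
    then obtain f where f: "f \<in> S" "dom f = dom h" "maps_pairs \<K> f" using R by blast
    then have "f \<in> cmaps T (dom h)" using loct_in_cmaps[of f T] S by auto
    then show "\<exists>f\<in>{f \<in> S. dom f = dom h} \<inter> cmaps T (dom h). maps_pairs \<K> f" using f by blast
  qed
  then show "h \<in> closure_star T S" using R loct_dom[of h T] unfolding closure_star_def by blast
qed

lemma closure_star_loct: "h \<in> closure_star T S \<Longrightarrow> h \<in> loct T"
  unfolding closure_star_def by blast

lemma closure_star_superset:
  assumes "S \<subseteq> loct T" shows "S \<subseteq> closure_star T S"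
proof
  fix h assume "h \<in> S"
  then show "h \<in> closure_star T S"
    unfolding in_closure_star[OF assms] using assms by auto
qed

lemma closure_star_mono:
  assumes "S' \<subseteq> loct T" "S \<subseteq> S'" shows "closure_star T S \<subseteq> closure_star T S'"
proof
  fix h assume "h \<in> closure_star T S"
  then show "h \<in> closure_star T S'"
    unfolding in_closure_star[OF assms(1)] in_closure_star[OF order_trans[OF assms(2,1)]]
    using assms(2) by blast
qed

lemma closure_pseudogroup_loct: "closure_pseudogroup T S \<subseteq> loct T"
  unfolding closure_pseudogroup_def by blast

section \<open>Germs and the topology of their space\<close>

lemma germ_eq_agree:
  assumes "agree T f g x" shows "germ T f x = germ T g x"
proof -
  have "agree T k f x \<longleftrightarrow> agree T k g x" for k
    using agree_trans[OF _ assms] agree_trans[OF _ agree_sym[OF assms]] by blast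
  then show ?thesis unfolding germ_def agree_def by simp
qed

lemma in_germ: "(f, y) \<in> germ T h x \<longleftrightarrow> y = x \<and> f \<in> loct T \<and> x \<in> dom f \<and> agree T f h x"
  unfolding germ_def agree_def by auto

lemma self_in_germ: "f \<in> loct T \<Longrightarrow> f x = Some y \<Longrightarrow> (f, x) \<in> germ T f x"
  unfolding in_germ using agree_refl[OF loct_in_topspace(1)] by auto

lemma germ_eqD:
  assumes "germ T f x = germ T g z" "f \<in> loct T" "f x = Some y"
  shows "z = x" "agree T f g x"
  using self_in_germ[OF assms(2,3)] unfolding assms(1) in_germ by auto

text \<open>For an admissible choice these are all the germs of
  \<open>closure_pseudogroup T S\<close> with target \<open>t\<close>, hence the points of
  \<open>germ_space_at T S t\<close>.\<close>

definition based_germs :: "'t topology \<Rightarrow> ('t \<rightharpoonup> 't) set \<Rightarrow> 't \<Rightarrow> (('t \<rightharpoonup> 't) \<times> 't) set set" where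
  "based_germs T S t = {germ T g x | g x. g \<in> closure_star T S \<and> g x = Some t}"

lemma topspace_germ_space:
  "topspace (germ_space T S) = (\<Union>t. based_germs T S t)"
proof -
  have "x \<in> topspace T" if "f \<in> closure_star T S" "x \<in> dom f" for f x
    using that loct_in_topspace[OF closure_star_loct] by auto
  then show ?thesis
    unfolding germ_space_def based_germs_def by (force simp: topspace_prod_topology image_iff)
qed

text \<open>The preimage of \<open>W\<close> under the germ map is a neighbourhood of
  \<open>(f, x)\<close>, in terms of basic open sets.\<close>

definition germs_near :: "'t topology \<Rightarrow> ('t \<rightharpoonup> 't) set \<Rightarrow> ('t \<rightharpoonup> 't) \<Rightarrow> 't \<Rightarrow> (('t \<rightharpoonup> 't) \<times> 't) set set \<Rightarrow> bool" where
  "germs_near T S f x W \<longleftrightarrow> (\<exists>\<K> U. co_pairs T \<K> \<and> maps_pairs \<K> f \<and> openin T U \<and> x \<in> U \<and>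
          (\<forall>g\<in>closure_star T S. maps_pairs \<K> g \<longrightarrow> (\<forall>z\<in>U \<inter> dom g. germ T g z \<in> W)))"

lemma openin_germ_space:
  assumes S: "S \<subseteq> loct T"
  shows "openin (germ_space T S) W \<longleftrightarrow>
    W \<subseteq> topspace (germ_space T S) \<and>
    (\<forall>f\<in>closure_star T S. \<forall>x\<in>dom f. germ T f x \<in> W \<longrightarrow> germs_near T S f x W)"
  (is "_ \<longleftrightarrow> _ \<and> ?R")
proof -
  let ?A = "closure_star T S"
  let ?P = "prod_topology (co_topology T ?A) T"
  let ?D = "{(f, x). x \<in> dom f}"
  let ?q = "\<lambda>(f, x). germ T f x"
  have dom_sub: "x \<in> topspace T" if "f \<in> ?A" "x \<in> dom f" for f x
    using that loct_in_topspace[OF closure_star_loct] by auto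
  have ts: "topspace (subtopology ?P ?D) = {(f, x). f \<in> ?A \<and> x \<in> dom f}"
    using dom_sub by (auto simp: topspace_prod_topology)
  have im: "?q ` topspace (subtopology ?P ?D) = topspace (germ_space T S)"
    unfolding germ_space_def by simp
  let ?E = "{p \<in> topspace (subtopology ?P ?D). ?q p \<in> W}"
  have "openin (subtopology ?P ?D) ?E \<longleftrightarrow> ?R"
  proof
    assume "openin (subtopology ?P ?D) ?E"
    then obtain N where N: "openin ?P N" "?E = N \<inter> ?D" unfolding openin_subtopology by blast
    show ?R
    proof (intro ballI impI)
      fix f x assume f: "f \<in> ?A" and x: "x \<in> dom f" and W: "germ T f x \<in> W"
      then have "(f, x) \<in> ?E" unfolding ts by simp
      then have "(f, x) \<in> N" using N by blast
      then obtain B U where BU: "openin (co_topology T ?A) B" "openin T U" "f \<in> B" "x \<in> U" "B \<times> U \<subseteq> N"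
        using N(1)[unfolded openin_prod_topology_alt, rule_format] by metis
      then obtain \<K> where K: "co_pairs T \<K>" "maps_pairs \<K> f" "\<forall>h\<in>?A. maps_pairs \<K> h \<longrightarrow> h \<in> B"
        unfolding openin_co_topology by blast
      have "germ T g z \<in> W" if "g \<in> ?A" "maps_pairs \<K> g" "z \<in> U \<inter> dom g" for g z
      proof -
        have "(g, z) \<in> N \<inter> ?D" using that K(3) BU(5) by blast
        then have "(g, z) \<in> ?E" using N(2) by simp
        then show ?thesis by simp
      qed
      then show "germs_near T S f x W" unfolding germs_near_def using K BU by blast
    qed
  next
    assume R: ?R
    show "openin (subtopology ?P ?D) ?E"
    proof (subst openin_subopen, intro ballI)
      fix p assume p: "p \<in> ?E"
      obtain f x where fx: "p = (f, x)" by (cases p)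
      have f: "f \<in> ?A" "x \<in> dom f" "germ T f x \<in> W" using p unfolding ts fx by auto
      obtain \<K> U where K: "co_pairs T \<K>" "maps_pairs \<K> f" "openin T U" "x \<in> U"
          "\<forall>g\<in>?A. maps_pairs \<K> g \<longrightarrow> (\<forall>z\<in>U \<inter> dom g. germ T g z \<in> W)"
        using R f unfolding germs_near_def by blast
      let ?N = "({h \<in> ?A. maps_pairs \<K> h} \<times> U) \<inter> ?D"
      have "openin ?P ({h \<in> ?A. maps_pairs \<K> h} \<times> U)"
        using openin_prod_Times_iff openin_maps_pairs[OF K(1)] K(3) by blast
      then have o: "openin (subtopology ?P ?D) ?N" by (rule openin_subtopology_Int)
      have "p \<in> ?N" using f K fx by simp
      moreover have "?N \<subseteq> ?E" unfolding ts using K(5) by auto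
      ultimately show "\<exists>N. openin (subtopology ?P ?D) N \<and> p \<in> N \<and> N \<subseteq> ?E" using o by blast
    qed
  qed
  then show ?thesis
    unfolding germ_space_def[of T S] openin_quotient_topology im unfolding germ_space_def by simp
qed

section \<open>Independence of the choice of \<open>S\<close>\<close>

definition quasi_analytic :: "'t topology \<Rightarrow> ('t \<rightharpoonup> 't) set \<Rightarrow> bool" where
  "quasi_analytic T S \<longleftrightarrow> (\<forall>h\<in>S. (\<exists>V. openin T V \<and> V \<noteq> {} \<and> V \<subseteq> dom h \<and> (\<forall>x\<in>V. h x = Some x)) \<longrightarrow>
        (\<forall>x\<in>dom h. h x = Some x))"

lemma quasi_analyticD:
  assumes "quasi_analytic T S" "h \<in> S" "agree T h (lid T) x" "z \<in> dom h"
  shows "h z = Some z"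
proof -
  obtain W where W: "openin T W" "x \<in> W" "\<And>z. z \<in> W \<Longrightarrow> h z = lid T z"
    using assms(3) unfolding agree_def by blast
  have "\<forall>z\<in>W. h z = Some z" using W openin_subset[OF W(1)] by (auto simp: lid_def)
  then have "\<exists>V. openin T V \<and> V \<noteq> {} \<and> V \<subseteq> dom h \<and> (\<forall>x\<in>V. h x = Some x)"
    using W(1,2) by (intro exI[of _ W]) auto
  then show ?thesis using assms(1,2,4) unfolding quasi_analytic_def by blast
qed

lemma quasi_analytic_mono: "quasi_analytic T S' \<Longrightarrow> S \<subseteq> S' \<Longrightarrow> quasi_analytic T S"
  unfolding quasi_analytic_def by blast

context equi_pg
begin

lemma Hausdorff_T: "Hausdorff_space T"
  unfolding T_def by (rule Hausdorff_space_mtopology)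

lemma compact_neighbourhood:
  assumes "openin T N" "x \<in> N"
  obtains K Q where "compactin T K" "openin T Q" "x \<in> Q" "Q \<subseteq> K" "K \<subseteq> N"
proof -
  have "neighbourhood_base_of (compactin T) T"
    using lc locally_compact_space_neighbourhood_base Hausdorff_T by blast
  then show thesis using that assms unfolding neighbourhood_base_of by metis
qed

lemma S_subset_loct: "S \<subseteq> loct T" using S_loct by blast

text \<open>In the application \<open>S\<close> is \<open>S0 \<inter> S1\<close> and
  \<open>S'\<close> is \<open>S0\<close> or \<open>S1\<close>; the main statements below are applied
  to both.\<close>

context
  fixes S' assumes psgS': "pseudo_star_group T S'" and SS': "S \<subseteq> S'" and S'H: "S' \<subseteq> H"
    and qa: "quasi_analytic T S'"
begin

lemma S'_subset_loct: "S' \<subseteq> loct T" using H_loct S'H by blast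

text \<open>Quasi-analyticity of \<open>S'\<close> compares \<open>f'\<close> with the extension \<open>h\<close> of its germ only where a composite
  of one with the inverse of the other is defined, and images of maps close to \<open>f\<close> need not contain a fixed
  neighbourhood. So both are composed with an extension \<open>k\<close> of the germ of the inverse of \<open>f'\<close>, whose domain
  has uniform size.\<close>

lemma close_maps_in_S:
  assumes f: "f \<in> loct T" "f x = Some y"
  obtains K Q Y where "compactin T K" "openin T Q" "openin T Y" "x \<in> Q" "Q \<subseteq> K"
    "maps_pairs {(K, Y)} f" "\<forall>f'\<in>S'. maps_pairs {(K, Y)} f' \<longrightarrow> f' |` Q \<in> S"
proof -
  have xM: "x \<in> M" and yM: "y \<in> M" using loct_in_topspace[OF f] by auto
  have MM: "openin T M" using openin_topspace[of T] by simp
  \<comment> \<open>\<open>P1\<close> is a common domain for extensions \<open>k\<close> of germs of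
    inverses, with source near \<open>y\<close> and target near \<open>x\<close>. \<open>P2\<close>
    below is a common domain for the extensions \<open>h\<close>, whose images stay in
    \<open>P1\<close> so that \<open>k\<close> can be applied to them.\<close>
  obtain P1 R1 where P1: "openin T P1" "y \<in> P1" "openin T R1" "x \<in> R1"
    and ext1: "\<forall>g\<in>H. \<forall>x'\<in>P1. \<forall>y'\<in>R1. g x' = Some y' \<longrightarrow> (\<exists>h\<in>S. dom h = P1 \<and> ran h \<subseteq> M \<and> agree T h g x')"
    by (rule uniform_extension[OF yM xM MM xM])
  obtain P2 R2 where P2: "openin T P2" "x \<in> P2" "openin T R2" "y \<in> R2"
    and ext2: "\<forall>g\<in>H. \<forall>x'\<in>P2. \<forall>y'\<in>R2. g x' = Some y' \<longrightarrow> (\<exists>h\<in>S. dom h = P2 \<and> ran h \<subseteq> P1 \<and> agree T h g x')"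
    by (rule uniform_extension[OF xM yM P1(1,2)])
  let ?Y = "R2 \<inter> P1"
  have Yo: "openin T ?Y" using P1 P2 by blast
  let ?N = "{z. \<exists>w\<in>?Y. f z = Some w} \<inter> P2 \<inter> R1"
  have "openin T ?N" using loct_preimage[OF f(1) Yo] P1 P2 by blast
  moreover have "x \<in> ?N" using f P1 P2 by blast
  ultimately obtain K Q where KQ: "compactin T K" "openin T Q" "x \<in> Q" "Q \<subseteq> K" "K \<subseteq> ?N"
    using compact_neighbourhood by blast
  show thesis
  proof (rule that[OF KQ(1,2) Yo KQ(3,4)], unfold maps_pairs_single, safe)
    show "\<exists>w\<in>?Y. f z = Some w" if "z \<in> K" for z using that KQ(5) by blast
    fix f' assume f': "f' \<in> S'" and f'K0: "\<forall>z\<in>K. \<exists>w\<in>?Y. f' z = Some w"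
    note f'K = f'K0[rule_format]
    have fl: "f' \<in> loct T" using f' S'_subset_loct by blast
    have fH: "f' \<in> H" using f' S'H by blast
    obtain y' where y': "f' x = Some y'" "y' \<in> R2" "y' \<in> P1" using f'K KQ by blast
    obtain h where h: "h \<in> S" "dom h = P2" "ran h \<subseteq> P1" "agree T h f' x"
      using ext2 fH P2(2) y'(1,2) by blast
    have lH: "linv f' \<in> H" using psg_linv[OF pseudogroup_psg[OF pgH] fH] .
    have ly: "linv f' y' = Some x" using linv_eq_Some[OF fl] y' by simp
    obtain k where k: "k \<in> S" "dom k = P1" "agree T k (linv f') y'"
      using ext1 lH y'(3) ly P1(4) by blast
    have kl: "k \<in> loct T" and hl: "h \<in> loct T" using k h S_loct by auto
    have hx: "h x = Some y'" using agree_eq[OF h(4)] y' by simp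
    have a: "agree T (linv f' \<circ>\<^sub>m f') (lid T) x" by (rule linv_comp_agree[OF fl y'(1)])
    have a1: "agree T (k \<circ>\<^sub>m f') (lid T) x"
      by (rule agree_trans[OF agree_comp_right[OF fl y'(1) k(3)] a])
    have a2: "agree T (k \<circ>\<^sub>m h) (lid T) x"
      by (rule agree_trans[OF agree_comp[OF hl hx h(4) k(3)] a])
    have in1: "k \<circ>\<^sub>m f' \<in> S'" using psg_comp[OF psgS' f'] k(1) SS' by blast
    have in2: "k \<circ>\<^sub>m h \<in> S'" using psg_comp[OF psgS' ] k(1) h(1) SS' by blast
    \<comment> \<open>Both composites with \<open>k\<close> have the identity germ at
      \<open>x\<close> and are defined on \<open>K\<close>, so both are the identity there, and
      \<open>k\<close> is injective.\<close>
    have eq: "f' z = h z" if z: "z \<in> K" for z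
    proof -
      obtain w where w: "f' z = Some w" "w \<in> P1" using f'K[OF z] by blast
      then obtain c where "k w = Some c" using k(2) by blast
      then have "z \<in> dom (k \<circ>\<^sub>m f')" using w by (simp add: dom_def)
      from quasi_analyticD[OF qa in1 a1 this] have kw: "k w = Some z" using w by simp
      have "z \<in> P2" using z KQ by blast
      then obtain w' where w': "h z = Some w'" using h(2) by blast
      then have "w' \<in> P1" using h(3) by (auto simp: ran_def)
      then obtain c' where "k w' = Some c'" using k(2) by blast
      then have "z \<in> dom (k \<circ>\<^sub>m h)" using w' by (simp add: dom_def)
      from quasi_analyticD[OF qa in2 a2 this] have "k w' = Some z" using w' by simp
      then show ?thesis using loct_inj[OF kl kw] w w' by simp
    qed
    have "f' |` Q = h |` Q" using eq KQ(4) by (auto simp: restrict_map_def fun_eq_iff)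
    then show "f' |` Q \<in> S" using S_restrict[OF h(1) KQ(2)] by simp
  qed
qed

text \<open>The condition on \<open>K\<close> and \<open>Y\<close> is open, so approximants of
  \<open>f'\<close> in \<open>S'\<close> can be chosen to satisfy it too; their restrictions to
  \<open>Q\<close> lie in \<open>S\<close> and approximate the restriction of
  \<open>f'\<close>.\<close>

lemma close_maps_in_closure_star:
  assumes f: "f \<in> closure_star T S'" "f x = Some y"
  obtains K Q Y where "compactin T K" "openin T Q" "openin T Y" "x \<in> Q" "Q \<subseteq> K"
    "maps_pairs {(K, Y)} f" "\<forall>f'\<in>closure_star T S'. maps_pairs {(K, Y)} f' \<longrightarrow> f' |` Q \<in> closure_star T S"
proof -
  obtain K Q Y where KQ: "compactin T K" "openin T Q" "openin T Y" "x \<in> Q" "Q \<subseteq> K"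
    "maps_pairs {(K, Y)} f" and c: "\<forall>f'\<in>S'. maps_pairs {(K, Y)} f' \<longrightarrow> f' |` Q \<in> S"
    by (rule close_maps_in_S[OF closure_star_loct[OF f(1)] f(2)])
  show thesis
  proof (rule that[OF KQ], intro ballI impI)
    fix f' assume f': "f' \<in> closure_star T S'" and f'K: "maps_pairs {(K, Y)} f'"
    have fl: "f' \<in> loct T" using closure_star_loct[OF f'] .
    show "f' |` Q \<in> closure_star T S"
      unfolding in_closure_star[OF S_subset_loct]
    proof (intro conjI allI impI)
      show "f' |` Q \<in> loct T" by (rule restrict_map_in_loct[OF fl KQ(2)])
      fix \<K> assume K: "co_pairs T \<K>" "maps_pairs \<K> (f' |` Q)"
      \<comment> \<open>A condition met by the restriction concerns a compact subset of
        \<open>Q\<close>, so it passes between a map and its restriction.\<close>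
      have KsubQ: "L \<subseteq> Q" if "(L, V) \<in> \<K>" for L V
        using that K(2) unfolding maps_pairs_def by (fastforce simp: restrict_map_eq_Some)
      have "maps_pairs (\<K> \<union> {(K, Y)}) f'"
        unfolding maps_pairs_Un
      proof
        show "maps_pairs \<K> f'"
          using K(2) unfolding maps_pairs_def by (fastforce simp: restrict_map_eq_Some)
      qed (rule f'K)
      moreover have "co_pairs T (\<K> \<union> {(K, Y)})" using K(1) KQ(1,3) unfolding co_pairs_Un co_pairs_single by blast
      ultimately obtain f2 where f2: "f2 \<in> S'" "dom f2 = dom f'" "maps_pairs (\<K> \<union> {(K, Y)}) f2"
        using f' unfolding in_closure_star[OF S'_subset_loct] by blast
      have "f2 |` Q \<in> S" using c f2(1,3) unfolding maps_pairs_Un by blast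
      moreover have "dom (f2 |` Q) = dom (f' |` Q)" using f2(2) by simp
      moreover have "maps_pairs \<K> (f2 |` Q)"
        using f2(3) KsubQ unfolding maps_pairs_Un maps_pairs_def by (fastforce simp: restrict_map_eq_Some)
      ultimately show "\<exists>f\<in>S. dom f = dom (f' |` Q) \<and> maps_pairs \<K> f" by blast
    qed
  qed
qed

lemma closure_star_subset: "closure_star T S \<subseteq> closure_star T S'"
  by (rule closure_star_mono[OF S'_subset_loct SS'])

lemma closure_star_germ:
  assumes "f \<in> closure_star T S'" "f x = Some y"
  obtains g where "g \<in> closure_star T S" "agree T g f x"
proof -
  obtain K Q Y where KQ0: "compactin T K" and KQ1: "openin T Q" and "openin T Y" and KQ2: "x \<in> Q"
    and "Q \<subseteq> K" and KQ3: "maps_pairs {(K, Y)} f"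
    and KQ4: "\<forall>f'\<in>closure_star T S'. maps_pairs {(K, Y)} f' \<longrightarrow> f' |` Q \<in> closure_star T S"
    by (rule close_maps_in_closure_star[OF assms])
  show thesis
    by (rule that[OF KQ4[rule_format, OF assms(1) KQ3] agree_restrict[OF KQ1 KQ2]])
qed

lemma based_germs_eq:
  "based_germs T S' t = based_germs T S t"
proof (intro equalityI subsetI)
  fix \<gamma> assume "\<gamma> \<in> based_germs T S' t"
  then obtain f x where f: "\<gamma> = germ T f x" "f \<in> closure_star T S'" "f x = Some t" unfolding based_germs_def by blast
  obtain g where g: "g \<in> closure_star T S" "agree T g f x" using closure_star_germ[OF f(2,3)] .
  then have "\<gamma> = germ T g x" "g x = Some t"
    using f germ_eq_agree[OF g(2)] agree_eq[OF g(2)] by simp_all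
  then show "\<gamma> \<in> based_germs T S t" using g unfolding based_germs_def by blast
next
  fix \<gamma> assume "\<gamma> \<in> based_germs T S t"
  then obtain f x where f: "\<gamma> = germ T f x" "f \<in> closure_star T S" "f x = Some t" unfolding based_germs_def by blast
  have "f \<in> closure_star T S'" using f(2) closure_star_subset by blast
  then show "\<gamma> \<in> based_germs T S' t" using f(1,3) unfolding based_germs_def by blast
qed

text \<open>\<open>closure_star T S\<close> is the smaller set, so sets open for \<open>S'\<close>
  are open for \<open>S\<close>. Conversely, restriction to \<open>Q\<close> carries a neighbourhood
  of \<open>f\<close> in the larger set into the smaller one without changing germs at points of
  \<open>Q\<close>.\<close>

lemma germ_space_eq: "germ_space T S' = germ_space T S"
proof -
  have tops: "topspace (germ_space T S') = topspace (germ_space T S)"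
    unfolding topspace_germ_space based_germs_eq ..
  have "openin (germ_space T S') W \<longleftrightarrow> openin (germ_space T S) W" for W
  proof
    assume "openin (germ_space T S') W"
    note W = this[unfolded openin_germ_space[OF S'_subset_loct]]
    show "openin (germ_space T S) W"
      unfolding openin_germ_space[OF S_subset_loct]
    proof (intro conjI ballI impI)
      show "W \<subseteq> topspace (germ_space T S)"
        using W[THEN conjunct1] unfolding tops .
      fix f x assume f: "f \<in> closure_star T S" "x \<in> dom f" "germ T f x \<in> W"
      have fS': "f \<in> closure_star T S'" using f closure_star_subset by blast
      have "germs_near T S' f x W"
        using W[THEN conjunct2, THEN bspec, THEN bspec, THEN mp, OF fS' f(2,3)] .
      then show "germs_near T S f x W"
        unfolding germs_near_def using closure_star_subset by (elim exE conjE) (intro exI conjI, auto)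
    qed
  next
    assume "openin (germ_space T S) W"
    note W = this[unfolded openin_germ_space[OF S_subset_loct]]
    show "openin (germ_space T S') W"
      unfolding openin_germ_space[OF S'_subset_loct]
    proof (intro conjI ballI impI)
      show "W \<subseteq> topspace (germ_space T S')"
        using W[THEN conjunct1] unfolding tops .
      fix f x assume f: "f \<in> closure_star T S'" "x \<in> dom f" "germ T f x \<in> W"
      obtain y where y: "f x = Some y" using f(2) by blast
      obtain K Q Y where KQ: "compactin T K" "openin T Q" "openin T Y" "x \<in> Q" "Q \<subseteq> K"
        "maps_pairs {(K, Y)} f" "\<forall>f'\<in>closure_star T S'. maps_pairs {(K, Y)} f' \<longrightarrow> f' |` Q \<in> closure_star T S"
        by (rule close_maps_in_closure_star[OF f(1) y])
      have fQ: "f |` Q \<in> closure_star T S" using KQ(6,7) f(1) by blast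
      have gQ: "germ T (g |` Q) z = germ T g z" if "z \<in> Q" for g z
        by (rule germ_eq_agree[OF agree_restrict[OF KQ(2) that]])
      have "x \<in> dom (f |` Q)" "germ T (f |` Q) x \<in> W" using KQ(4) f gQ by auto
      then have "germs_near T S (f |` Q) x W"
        using W[THEN conjunct2, THEN bspec, THEN bspec, THEN mp, OF fQ] by simp
      then obtain \<K> U where K: "co_pairs T \<K>" "maps_pairs \<K> (f |` Q)" "openin T U" "x \<in> U"
          "\<forall>g\<in>closure_star T S. maps_pairs \<K> g \<longrightarrow> (\<forall>z\<in>U \<inter> dom g. germ T g z \<in> W)"
        unfolding germs_near_def by (elim exE conjE)
      have KsubQ: "L \<subseteq> Q" if "(L, V) \<in> \<K>" for L V
        using that K(2) unfolding maps_pairs_def by (fastforce simp: restrict_map_eq_Some)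
      have c1: "co_pairs T (\<K> \<union> {(K, Y)})" using K(1) KQ(1,3) unfolding co_pairs_Un co_pairs_single by blast
      have "maps_pairs \<K> f"
        using K(2) unfolding maps_pairs_def by (fastforce simp: restrict_map_eq_Some)
      then have c2: "maps_pairs (\<K> \<union> {(K, Y)}) f"
        unfolding maps_pairs_Un using KQ(6) by blast
      have c3: "openin T (U \<inter> Q)" "x \<in> U \<inter> Q" using K KQ by auto
      have "germ T g z \<in> W" if g: "g \<in> closure_star T S'" "maps_pairs (\<K> \<union> {(K, Y)}) g" and z: "z \<in> (U \<inter> Q) \<inter> dom g" for g z
      proof -
        have m: "maps_pairs \<K> g" "maps_pairs {(K, Y)} g"
          using g(2) unfolding maps_pairs_Un by auto
        have "g |` Q \<in> closure_star T S" using KQ(7) g(1) m(2) by blast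
        moreover have "maps_pairs \<K> (g |` Q)"
          using m(1) KsubQ unfolding maps_pairs_def by (fastforce simp: restrict_map_eq_Some)
        moreover have "z \<in> U \<inter> dom (g |` Q)" using z by auto
        ultimately have "germ T (g |` Q) z \<in> W" using K(5) by blast
        then show ?thesis using gQ z by simp
      qed
      then show "germs_near T S' f x W"
        unfolding germs_near_def using c1 c2 c3 by blast
    qed
  qed
  then show ?thesis by (simp add: topology_eq)
qed

end

end

section \<open>Transitivity of the closure\<close>

context Metric_space
begin

text \<open>Tychonoff's theorem, applied to the nested closures of the tails. An accumulation point
  takes the place of the limit of a subsequence since \<open>J\<close> may be uncountable; it is
  approximated on finitely many indices at a time, with arbitrarily large \<open>n\<close>.\<close>

lemma pointwise_accumulation:
  assumes C: "\<And>j. j \<in> J \<Longrightarrow> compactin mtopology (C j)"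
    and u: "\<And>(n::nat) j. j \<in> J \<Longrightarrow> u n j \<in> C j"
  obtains f where "\<forall>j\<in>J. f j \<in> C j"
    "\<forall>F \<epsilon> N. finite F \<longrightarrow> F \<subseteq> J \<longrightarrow> \<epsilon> > 0 \<longrightarrow> (\<exists>n\<ge>N. \<forall>j\<in>F. d (u n j) (f j) < \<epsilon>)"
proof -
  let ?X = "product_topology (\<lambda>j. subtopology mtopology (C j)) J"
  have CM: "C j \<subseteq> M" if "j \<in> J" for j
    using compactin_subset_topspace[OF C[OF that]] by simp
  have "compact_space ?X"
    unfolding compact_space_product_topology using C by (auto simp: compact_space_subtopology)
  have ts: "topspace ?X = (\<Pi>\<^sub>E j\<in>J. C j)"
    using CM by (auto simp: topspace_product_topology PiE_iff)
  \<comment> \<open>Points of the product are extensional functions.\<close>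
  let ?v = "\<lambda>n. restrict (u n) J"
  let ?A = "\<lambda>N. ?X closure_of (?v ` {N..})"
  have v: "?v n \<in> topspace ?X" for n unfolding ts using u by auto
  have "(\<Inter>N. ?A N) \<noteq> {}"
  proof (rule compact_space_imp_nest[OF \<open>compact_space ?X\<close>])
    show "closedin ?X (?A N)" for N by simp
    show "?A N \<noteq> {}" for N
    proof -
      have "?v ` {N..} \<subseteq> ?A N" by (rule closure_of_subset) (use v in blast)
      then show ?thesis by blast
    qed
    show "decseq ?A" unfolding decseq_def by (intro allI impI closure_of_mono image_mono) auto
  qed
  then obtain f where f: "\<And>N. f \<in> ?A N" by blast
  then have fts: "f \<in> topspace ?X" using in_closure_of by metis
  show thesis
  proof (rule that, safe)
    show fC: "f j \<in> C j" if "j \<in> J" for j using fts that unfolding ts by blast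
    fix F \<epsilon> N assume F: "finite F" "F \<subseteq> J" and \<epsilon>: "\<epsilon> > (0::real)"
    let ?W = "\<Inter>(insert (topspace ?X) ((\<lambda>j. {g \<in> topspace ?X. g j \<in> C j \<inter> mball (f j) \<epsilon>}) ` F))"
    have "openin ?X ?W"
    proof (rule openin_Inter)
      fix W assume "W \<in> insert (topspace ?X) ((\<lambda>j. {g \<in> topspace ?X. g j \<in> C j \<inter> mball (f j) \<epsilon>}) ` F)"
      then consider "W = topspace ?X" | j where "j \<in> F" "W = {g \<in> topspace ?X. g j \<in> C j \<inter> mball (f j) \<epsilon>}" by blast
      then show "openin ?X W"
      proof cases
        case 1 then show ?thesis by (simp only: openin_topspace)
      next
        case 2
        have "continuous_map ?X (subtopology mtopology (C j)) (\<lambda>g. g j)"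
          by (rule continuous_map_product_projection) (use 2 F in blast)
        then show ?thesis unfolding 2(2)
          by (rule openin_continuous_map_preimage) (rule openin_subtopology_Int2, simp)
      qed
    qed (use F in auto)
    moreover have "f \<in> ?W"
    proof -
      have "f j \<in> C j \<inter> mball (f j) \<epsilon>" if "j \<in> F" for j
      proof -
        have "j \<in> J" using that F by blast
        then have "f j \<in> C j" "f j \<in> M" using fC CM by auto
        then show ?thesis using \<epsilon> by simp
      qed
      then show ?thesis using fts by blast
    qed
    ultimately obtain g where "g \<in> ?v ` {N..}" "g \<in> ?W" using f[of N] unfolding in_closure_of by blast
    then obtain n where n: "n \<ge> N" "?v n \<in> ?W" by blast
    have "d (u n j) (f j) < \<epsilon>" if "j \<in> F" for j
    proof -
      have "?v n j \<in> mball (f j) \<epsilon>" using n(2) that by blast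
      then show ?thesis using that F commute[of "f j"] by auto
    qed
    then show "\<exists>n\<ge>N. \<forall>j\<in>F. d (u n j) (f j) < \<epsilon>" using n(1) by blast
  qed
qed

definition equicontinuous_maps :: "'a set \<Rightarrow> (nat \<Rightarrow> 'a \<Rightarrow> 'a) \<Rightarrow> bool" where
  "equicontinuous_maps A h \<longleftrightarrow> (\<forall>\<epsilon>>0. \<forall>x\<in>A. \<exists>P. openin mtopology P \<and> x \<in> P \<and>
     (\<forall>n. \<forall>z\<in>P \<inter> A. d (h n x) (h n z) < \<epsilon>))"

lemma equicontinuous_mapsD:
  assumes "equicontinuous_maps A h" "\<epsilon> > 0" "x \<in> A"
  obtains P where "openin mtopology P" "x \<in> P" "\<forall>n. \<forall>z\<in>P \<inter> A. d (h n x) (h n z) < \<epsilon>"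
  using assms(1)[unfolded equicontinuous_maps_def, rule_format, OF assms(2,3)] that
  by (elim exE conjE)

text \<open>A three-term estimate in which \<open>n\<close> is chosen for both points at once, after
  \<open>P\<close>; this is possible because \<open>P\<close> does not depend on
  \<open>n\<close>.\<close>

lemma equicontinuous_limit:
  assumes eq: "equicontinuous_maps A h" and M: "\<And>n z. z \<in> A \<Longrightarrow> h n z \<in> M" "\<And>z. z \<in> A \<Longrightarrow> f z \<in> M"
    and acc: "\<And>G \<epsilon>. finite G \<Longrightarrow> G \<subseteq> A \<Longrightarrow> \<epsilon> > 0 \<Longrightarrow> \<exists>n. \<forall>z\<in>G. d (h n z) (f z) < \<epsilon>"
    and V: "openin mtopology V" and x: "x \<in> A" "f x \<in> V"
  shows "\<exists>P. openin mtopology P \<and> x \<in> P \<and> (\<forall>z\<in>P \<inter> A. f z \<in> V)"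
proof -
  obtain r where r: "r > 0" "mball (f x) r \<subseteq> V" using V x(2) unfolding openin_mtopology by blast
  have r3: "r / 3 > 0" using r by simp
  obtain P where P: "openin mtopology P" "x \<in> P" "\<forall>n. \<forall>w\<in>P \<inter> A. d (h n x) (h n w) < r / 3"
    by (rule equicontinuous_mapsD[OF eq r3 x(1)])
  have "f z \<in> V" if z: "z \<in> P \<inter> A" for z
  proof -
    obtain n where n: "d (h n x) (f x) < r / 3" "d (h n z) (f z) < r / 3"
      using acc[of "{x, z}" "r / 3"] x z r3 by auto
    have "d (h n x) (h n z) < r / 3" using P(3) z by blast
    then have "d (f x) (f z) < r"
      using n triangle''[of "f x" "h n x" "f z"] triangle[of "h n x" "h n z" "f z"] M x(1) z
      by auto
    then show ?thesis using r(2) M(2)[OF x(1)] M(2)[of z] z by auto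
  qed
  then show ?thesis using P by blast
qed

text \<open>\<open>h\<close> and \<open>k\<close> are treated as one family over the disjoint union
  of \<open>A\<close> and \<open>B\<close>: accumulation points found separately might need
  different indices, and then the relations between \<open>h n\<close> and \<open>k n\<close> would
  say nothing about \<open>f\<close> and \<open>l\<close>. Values of \<open>l\<close> may leave
  \<open>A\<close>, which is why \<open>f (l z) = z\<close> is conditional.\<close>

lemma limit_of_inverse_pairs:
  fixes h k :: "nat \<Rightarrow> 'a \<Rightarrow> 'a"
  assumes AM: "A \<subseteq> M" and BM: "B \<subseteq> M"
    and C: "compactin mtopology C" "C \<subseteq> B" "compactin mtopology D"
    and h: "\<And>n z. z \<in> A \<Longrightarrow> h n z \<in> C" and k: "\<And>n z. z \<in> B \<Longrightarrow> k n z \<in> D"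
    and equih: "equicontinuous_maps A h"
    and equik: "equicontinuous_maps B k"
    and kh: "\<And>n z. z \<in> A \<Longrightarrow> k n (h n z) = z" and hk: "\<And>n z. z \<in> B \<Longrightarrow> k n z \<in> A \<Longrightarrow> h n (k n z) = z"
    and Ao: "openin mtopology A"
  obtains f l where "\<forall>z\<in>A. f z \<in> C" "\<forall>z\<in>A. l (f z) = z"
    "\<forall>z\<in>B. l z \<in> A \<longrightarrow> f (l z) = z"
    "\<forall>F \<epsilon> N. finite F \<longrightarrow> F \<subseteq> A \<longrightarrow> \<epsilon> > 0 \<longrightarrow> (\<exists>n\<ge>N. \<forall>z\<in>F. d (h n z) (f z) < \<epsilon>)"
    "\<forall>V. \<forall>x\<in>A. openin mtopology V \<longrightarrow> f x \<in> V \<longrightarrow> (\<exists>P. openin mtopology P \<and> x \<in> P \<and> (\<forall>z\<in>P \<inter> A. f z \<in> V))"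
    "\<forall>V. \<forall>x\<in>B. openin mtopology V \<longrightarrow> l x \<in> V \<longrightarrow> (\<exists>P. openin mtopology P \<and> x \<in> P \<and> (\<forall>z\<in>P \<inter> B. l z \<in> V))"
proof -
  let ?J = "Inl ` A \<union> Inr ` B"
  let ?u = "\<lambda>n. case_sum (h n) (k n)"
  have CM: "C \<subseteq> M" "D \<subseteq> M" using C compactin_subset_topspace by fastforce+
  have JC: "compactin mtopology (case_sum (\<lambda>_. C) (\<lambda>_. D) j)" if "j \<in> ?J" for j
    using that C by auto
  have Ju: "?u n j \<in> case_sum (\<lambda>_. C) (\<lambda>_. D) j" if "j \<in> ?J" for n j
    using that h k by auto
  obtain F where FC0: "\<forall>j\<in>?J. F j \<in> case_sum (\<lambda>_. C) (\<lambda>_. D) j"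
    and acc0: "\<forall>G \<epsilon> N. finite G \<longrightarrow> G \<subseteq> ?J \<longrightarrow> \<epsilon> > 0 \<longrightarrow> (\<exists>n\<ge>N. \<forall>j\<in>G. d (?u n j) (F j) < \<epsilon>)"
    using pointwise_accumulation[of ?J "case_sum (\<lambda>_. C) (\<lambda>_. D)" ?u, OF JC Ju] .
  note FC = FC0[rule_format] and acc = acc0[rule_format]
  define f where "f z = F (Inl z)" for z
  define l where "l z = F (Inr z)" for z
  have fC: "f z \<in> C" if "z \<in> A" for z using FC[of "Inl z"] that by (simp add: f_def)
  have lD: "l z \<in> D" if "z \<in> B" for z using FC[of "Inr z"] that by (simp add: l_def)
  have hM: "h n z \<in> M" "f z \<in> M" if "z \<in> A" for n z using h fC that CM by auto
  have kM: "k n z \<in> M" "l z \<in> M" if "z \<in> B" for n z using k lD that CM by auto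
  have acc2: "\<exists>n\<ge>N. (\<forall>z\<in>G. d (h n z) (f z) < \<epsilon>) \<and> (\<forall>z\<in>G'. d (k n z) (l z) < \<epsilon>)"
    if G: "finite G" "G \<subseteq> A" "finite G'" "G' \<subseteq> B" "\<epsilon> > 0" for G G' \<epsilon> N
  proof -
    have "\<exists>n\<ge>N. \<forall>j\<in>Inl ` G \<union> Inr ` G'. d (?u n j) (F j) < \<epsilon>"
      by (rule acc) (use G in auto)
    then show ?thesis unfolding f_def l_def by (auto simp: ball_Un)
  qed
  have zero: "x = y" if "x \<in> M" "y \<in> M" "\<And>\<epsilon>. \<epsilon> > 0 \<Longrightarrow> d x y < 2 * \<epsilon>" for x y
  proof (rule ccontr)
    assume "x \<noteq> y"
    then have "d x y > 0" using that by simp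
    then show False using that(3)[of "d x y / 2"] by simp
  qed
  have lf: "l (f z) = z" if z: "z \<in> A" for z
  proof (rule zero)
    have fB: "f z \<in> B" using fC[OF z] C by blast
    show "l (f z) \<in> M" "z \<in> M" using kM(2)[OF fB] z AM by auto
    fix \<epsilon> :: real assume \<epsilon>: "\<epsilon> > 0"
    obtain P where P: "openin mtopology P" "f z \<in> P" "\<forall>n. \<forall>w\<in>P \<inter> B. d (k n (f z)) (k n w) < \<epsilon>"
      by (rule equicontinuous_mapsD[OF equik \<epsilon> fB])
    obtain r where r: "r > 0" "mball (f z) r \<subseteq> P" using P(1,2) unfolding openin_mtopology by blast
    obtain n where n: "d (h n z) (f z) < min r \<epsilon>" "d (k n (f z)) (l (f z)) < min r \<epsilon>"
      using acc2[of "{z}" "{f z}" "min r \<epsilon>"] z fB r(1) \<epsilon> by auto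
    have "h n z \<in> mball (f z) r" using n(1) hM[OF z] commute[of "f z"] by auto
    then have "h n z \<in> P \<inter> B" using r(2) h[OF z] C(2) by blast
    then have "d (k n (f z)) z < \<epsilon>" using P(3) kh[OF z] by metis
    then show "d (l (f z)) z < 2 * \<epsilon>"
      using triangle''[of "l (f z)" "k n (f z)" z] n(2) kM[OF fB] z AM by auto
  qed
  have fl: "f (l z) = z" if z: "z \<in> B" and lz: "l z \<in> A" for z
  proof (rule zero)
    show "f (l z) \<in> M" "z \<in> M" using hM(2)[OF lz] z BM by auto
    fix \<epsilon> :: real assume \<epsilon>: "\<epsilon> > 0"
    obtain P where P: "openin mtopology P" "l z \<in> P" "\<forall>n. \<forall>w\<in>P \<inter> A. d (h n (l z)) (h n w) < \<epsilon>"
      by (rule equicontinuous_mapsD[OF equih \<epsilon> lz])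
    \<comment> \<open>\<open>A\<close> is open, so \<open>k n z\<close> lies in \<open>A\<close> as
      soon as it is close enough to \<open>l z\<close>, and \<open>hk\<close> applies.\<close>
    have "openin mtopology (P \<inter> A)" "l z \<in> P \<inter> A" using P Ao lz by auto
    then obtain r where r: "r > 0" "mball (l z) r \<subseteq> P \<inter> A" unfolding openin_mtopology by blast
    obtain n where n: "d (h n (l z)) (f (l z)) < min r \<epsilon>" "d (k n z) (l z) < min r \<epsilon>"
      using acc2[of "{l z}" "{z}" "min r \<epsilon>"] z lz r(1) \<epsilon> by auto
    have "k n z \<in> mball (l z) r" using n(2) kM[OF z] commute[of "l z"] by auto
    then have kP: "k n z \<in> P \<inter> A" using r(2) by blast
    then have "d (h n (l z)) z < \<epsilon>" using P(3) hk[OF z] by (metis IntD2)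
    then show "d (f (l z)) z < 2 * \<epsilon>"
      using triangle''[of "f (l z)" "h n (l z)" z] n(1) hM[OF lz] z BM by auto
  qed
  have facc: "\<exists>n\<ge>N. \<forall>z\<in>G. d (h n z) (f z) < \<epsilon>" if "finite G" "G \<subseteq> A" "\<epsilon> > 0" for G \<epsilon> N
    using acc2[of G "{}" \<epsilon> N] that by auto
  have lacc: "\<exists>n\<ge>N. \<forall>z\<in>G. d (k n z) (l z) < \<epsilon>" if "finite G" "G \<subseteq> B" "\<epsilon> > 0" for G \<epsilon> N
    using acc2[of "{}" G \<epsilon> N] that by auto
  show thesis
  proof (rule that[of f l])
    show "\<forall>z\<in>A. f z \<in> C" "\<forall>z\<in>A. l (f z) = z" "\<forall>z\<in>B. l z \<in> A \<longrightarrow> f (l z) = z"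
      using fC lf fl by auto
    show "\<forall>F \<epsilon> N. finite F \<longrightarrow> F \<subseteq> A \<longrightarrow> \<epsilon> > 0 \<longrightarrow> (\<exists>n\<ge>N. \<forall>z\<in>F. d (h n z) (f z) < \<epsilon>)"
      using facc by simp
    show "\<forall>V. \<forall>x\<in>A. openin mtopology V \<longrightarrow> f x \<in> V \<longrightarrow> (\<exists>P. openin mtopology P \<and> x \<in> P \<and> (\<forall>z\<in>P \<inter> A. f z \<in> V))"
      by (intro allI ballI impI equicontinuous_limit[OF equih hM]) (use facc in blast)+
    show "\<forall>V. \<forall>x\<in>B. openin mtopology V \<longrightarrow> l x \<in> V \<longrightarrow> (\<exists>P. openin mtopology P \<and> x \<in> P \<and> (\<forall>z\<in>P \<inter> B. l z \<in> V))"
      by (intro allI ballI impI equicontinuous_limit[OF equik kM]) (use lacc in blast)+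
  qed
qed

text \<open>Equicontinuity turns closeness at finitely many points of \<open>K\<close> into a
  statement on all of \<open>K\<close>, so the approximation given by
  \<open>pointwise_accumulation\<close> is enough for the compact-open topology.\<close>

lemma uniform_limit_on_compact:
  assumes K: "compactin mtopology K" "K \<subseteq> A" and V: "openin mtopology V" "\<And>z. z \<in> K \<Longrightarrow> f z \<in> V"
    and hM: "\<And>n z. z \<in> A \<Longrightarrow> h n z \<in> M"
    and equih: "equicontinuous_maps A h"
  obtains F \<epsilon> where "finite F" "F \<subseteq> A" "\<epsilon> > 0"
    "\<forall>n. (\<forall>j\<in>F. d (h n j) (f j) < \<epsilon>) \<longrightarrow> (\<forall>z\<in>K. h n z \<in> V)"
proof -
  have "\<exists>r P. r > 0 \<and> mball (f v) (2 * r) \<subseteq> V \<and> openin mtopology P \<and> v \<in> P \<and> (\<forall>n. \<forall>z\<in>P \<inter> A. d (h n v) (h n z) < r)"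
    if v: "v \<in> K" for v
  proof -
    obtain r where r: "r > 0" "mball (f v) r \<subseteq> V" using V v unfolding openin_mtopology by blast
    have r2: "r / 2 > 0" using r by simp
    have "v \<in> A" using v K(2) by blast
    from equicontinuous_mapsD[OF equih r2 this] obtain P where
      "openin mtopology P" "v \<in> P" "\<forall>n. \<forall>z\<in>P \<inter> A. d (h n v) (h n z) < r / 2" .
    then show ?thesis using r by (intro exI[of _ "r / 2"] exI[of _ P]) auto
  qed
  then have "\<forall>v\<in>K. \<exists>p. fst p > 0 \<and> mball (f v) (2 * fst p) \<subseteq> V \<and> openin mtopology (snd p) \<and> v \<in> snd p \<and>
     (\<forall>n. \<forall>z\<in>snd p \<inter> A. d (h n v) (h n z) < fst p)" by simp
  from bchoice[OF this] obtain p where p: "\<forall>v\<in>K. fst (p v) > 0 \<and> mball (f v) (2 * fst (p v)) \<subseteq> V \<and>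
     openin mtopology (snd (p v)) \<and> v \<in> snd (p v) \<and> (\<forall>n. \<forall>z\<in>snd (p v) \<inter> A. d (h n v) (h n z) < fst (p v))"
    by (elim exE)
  obtain F where F: "finite F" "F \<subseteq> K" "K \<subseteq> (\<Union>v\<in>F. snd (p v))"
    by (rule compactin_pointwise_subcover[OF K(1), of "\<lambda>v. snd (p v)"]) (use p in auto)
  obtain e where e: "e > 0" "\<And>v. v \<in> F \<Longrightarrow> e \<le> fst (p v)"
    by (rule finite_pos_lower_bound[OF F(1), of "\<lambda>v. fst (p v)"]) (use p F(2) in auto)
  show thesis
  proof (rule that[OF F(1) _ e(1)])
    show "F \<subseteq> A" using F K by blast
    show "\<forall>n. (\<forall>j\<in>F. d (h n j) (f j) < e) \<longrightarrow> (\<forall>z\<in>K. h n z \<in> V)"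
    proof (intro allI impI ballI)
    fix n z assume n: "\<forall>j\<in>F. d (h n j) (f j) < e" and z: "z \<in> K"
    then obtain v where v: "v \<in> F" "z \<in> snd (p v)" using F(3) by blast
    have vK: "v \<in> K" using v F by blast
    have M3: "f v \<in> M" "h n v \<in> M" "h n z \<in> M"
      using V vK z K(2) hM openin_subset[OF V(1)] by auto
    have "d (h n v) (f v) < fst (p v)" using n v(1) e(2)[OF v(1)] by fastforce
    moreover have "d (h n v) (h n z) < fst (p v)" using p vK v(2) z K(2) by blast
    ultimately have "h n z \<in> mball (f v) (2 * fst (p v))"
      using triangle''[of "f v" "h n v" "h n z"] M3 by auto
    then show "h n z \<in> V" using p vK by blast
    qed
  qed
qed

end

section \<open>The limit as an element of the closure\<close>

context equi_pg
begin

text \<open>All images lie in one ball of radius \<open>\<epsilon>0 / 2\<close>, so the proviso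
  \<open>d a b < \<epsilon>0\<close> in \<open>controlled\<close> always holds.\<close>

lemma equicontinuous_small_range:
  assumes eq: "\<forall>\<epsilon>>0. \<forall>x\<in>M. \<exists>P. openin T P \<and> x \<in> P \<and> controlled K \<epsilon>0 \<epsilon> P"
    and h: "\<And>n. h n \<in> S" "\<And>n. dom (h n) = A" "\<And>n. ran (h n) \<subseteq> K \<inter> mball c (\<epsilon>0 / 2)" and A: "A \<subseteq> M"
  shows "equicontinuous_maps A (\<lambda>n z. the (h n z))"
  unfolding equicontinuous_maps_def
proof (intro allI impI ballI)
  fix \<epsilon> x assume e: "\<epsilon> > (0::real)" and x: "x \<in> A"
  have "x \<in> M" using x A by blast
  from eq[rule_format, OF e this] obtain P where P: "openin T P" "x \<in> P" and
    c: "controlled K \<epsilon>0 \<epsilon> P"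
    by (elim exE conjE)
  have hv: "\<exists>w. h n z = Some w \<and> w \<in> K \<inter> mball c (\<epsilon>0 / 2)" if z: "z \<in> A" for n z
  proof -
    have "z \<in> dom (h n)" using z h(2)[of n] by simp
    then obtain w where "h n z = Some w" by blast
    then show ?thesis using h(3)[of n] ranI[of "h n" z w] by blast
  qed
  have "d (the (h n x)) (the (h n z)) < \<epsilon>" if z: "z \<in> P \<inter> A" for n z
  proof -
    obtain a where a: "h n x = Some a" "a \<in> K" "a \<in> mball c (\<epsilon>0 / 2)" using hv[OF x] by blast
    obtain b where b: "h n z = Some b" "b \<in> mball c (\<epsilon>0 / 2)" using hv[of z n] z by blast
    have "z \<in> P" "b \<in> M" using z b(2) by auto
    moreover have "d a b < \<epsilon>0" using triangle''[of a c b] a(3) b(2) by auto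
    ultimately have "d a b < \<epsilon>"
      using c[unfolded controlled_def, rule_format, OF h(1) P(2) _ a(1) b(1) a(2)] by blast
    then show ?thesis using a(1) b(1) by simp
  qed
  then show "\<exists>P. openin mtopology P \<and> x \<in> P \<and> (\<forall>n. \<forall>z\<in>P \<inter> A. d (the (h n x)) (the (h n z)) < \<epsilon>)"
    using P unfolding T_def by blast
qed

text \<open>Openness of images comes from \<open>l\<close>: near \<open>f x\<close> it takes values
  in \<open>V \<inter> A\<close>, and there \<open>f (l z) = z\<close>.\<close>

lemma limit_in_loct:
  assumes A: "openin T A" and B: "openin T B"
    and fB: "\<forall>z\<in>A. f z \<in> B" and lf: "\<forall>z\<in>A. l (f z) = z" and fl: "\<forall>z\<in>B. l z \<in> A \<longrightarrow> f (l z) = z"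
    and fcont: "\<forall>V. \<forall>x\<in>A. openin mtopology V \<longrightarrow> f x \<in> V \<longrightarrow> (\<exists>P. openin mtopology P \<and> x \<in> P \<and> (\<forall>z\<in>P \<inter> A. f z \<in> V))"
    and lcont: "\<forall>V. \<forall>x\<in>B. openin mtopology V \<longrightarrow> l x \<in> V \<longrightarrow> (\<exists>P. openin mtopology P \<and> x \<in> P \<and> (\<forall>z\<in>P \<inter> B. l z \<in> V))"
    and \<psi>: "\<And>z w. \<psi> z = Some w \<longleftrightarrow> z \<in> A \<and> w = f z"
  shows "\<psi> \<in> loct T"
  unfolding loct_iff
proof (intro conjI allI impI)
  show "dom \<psi> \<subseteq> topspace T" using openin_subset[OF A] by (auto simp: dom_def \<psi>)
  show "ran \<psi> \<subseteq> topspace T" using openin_subset[OF B] fB by (auto simp: ran_def \<psi>)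
  show "x = x'" if "\<psi> x = Some y" "\<psi> x' = Some y" for x x' y
    using that lf unfolding \<psi> by metis
  fix V assume V: "openin T V"
  show "openin T {x. \<exists>y\<in>V. \<psi> x = Some y}"
  proof (subst openin_subopen, intro ballI)
    fix x assume "x \<in> {x. \<exists>y\<in>V. \<psi> x = Some y}"
    then have x: "x \<in> A" "f x \<in> V" unfolding \<psi> by auto
    obtain P where P: "openin T P" "x \<in> P" "\<forall>z\<in>P \<inter> A. f z \<in> V"
      using fcont[rule_format, OF x(1) V[unfolded T_def] x(2)] unfolding T_def by blast
    show "\<exists>P. openin T P \<and> x \<in> P \<and> P \<subseteq> {x. \<exists>y\<in>V. \<psi> x = Some y}"
      by (rule exI[of _ "P \<inter> A"]) (use P A x in \<open>auto simp: \<psi>\<close>)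
  qed
  show "openin T {y. \<exists>x\<in>V. \<psi> x = Some y}"
  proof (subst openin_subopen, intro ballI)
    fix y assume "y \<in> {y. \<exists>x\<in>V. \<psi> x = Some y}"
    then obtain x where x: "x \<in> V" "x \<in> A" "y = f x" unfolding \<psi> by blast
    have y: "y \<in> B" "l y \<in> V \<inter> A" using fB x lf by auto
    have VA: "openin mtopology (V \<inter> A)" using V A unfolding T_def by blast
    obtain P where P: "openin T P" "y \<in> P" "\<forall>z\<in>P \<inter> B. l z \<in> V \<inter> A"
      using lcont[rule_format, OF y(1) VA y(2)] unfolding T_def by blast
    have "P \<inter> B \<subseteq> {y. \<exists>x\<in>V. \<psi> x = Some y}"
    proof
      fix z assume z: "z \<in> P \<inter> B"
      then have "l z \<in> V" "l z \<in> A" "z = f (l z)" using P(3) fl by auto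
      then show "z \<in> {y. \<exists>x\<in>V. \<psi> x = Some y}" unfolding \<psi> by blast
    qed
    then show "\<exists>P. openin T P \<and> y \<in> P \<and> P \<subseteq> {y. \<exists>x\<in>V. \<psi> x = Some y}"
      using P y B by (intro exI[of _ "P \<inter> B"]) auto
  qed
qed

lemma limit_maps_pairs:
  assumes eq: "equicontinuous_maps A h" and hM: "\<forall>n. \<forall>z\<in>A. h n z \<in> M"
    and \<psi>: "\<And>z w. \<psi> z = Some w \<longleftrightarrow> z \<in> A \<and> w = f z" and K: "co_pairs T \<K>" "maps_pairs \<K> \<psi>"
  shows "\<exists>F \<epsilon>. finite F \<and> F \<subseteq> A \<and> \<epsilon> > 0 \<and>
    (\<forall>n. (\<forall>j\<in>F. d (h n j) (f j) < \<epsilon>) \<longrightarrow> maps_pairs \<K> (\<lambda>z. if z \<in> A then Some (h n z) else None))"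
proof -
  have "finite \<K>" using K(1) by (simp add: co_pairs_def)
  then show ?thesis using K
  proof (induction \<K>)
    case empty
    show ?case by (intro exI[of _ "{}"] exI[of _ 1]) simp
  next
    case (insert q \<K>)
    obtain L V where q: "q = (L, V)" by (cases q)
    have L: "compactin mtopology L" "openin mtopology V"
      and K: "co_pairs T \<K>" "maps_pairs \<K> \<psi>" and "\<forall>z\<in>L. \<exists>y\<in>V. \<psi> z = Some y"
      using insert.prems unfolding co_pairs_def maps_pairs_def q T_def by auto
    then have Lf: "L \<subseteq> A" "\<And>z. z \<in> L \<Longrightarrow> f z \<in> V" unfolding \<psi> by auto
    obtain F \<epsilon> where F: "finite F" "F \<subseteq> A" "\<epsilon> > 0"
      "\<forall>n. (\<forall>j\<in>F. d (h n j) (f j) < \<epsilon>) \<longrightarrow> (\<forall>z\<in>L. h n z \<in> V)"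
      using uniform_limit_on_compact[OF L(1) Lf(1) L(2) Lf(2) hM[rule_format] eq] .
    obtain F' \<epsilon>' where F': "finite F'" "F' \<subseteq> A" "\<epsilon>' > 0" "\<forall>n. (\<forall>j\<in>F'. d (h n j) (f j) < \<epsilon>') \<longrightarrow>
        maps_pairs \<K> (\<lambda>z. if z \<in> A then Some (h n z) else None)"
      using insert.IH[OF K] by (elim exE conjE)
    show ?case
    proof (intro exI[of _ "F \<union> F'"] exI[of _ "min \<epsilon> \<epsilon>'"] conjI allI impI)
      fix n assume n: "\<forall>j\<in>F \<union> F'. d (h n j) (f j) < min \<epsilon> \<epsilon>'"
      then have "maps_pairs \<K> (\<lambda>z. if z \<in> A then Some (h n z) else None)" "\<forall>z\<in>L. h n z \<in> V"
        using F(4) F'(4) by simp_all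
      then show "maps_pairs (insert q \<K>) (\<lambda>z. if z \<in> A then Some (h n z) else None)"
        using Lf(1) unfolding maps_pairs_def q by auto
    qed (use F F' in auto)
  qed
qed

text \<open>The composites have identity germs at \<open>x\<close> and at \<open>y\<close>, so
  quasi-analyticity makes them the identity wherever they are defined. \<open>k\<close> is defined
  on all images of \<open>h\<close>, but \<open>h\<close> only on those images of \<open>k\<close>
  that lie in \<open>A\<close>.\<close>

lemma inverse_pair:
  assumes qa: "quasi_analytic T S" and g: "g \<in> H" "g x = Some y"
    and h: "h \<in> S" "dom h = A" "ran h \<subseteq> B" "agree T h g x"
    and k: "k \<in> S" "dom k = B" "agree T k (linv g) y"
  shows "\<forall>z w. h z = Some w \<longrightarrow> k w = Some z" "\<forall>z w. k z = Some w \<longrightarrow> w \<in> A \<longrightarrow> h w = Some z"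
proof -
  have gl: "g \<in> loct T" using H_loct g by blast
  have hy: "h x = Some y" using agree_eq[OF h(4)] g by simp
  have ky: "k y = Some x" using agree_eq[OF k(3)] linv_eq_Some[OF gl] g(2) by simp
  have hl: "h \<in> loct T" and kl: "k \<in> loct T" using h k S_loct by auto
  have kh: "agree T (k \<circ>\<^sub>m h) (lid T) x"
    by (rule agree_trans[OF agree_comp[OF hl hy h(4) k(3)] linv_comp_agree[OF gl g(2)]])
  have hk: "agree T (h \<circ>\<^sub>m k) (lid T) y"
    by (rule agree_trans[OF agree_comp[OF kl ky k(3) h(4)] comp_linv_agree[OF gl g(2)]])
  have khS: "k \<circ>\<^sub>m h \<in> S" "h \<circ>\<^sub>m k \<in> S" using psg_comp[OF psgS] h k by auto
  show "\<forall>z w. h z = Some w \<longrightarrow> k w = Some z"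
  proof (intro allI impI)
    fix z w assume hz: "h z = Some w"
    have "w \<in> dom k" using ranI[of h, OF hz] h(3) k(2) by blast
    then have "z \<in> dom (k \<circ>\<^sub>m h)" using hz by (auto simp: dom_def)
    from quasi_analyticD[OF qa khS(1) kh this] show "k w = Some z" using hz by simp
  qed
  show "\<forall>z w. k z = Some w \<longrightarrow> w \<in> A \<longrightarrow> h w = Some z"
  proof (intro allI impI)
    fix z w assume kz: "k z = Some w" and "w \<in> A"
    then have "z \<in> dom (h \<circ>\<^sub>m k)" using h(2) by (auto simp: dom_def)
    from quasi_analyticD[OF qa khS(2) hk this] show "h w = Some z" using kz by simp
  qed
qed

text \<open>The maps \<open>h n\<close> with \<open>h n t0\<close> tending to \<open>t1\<close> are taken to the limit together with their inverses
  \<open>k n\<close>, so that the limit is a homeomorphism onto an open set.\<close>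

lemma transitive_closure_star:
  assumes qa: "quasi_analytic T S" and t0: "t0 \<in> M" and t1: "t1 \<in> T closure_of orbit H t0"
  obtains f where "f \<in> closure_star T S" "f t0 = Some t1"
proof -
  have t1M: "t1 \<in> M" using t1 by (simp add: in_closure_of)
  have MM: "openin T M" using openin_topspace[of T] by simp
  obtain Ka Qa where a: "compactin T Ka" "openin T Qa" "t0 \<in> Qa" "Qa \<subseteq> Ka" "Ka \<subseteq> M"
    by (rule compact_neighbourhood[OF MM t0])
  obtain Kb Qb where b: "compactin T Kb" "openin T Qb" "t1 \<in> Qb" "Qb \<subseteq> Kb" "Kb \<subseteq> M"
    by (rule compact_neighbourhood[OF MM t1M])
  have Kab: "compactin T (Ka \<union> Kb)" using a b compactin_Un by blast
  obtain \<epsilon>0 where \<epsilon>0: "\<epsilon>0 > 0"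
    and eq: "\<forall>\<epsilon>>0. \<forall>x\<in>M. \<exists>P. openin T P \<and> x \<in> P \<and> controlled (Ka \<union> Kb) \<epsilon>0 \<epsilon> P"
    by (rule equicontinuous_compact[OF Kab])
  \<comment> \<open>Radius \<open>\<epsilon>0 / 2\<close> is what
    \<open>equicontinuous_small_range\<close> needs; the compact sets \<open>Ka\<close> and
    \<open>Kb\<close> keep the values in the range of the control.\<close>
  let ?W0 = "Qa \<inter> mball t0 (\<epsilon>0 / 2)" and ?W1 = "Qb \<inter> mball t1 (\<epsilon>0 / 2)"
  have "openin T ?W0" by (intro openin_Int a) simp
  then have W0: "openin T ?W0" "t0 \<in> ?W0" using a t0 \<epsilon>0 by auto
  obtain B P1 where B: "openin T B" "t1 \<in> B" "openin T P1" "t0 \<in> P1"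
    and ext1: "\<forall>g\<in>H. \<forall>x'\<in>B. \<forall>y'\<in>P1. g x' = Some y' \<longrightarrow> (\<exists>h\<in>S. dom h = B \<and> ran h \<subseteq> ?W0 \<and> agree T h g x')"
    by (rule uniform_extension[OF t1M t0 W0])
  have BW: "openin T (B \<inter> ?W1)" by (intro openin_Int B b) simp
  have tBW: "t1 \<in> B \<inter> ?W1" using B b t1M \<epsilon>0 by auto
  \<comment> \<open>The domain \<open>B\<close> of the inverses is fixed first; then the maps
    \<open>h n\<close> are confined to a compact \<open>K1 \<subseteq> B\<close>, so that limits of
    their values remain in \<open>B\<close>, where \<open>l\<close> is defined.\<close>
  obtain K1 W1 where K1: "compactin T K1" "openin T W1" "t1 \<in> W1" "W1 \<subseteq> K1" "K1 \<subseteq> B \<inter> ?W1"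
    by (rule compact_neighbourhood[OF BW tBW])
  obtain A R where A: "openin T A" "t0 \<in> A" "openin T R" "t1 \<in> R"
    and ext2: "\<forall>g\<in>H. \<forall>x'\<in>A. \<forall>y'\<in>R. g x' = Some y' \<longrightarrow> (\<exists>h\<in>S. dom h = A \<and> ran h \<subseteq> W1 \<and> agree T h g x')"
    by (rule uniform_extension[OF t0 t1M K1(2,3)])
  define good where "good n h k \<longleftrightarrow> h \<in> S \<and> k \<in> S \<and> dom h = A \<and> ran h \<subseteq> W1 \<and> dom k = B \<and> ran k \<subseteq> ?W0 \<and>
      d t1 (the (h t0)) < inverse (real (Suc n))" for n h k
  have "\<exists>h k. good n h k \<and> (\<forall>z w. h z = Some w \<longrightarrow> k w = Some z) \<and>
      (\<forall>z w. k z = Some w \<longrightarrow> w \<in> A \<longrightarrow> h w = Some z)" for n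
  proof -
    \<comment> \<open>A point of the orbit of \<open>t0\<close> is taken so close to
      \<open>t1\<close> that \<open>R\<close> allows the extension of \<open>g\<close> to
      \<open>A\<close>, and \<open>B\<close> that of its inverse to \<open>B\<close>.\<close>
    let ?N = "R \<inter> B \<inter> mball t1 (inverse (real (Suc n)))"
    have "openin T ?N" by (intro openin_Int B A) simp
    moreover have "t1 \<in> ?N" using B(2) A(4) t1M by simp
    ultimately have "\<exists>y. y \<in> orbit H t0 \<and> y \<in> ?N"
      using t1[unfolded in_closure_of, THEN conjunct2, THEN spec[of _ ?N]] by simp
    then obtain y g where "y \<in> ?N" and g: "g \<in> H" "g t0 = Some y" unfolding orbit_def by blast
    then have y: "y \<in> R" "y \<in> B" "y \<in> mball t1 (inverse (real (Suc n)))" by auto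
    obtain h where h: "h \<in> S" "dom h = A" "ran h \<subseteq> W1" "agree T h g t0"
      using ext2[rule_format, OF g(1) A(2) y(1) g(2)] by blast
    have lg: "linv g \<in> H" "linv g y = Some t0"
      using psg_linv[OF pseudogroup_psg[OF pgH] g(1)] linv_eq_Some[OF H_loct[OF g(1)]] g(2) by auto
    obtain k where k: "k \<in> S" "dom k = B" "ran k \<subseteq> ?W0" "agree T k (linv g) y"
      using ext1[rule_format, OF lg(1) y(2) B(4) lg(2)] by blast
    have "ran h \<subseteq> B" using h(3) K1(4,5) by blast
    note inverse_pair[OF qa g h(1,2) this h(4) k(1,2,4)]
    moreover have "good n h k"
      unfolding good_def using h(1-3) k(1-3) agree_eq[OF h(4)] g(2) y(3) by simp
    ultimately show ?thesis by blast
  qed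
  then obtain h k where p: "\<And>n. good n (h n) (k n)"
    and kh: "\<And>n. \<forall>z w. h n z = Some w \<longrightarrow> k n w = Some z"
    and hk: "\<And>n. \<forall>z w. k n z = Some w \<longrightarrow> w \<in> A \<longrightarrow> h n w = Some z" by metis
  have hS: "h n \<in> S" and kS: "k n \<in> S" and hd: "dom (h n) = A" and hr: "ran (h n) \<subseteq> W1"
    and kd: "dom (k n) = B" and kr: "ran (k n) \<subseteq> ?W0"
    and h0: "d t1 (the (h n t0)) < inverse (real (Suc n))" for n
    using p[of n] unfolding good_def by auto
  let ?h = "\<lambda>n z. the (h n z)" and ?k = "\<lambda>n z. the (k n z)"
  have hv: "h n z = Some (?h n z)" "?h n z \<in> W1" if z: "z \<in> A" for n z
  proof -
    show "h n z = Some (?h n z)" using z hd[of n] by auto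
    from ranI[of "h n", OF this] show "?h n z \<in> W1" using hr[of n] by blast
  qed
  have kv: "k n z = Some (?k n z)" "?k n z \<in> ?W0" if z: "z \<in> B" for n z
  proof -
    show "k n z = Some (?k n z)" using z kd[of n] by auto
    from ranI[of "k n", OF this] show "?k n z \<in> ?W0" using kr[of n] by blast
  qed
  have AM: "A \<subseteq> M" and BM: "B \<subseteq> M" using openin_subset[OF A(1)] openin_subset[OF B(1)] by auto
  have hr': "ran (h n) \<subseteq> (Ka \<union> Kb) \<inter> mball t1 (\<epsilon>0 / 2)" for n using hr[of n] K1(4,5) b(4) by blast
  have kr': "ran (k n) \<subseteq> (Ka \<union> Kb) \<inter> mball t0 (\<epsilon>0 / 2)" for n using kr[of n] a(4) by blast
  have equih: "equicontinuous_maps A ?h"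
    by (rule equicontinuous_small_range[OF eq hS hd hr' AM])
  have equik: "equicontinuous_maps B ?k"
    by (rule equicontinuous_small_range[OF eq kS kd kr' BM])
  have hK: "?h n z \<in> K1" if "z \<in> A" for n z using hv(2)[OF that] K1 by blast
  have kK: "?k n z \<in> Ka" if "z \<in> B" for n z using kv(2)[OF that] a by blast
  have kh': "?k n (?h n z) = z" if "z \<in> A" for n z using kh[rule_format, OF hv(1)[OF that]] by simp
  have hk': "?h n (?k n z) = z" if "z \<in> B" "?k n z \<in> A" for n z
    using hk[rule_format, OF kv(1)[OF that(1)] that(2)] by simp
  have K1B: "K1 \<subseteq> B" using K1 by blast
  have hM: "?h n z \<in> M" if "z \<in> A" for n z using hK[OF that] K1B BM by blast
  have hMb: "\<forall>n. \<forall>z\<in>A. ?h n z \<in> M" using hM by blast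
  obtain f l where fK: "\<forall>z\<in>A. f z \<in> K1" and lf: "\<forall>z\<in>A. l (f z) = z" and fl: "\<forall>z\<in>B. l z \<in> A \<longrightarrow> f (l z) = z"
    and acc0: "\<forall>F \<epsilon> N. finite F \<longrightarrow> F \<subseteq> A \<longrightarrow> \<epsilon> > 0 \<longrightarrow> (\<exists>n\<ge>N. \<forall>z\<in>F. d (?h n z) (f z) < \<epsilon>)"
    and fcont: "\<forall>V. \<forall>x\<in>A. openin mtopology V \<longrightarrow> f x \<in> V \<longrightarrow> (\<exists>P. openin mtopology P \<and> x \<in> P \<and> (\<forall>z\<in>P \<inter> A. f z \<in> V))"
    and lcont: "\<forall>V. \<forall>x\<in>B. openin mtopology V \<longrightarrow> l x \<in> V \<longrightarrow> (\<exists>P. openin mtopology P \<and> x \<in> P \<and> (\<forall>z\<in>P \<inter> B. l z \<in> V))"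
    using limit_of_inverse_pairs[OF AM BM K1(1)[unfolded T_def] K1B a(1)[unfolded T_def] hK kK equih equik kh' hk' A(1)[unfolded T_def]] .
  note acc = acc0[rule_format]
  have fB: "\<forall>z\<in>A. f z \<in> B" using fK K1B by blast
  define \<psi> where "\<psi> z = (if z \<in> A then Some (f z) else None)" for z
  have \<psi>: "\<psi> z = Some w \<longleftrightarrow> z \<in> A \<and> w = f z" for z w by (auto simp: \<psi>_def)
  have "\<psi> \<in> closure_star T S"
    unfolding in_closure_star[OF S_subset_loct]
  proof (intro conjI allI impI)
    show "\<psi> \<in> loct T" by (rule limit_in_loct[OF A(1) B(1) fB lf fl fcont lcont \<psi>])
    fix \<K> assume K: "co_pairs T \<K>" "maps_pairs \<K> \<psi>"
    obtain F \<epsilon> where F: "finite F" "F \<subseteq> A" "\<epsilon> > 0" "\<forall>n. (\<forall>j\<in>F. d (?h n j) (f j) < \<epsilon>) \<longrightarrow>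
        maps_pairs \<K> (\<lambda>z. if z \<in> A then Some (?h n z) else None)"
      using limit_maps_pairs[OF equih hMb \<psi> K] by (elim exE conjE)
    obtain n where n: "\<forall>z\<in>F. d (?h n z) (f z) < \<epsilon>" using acc[OF F(1-3)] by blast
    have "(\<lambda>z. if z \<in> A then Some (?h n z) else None) = h n" using hv(1) hd[of n] by (auto simp: fun_eq_iff)
    then have "maps_pairs \<K> (h n)" using F(4) n by metis
    moreover have "dom (h n) = dom \<psi>" using hd[of n] by (auto simp: dom_def \<psi>)
    ultimately show "\<exists>g\<in>S. dom g = dom \<psi> \<and> maps_pairs \<K> g" using hS by blast
  qed
  \<comment> \<open>\<open>f t0\<close> is only an accumulation value, but \<open>h n t0\<close>
    converges to \<open>t1\<close> and \<open>n\<close> can be taken arbitrarily large.\<close>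
  moreover have "t1 = f t0"
  proof (rule ccontr)
    assume "t1 \<noteq> f t0"
    moreover have fM: "f t0 \<in> M" using fB BM A(2) by blast
    ultimately have pos: "d t1 (f t0) / 2 > 0" using t1M by simp
    obtain N where N: "inverse (real (Suc N)) < d t1 (f t0) / 2" using reals_Archimedean[OF pos] by blast
    obtain n where n: "n \<ge> N" "d (?h n t0) (f t0) < d t1 (f t0) / 2"
      using acc[of "{t0}" "d t1 (f t0) / 2" N] pos A(2) by auto
    have "inverse (real (Suc n)) \<le> inverse (real (Suc N))" using n(1) by simp
    then show False
      using triangle[of t1 "?h n t0" "f t0"] n(2) N t1M fM hM[OF A(2), of n] h0[of n] by linarith
  qed
  ultimately show thesis using that \<psi> A(2) by blast
qed

end

section \<open>Composition of germs\<close>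

text \<open>The point that needs an argument is that the domains of elements of \<open>S\<close>
  cover \<open>T\<close>, which gives the identity germs. Over \<open>V\<close> this comes from the
  elements of \<open>closure_star T S\<close> with prescribed domain, whose approximants in
  \<open>S\<close> have the same domain; other points are reached along their orbits.\<close>

lemma admissible_choiceD:
  assumes adm: "admissible_choice T H t V \<C> S"
  shows admissible_psg: "pseudo_star_group T S"
    and admissible_restriction_closed: "restriction_closed T S"
    and admissible_subset: "S \<subseteq> H"
    and admissible_pseudogroup: "pseudogroup T H"
    and admissible_quasi_analytic: "quasi_analytic T S"
    and admissible_compactly_generated: "compactly_generated_with T H V"
    and admissible_equicontinuous: "equicontinuous_with T H \<C> S"
    and admissible_germ: "\<And>g x y. g \<in> H \<Longrightarrow> g x = Some y \<Longrightarrow> \<exists>s\<in>S. agree T s g x"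
    and admissible_closure_psg: "pseudo_star_group T (closure_star T S)"
    and admissible_closure_subset: "closure_star T S \<subseteq> closure_pseudogroup T S"
    and admissible_closure_germ: "\<And>g x y. g \<in> closure_pseudogroup T S \<Longrightarrow> g x = Some y \<Longrightarrow>
           \<exists>s\<in>closure_star T S. agree T s g x"
proof -
  note D = adm[unfolded admissible_choice_def]
  have "local_pseudo_star_group T S" using D by (elim conjE)
  then show psg: "pseudo_star_group T S" and "restriction_closed T S"
    unfolding local_pseudo_star_group_def by auto
  have sqa: "strongly_quasi_analytic_with T H S" using D by (elim conjE)
  then show SH: "S \<subseteq> H" and "quasi_analytic T S"
    unfolding strongly_quasi_analytic_with_def generating_sub_pseudo_star_group_def quasi_analytic_def
    by auto
  have genS: "generated_pseudogroup T S = H"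
    using sqa unfolding strongly_quasi_analytic_with_def generating_sub_pseudo_star_group_def by auto
  show cg: "compactly_generated_with T H V" using D by (elim conjE)
  show "equicontinuous_with T H \<C> S" using D by (elim conjE)
  let ?A = "closure_star T S" and ?P = "closure_pseudogroup T S"
  have "strongly_quasi_analytic_with T ?P ?A" using D by (elim conjE)
  then have g: "generating_sub_pseudo_star_group T ?P ?A"
    unfolding strongly_quasi_analytic_with_def by (elim conjE)
  then show psgA: "pseudo_star_group T ?A" and AP: "?A \<subseteq> ?P"
    unfolding generating_sub_pseudo_star_group_def by auto
  have genA: "generated_pseudogroup T ?A = ?P"
    using g unfolding generating_sub_pseudo_star_group_def by auto
  \<comment> \<open>\<open>closure_pseudogroup T S\<close> consists of local transformations by
    definition, so what \<open>closure_star T S\<close> generates is a true pseudogroup. It contains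
    \<open>S\<close>, hence \<open>H\<close>, which therefore consists of local transformations
    too.\<close>
  have pgP: "pseudogroup T ?P"
    using pseudogroup_generated[of T ?A] closure_pseudogroup_loct[of T S] unfolding genA by blast
  have Sl: "S \<subseteq> loct T" using psg_loct[OF psg] by blast
  have SA: "S \<subseteq> ?A" by (rule closure_star_superset[OF Sl])
  have "H \<subseteq> ?P"
    using generated_pseudogroup_minimal[OF pgP, of S] SA AP unfolding genS by blast
  then have Hl: "H \<subseteq> loct T" using closure_pseudogroup_loct by blast
  then show pgH: "pseudogroup T H" using pseudogroup_generated[of T S] unfolding genS by blast
  define D0 where "D0 = (\<Union>s\<in>S. dom s)"
  have linvD: "y \<in> D0" if "g \<in> S" "g x = Some y" for g x y
  proof -
    have "linv g \<in> S" "linv g y = Some x"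
      using psg_linv[OF psg that(1)] linv_eq_Some[OF psg_loct[OF psg that(1)]] that(2) by auto
    then show ?thesis unfolding D0_def by blast
  qed
  have VD: "y \<in> D0" if y: "y \<in> V" for y
  proof -
    have "\<exists>\<D>\<subseteq>\<C>. finite \<D> \<and> T closure_of V \<subseteq> (\<Union>m\<in>\<D>. mspace m) \<and>
        (\<forall>m\<in>\<D>. co_topology T (cmaps T (mspace m)) closure_of
             {h \<in> S. dom h = mspace m \<and> ran h \<inter> T closure_of V \<noteq> {}} \<subseteq> closure_star T S \<and>
           (\<forall>h\<in>closure_pseudogroup T S. \<forall>x\<in>mspace m \<inter> V. \<forall>y\<in>V. h x = Some y \<longrightarrow>
              (\<exists>h'\<in>closure_star T S. dom h' = mspace m \<and> germ T h' x = germ T h x)))"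
      using D by (elim conjE)
    then obtain \<D> where D': "T closure_of V \<subseteq> (\<Union>m\<in>\<D>. mspace m)"
      "\<forall>m\<in>\<D>. \<forall>h\<in>?P. \<forall>x\<in>mspace m \<inter> V. \<forall>y\<in>V. h x = Some y \<longrightarrow>
              (\<exists>h'\<in>?A. dom h' = mspace m \<and> germ T h' x = germ T h x)"
      by auto
    have Vo: "openin T V" using cg unfolding compactly_generated_with_def by auto
    have yT: "y \<in> topspace T" using openin_subset[OF Vo] y by blast
    have "y \<in> T closure_of V" using closure_of_subset[OF openin_subset[OF Vo]] y by blast
    then obtain m where m: "m \<in> \<D>" "y \<in> mspace m" using D'(1) by blast
    have ly: "lid T y = Some y" using yT by (simp add: lid_def)
    have my: "y \<in> mspace m \<inter> V" using m(2) y by simp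
    obtain h' where h': "h' \<in> ?A" "dom h' = mspace m"
      using D'(2)[rule_format, OF m(1) pseudogroup_lid[OF pgP] my y ly] by blast
    \<comment> \<open>The empty family of conditions leaves only the equality of domains.\<close>
    have "\<exists>f\<in>S. dom f = dom h'"
      using h'(1)[unfolded in_closure_star[OF Sl], THEN conjunct2, THEN spec[of _ "{}"]] by simp
    then show ?thesis using h'(2) m(2) unfolding D0_def by blast
  qed
  have cov: "\<exists>s\<in>S. x \<in> dom s" if x: "x \<in> topspace T" for x
  proof -
    obtain g y where gy: "g \<in> generated_pseudogroup T S" "g x = Some y" "y \<in> V"
      using cg x unfolding compactly_generated_with_def orbit_def genS by blast
    \<comment> \<open>Membership in \<open>D0\<close> passes from the target of a germ to its source
      along a word.\<close>
    have "\<forall>y. g x = Some y \<longrightarrow> y \<in> D0 \<longrightarrow> x \<in> D0"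
      using gy(1,2)
    proof (induction rule: generated_pseudogroup_germ_induct)
      case loct show ?case by (rule Sl)
    next
      case (agree k k' x y) then show ?case using agree_eq by metis
    next
      case (lid x) then show ?case by (simp add: lid_def)
    next
      case (gen g x y) then show ?case unfolding D0_def by blast
    next
      case (inv g x y) then show ?case using linvD by blast
    next
      case (comp k k' x y w) then show ?case by simp
    qed
    then have "x \<in> D0" using gy(2,3) VD by blast
    then show ?thesis unfolding D0_def by blast
  qed
  show "\<exists>s\<in>S. agree T s g x" if "g \<in> H" "g x = Some y" for g x y
    by (rule generated_by_psg_germ[OF psg cov]) (use that genS in auto)
  show "\<exists>s\<in>?A. agree T s g x" if "g \<in> ?P" "g x = Some y" for g x y
  proof (rule generated_by_psg_germ[OF psgA])
    show "\<exists>s\<in>?A. x \<in> dom s" if "x \<in> topspace T" for x using cov[OF that] SA by blast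
  qed (use that genA in auto)
qed

section \<open>Topology of the transversal\<close>

lemma metrizable_space_sum_open_subsets:
  assumes Z: "metrizable_space Z" and A: "\<And>i. i \<in> I \<Longrightarrow> openin Z (A i)"
  shows "metrizable_space (sum_topology (\<lambda>i. subtopology Z (A i)) I)"
proof -
  \<comment> \<open>The sum is a subspace of the product with a discrete space, and such products
    and their subspaces are metrizable.\<close>
  let ?P = "subtopology (prod_topology (discrete_topology I) Z) (Sigma I A)"
  have AZ: "A i \<subseteq> topspace Z" if "i \<in> I" for i using openin_subset[OF A[OF that]] .
  have "openin (sum_topology (\<lambda>i. subtopology Z (A i)) I) W \<longleftrightarrow> openin ?P W" for W
  proof
    assume W: "openin (sum_topology (\<lambda>i. subtopology Z (A i)) I) W"
    have sl: "openin Z {x. (i, x) \<in> W}" if "i \<in> I" for i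
      using W that openin_open_subtopology[OF A[OF that]] unfolding openin_sum_topology by blast
    have sub: "W \<subseteq> Sigma I A" using openin_subset[OF W] by auto
    have "openin (prod_topology (discrete_topology I) Z) W"
      unfolding openin_prod_topology_alt
    proof (intro allI impI)
      fix i x assume "(i, x) \<in> W"
      then show "\<exists>N V. openin (discrete_topology I) N \<and> openin Z V \<and> i \<in> N \<and> x \<in> V \<and> N \<times> V \<subseteq> W"
        using sub sl[of i] by (intro exI[of _ "{i}"] exI[of _ "{x. (i, x) \<in> W}"]) auto
    qed
    then show "openin ?P W" using sub by (metis openin_subtopology inf.absorb1)
  next
    assume "openin ?P W"
    then obtain N where N: "openin (prod_topology (discrete_topology I) Z) N" "W = N \<inter> Sigma I A"
      unfolding openin_subtopology by blast
    have "openin (subtopology Z (A i)) {x. (i, x) \<in> W}" if i: "i \<in> I" for i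
    proof -
      have "continuous_map Z (prod_topology (discrete_topology I) Z) (\<lambda>x. (i, x))"
        using i by (simp add: continuous_map_pairedI)
      then have "openin Z {x \<in> topspace Z. (i, x) \<in> N}" using N(1) by (rule openin_continuous_map_preimage)
      moreover have "{x. (i, x) \<in> W} = {x \<in> topspace Z. (i, x) \<in> N} \<inter> A i" using N(2) AZ[OF i] i by auto
      ultimately show ?thesis by (simp add: openin_subtopology_Int)
    qed
    moreover have "W \<subseteq> Sigma I (topspace \<circ> (\<lambda>i. subtopology Z (A i)))" using N(2) AZ by fastforce
    ultimately show "openin (sum_topology (\<lambda>i. subtopology Z (A i)) I) W"
      unfolding openin_sum_topology by blast
  qed
  then have "sum_topology (\<lambda>i. subtopology Z (A i)) I = ?P" by (simp add: topology_eq)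
  moreover have "metrizable_space ?P"
    using Z by (intro metrizable_space_subtopology) (simp add: metrizable_space_prod_topology)
  ultimately show ?thesis by simp
qed

lemma openin_foliated_chart_transversal:
  assumes "foliated_chart X n Z (U, \<phi>)" shows "openin Z ((snd \<circ> \<phi>) ` U)"
proof -
  obtain c r A where c: "openin X U" "c \<in> topspace (Euclidean_space n)" "0 < r" "openin Z A"
    "homeomorphic_map (subtopology X U)
          (prod_topology (subtopology (Euclidean_space n) (euclidean_ball n c r)) (subtopology Z A)) \<phi>"
    using assms unfolding foliated_chart_def by auto
  have "\<phi> ` topspace (subtopology X U) = topspace (prod_topology (subtopology (Euclidean_space n) (euclidean_ball n c r)) (subtopology Z A))"
    using homeomorphic_imp_surjective_map[OF c(5)] .
  moreover have "topspace (subtopology X U) = U" using openin_subset[OF c(1)] by auto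
  moreover have "topspace (subtopology Z A) = A" using openin_subset[OF c(4)] by auto
  moreover have "topspace (subtopology (Euclidean_space n) (euclidean_ball n c r)) = euclidean_ball n c r"
    unfolding euclidean_ball_def by auto
  ultimately have im: "\<phi> ` U = euclidean_ball n c r \<times> A" by simp
  \<comment> \<open>The ball contains its centre, so projecting the product to \<open>Z\<close>
    gives all of \<open>A\<close>.\<close>
  have "c \<in> euclidean_ball n c r" using c(2,3) unfolding euclidean_ball_def by simp
  then have "snd ` \<phi> ` U = A" unfolding im by force
  then show ?thesis using c(4) by (simp add: image_comp)
qed

lemma transversal_metrizable_locally_compact:
  assumes Z: "lc_polish_space Z" and F: "foliated_structure X n Z F" and reg: "regular_foliated_atlas X F I U \<phi>"
  shows "metrizable_space (transversal Z I U \<phi>)" "locally_compact_space (transversal Z I U \<phi>)"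
proof -
  have A: "openin Z ((snd \<circ> \<phi> i) ` U i)" if "i \<in> I" for i
  proof -
    have "(U i, \<phi> i) \<in> F" using reg that unfolding regular_foliated_atlas_def by (elim conjE) blast
    then have "foliated_chart X n Z (U i, \<phi> i)"
      using F unfolding foliated_structure_def foliated_atlas_def by (elim conjE) blast
    then show ?thesis by (rule openin_foliated_chart_transversal)
  qed
  have mZ: "metrizable_space Z" and lZ: "locally_compact_space Z"
    using Z completely_metrizable_imp_metrizable_space unfolding lc_polish_space_def by auto
  show "metrizable_space (transversal Z I U \<phi>)"
    unfolding transversal_def by (rule metrizable_space_sum_open_subsets[OF mZ A])
  show "locally_compact_space (transversal Z I U \<phi>)"
    unfolding transversal_def locally_compact_space_sum_topology
    using locally_compact_space_open_subset[OF _ lZ A] metrizable_imp_Hausdorff_space[OF mZ] by blast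
qed

section \<open>Composition on the left with an element of the closure\<close>

definition germ_push :: "'t topology \<Rightarrow> ('t \<rightharpoonup> 't) \<Rightarrow> (('t \<rightharpoonup> 't) \<times> 't) set \<Rightarrow> (('t \<rightharpoonup> 't) \<times> 't) set" where
  "germ_push T f \<gamma> = (case (SOME p. p \<in> \<gamma>) of (g, x) \<Rightarrow> germ T (f \<circ>\<^sub>m g) x)"

lemma some_in_germ:
  assumes "g \<in> loct T" "g x = Some y"
  obtains g' where "(SOME p. p \<in> germ T g x) = (g', x)" "g' \<in> loct T" "agree T g' g x"
proof -
  have "(SOME p. p \<in> germ T g x) \<in> germ T g x"
    by (rule someI[of "\<lambda>p. p \<in> germ T g x", OF self_in_germ[OF assms]])
  then show thesis using that by (cases "SOME p. p \<in> germ T g x") (auto simp: in_germ)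
qed

lemma germ_push_germ:
  assumes "g \<in> loct T" "g x = Some y"
  shows "germ_push T f (germ T g x) = germ T (f \<circ>\<^sub>m g) x"
proof -
  obtain g' where g': "(SOME p. p \<in> germ T g x) = (g', x)" "agree T g' g x"
    using some_in_germ[OF assms] by metis
  show ?thesis unfolding germ_push_def g'(1)
    using germ_eq_agree[OF agree_comp_left[OF g'(2)]] by simp
qed

lemma germ_lift_germ:
  assumes "g \<in> loct T" "g x = Some y" "h \<in> loct T" "h x = Some z"
  shows "germ_lift T h (germ T g x) = germ T (g \<circ>\<^sub>m linv h) z"
proof -
  obtain g' where g': "(SOME p. p \<in> germ T g x) = (g', x)" "agree T g' g x"
    using some_in_germ[OF assms(1,2)] by metis
  have "linv h z = Some x" using linv_eq_Some[OF assms(3)] assms(4) by simp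
  then have "agree T (g' \<circ>\<^sub>m linv h) (g \<circ>\<^sub>m linv h) z"
    using agree_comp_right[OF linv_in_loct[OF assms(3)] _ g'(2)] by blast
  then show ?thesis unfolding germ_lift_def g'(1) using germ_eq_agree assms(4) by simp
qed

lemma germ_source_germ:
  assumes "g \<in> loct T" "g x = Some y"
  shows "germ_source (germ T g x) = x"
  unfolding germ_source_def
proof (rule the_equality)
  show "\<exists>f. (f, x) \<in> germ T g x" using self_in_germ[OF assms] by blast
qed (auto simp: in_germ)

locale closure_psg =
  fixes T :: "'t topology" and S :: "('t \<rightharpoonup> 't) set"
  assumes Sl: "S \<subseteq> loct T" and psgA: "pseudo_star_group T (closure_star T S)"
    and nbhd: "\<And>N x. openin T N \<Longrightarrow> x \<in> N \<Longrightarrow> \<exists>K Q. compactin T K \<and> openin T Q \<and> x \<in> Q \<and> Q \<subseteq> K \<and> K \<subseteq> N"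
begin

text \<open>That \<open>f \<circ>\<^sub>m k\<close> maps \<open>K\<close> into \<open>V\<close>
  means that \<open>k\<close> maps \<open>K\<close> into the preimage of \<open>V\<close> under
  \<open>f\<close>, which is again open. The additional pair \<open>(L, dom f)\<close> makes
  \<open>f \<circ>\<^sub>m k\<close> defined near \<open>x\<close> for all \<open>k\<close> close to
  \<open>g\<close>.\<close>

lemma openin_germ_push_preimage:
  assumes f: "f \<in> closure_star T S" and W: "openin (germ_space T S) W"
  shows "openin (germ_space T S)
    {germ T g x | g x. g \<in> closure_star T S \<and> x \<in> dom (f \<circ>\<^sub>m g) \<and> germ T (f \<circ>\<^sub>m g) x \<in> W}" (is "openin _ ?W")
  unfolding openin_germ_space[OF Sl]
proof (intro conjI ballI impI)
  let ?A = "closure_star T S"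
  have fl: "f \<in> loct T" using closure_star_loct[OF f] .
  show "?W \<subseteq> topspace (germ_space T S)"
  proof
    fix \<gamma> assume "\<gamma> \<in> ?W"
    then obtain g x where g: "\<gamma> = germ T g x" "g \<in> ?A" "x \<in> dom (f \<circ>\<^sub>m g)" by blast
    from g(3) obtain y where "g x = Some y" by (auto simp: map_comp_Some_iff dom_def)
    then show "\<gamma> \<in> topspace (germ_space T S)"
      unfolding topspace_germ_space based_germs_def using g(1,2) by blast
  qed
  fix g x assume g: "g \<in> ?A" and x: "x \<in> dom g" and "germ T g x \<in> ?W"
  \<comment> \<open>Membership is witnessed by some \<open>g0\<close>, which need not be
    \<open>g\<close>; agreement near \<open>x\<close> transfers it to \<open>g\<close>.\<close>
  then obtain g0 x0 where g0: "germ T g x = germ T g0 x0" "x0 \<in> dom (f \<circ>\<^sub>m g0)" "germ T (f \<circ>\<^sub>m g0) x0 \<in> W" by blast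
  have gl: "g \<in> loct T" using closure_star_loct[OF g] .
  obtain y where y: "g x = Some y" using x by blast
  have ag: "x0 = x" "agree T g g0 x" using germ_eqD[OF g0(1) gl y] by auto
  have agf: "agree T (f \<circ>\<^sub>m g) (f \<circ>\<^sub>m g0) x" by (rule agree_comp_left[OF ag(2)])
  have fgx: "x \<in> dom (f \<circ>\<^sub>m g)" using agree_dom[OF agf] g0(2) ag(1) by simp
  have fgW: "germ T (f \<circ>\<^sub>m g) x \<in> W" using germ_eq_agree[OF agf] g0(3) ag(1) by simp
  have fgA: "f \<circ>\<^sub>m g \<in> ?A" using psg_comp[OF psgA g f] .
  have "germs_near T S (f \<circ>\<^sub>m g) x W"
    using W[unfolded openin_germ_space[OF Sl], THEN conjunct2, THEN bspec, THEN bspec, THEN mp, OF fgA fgx fgW] .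
  then obtain \<K> U where K: "co_pairs T \<K>" "maps_pairs \<K> (f \<circ>\<^sub>m g)" "openin T U" "x \<in> U"
          "\<forall>g\<in>?A. maps_pairs \<K> g \<longrightarrow> (\<forall>z\<in>U \<inter> dom g. germ T g z \<in> W)"
    unfolding germs_near_def by (elim exE conjE)
  have No: "openin T {z. \<exists>w\<in>dom f. g z = Some w}" by (rule loct_preimage[OF gl loct_dom[OF fl]])
  obtain c where c: "(f \<circ>\<^sub>m g) x = Some c" using fgx by blast
  have Nx: "x \<in> {z. \<exists>w\<in>dom f. g z = Some w}" using c unfolding map_comp_Some_iff by blast
  obtain L Q where L: "compactin T L" "openin T Q" "x \<in> Q" "Q \<subseteq> L" "L \<subseteq> {z. \<exists>w\<in>dom f. g z = Some w}"
    using nbhd[OF No Nx] by blast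
  let ?p = "\<lambda>(K, V). (K, {z. \<exists>w\<in>V. f z = Some w})"
  let ?K = "?p ` \<K> \<union> {(L, dom f)}"
  have comp_pairs: "maps_pairs (?p ` \<K>) k \<longleftrightarrow> maps_pairs \<K> (f \<circ>\<^sub>m k)" for k
  proof -
    have "(\<exists>y\<in>{z. \<exists>w\<in>V. f z = Some w}. k x = Some y) \<longleftrightarrow> (\<exists>w\<in>V. (f \<circ>\<^sub>m k) x = Some w)" for x V
      by (auto simp: map_comp_Some_iff)
    then show ?thesis unfolding maps_pairs_def by (simp add: split_beta)
  qed
  have "co_pairs T ?K"
    unfolding co_pairs_Un co_pairs_single
  proof (intro conjI L(1) loct_dom[OF fl])
    show "co_pairs T (?p ` \<K>)"
      using K(1) loct_preimage[OF fl] unfolding co_pairs_def by (auto simp: split_beta)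
  qed
  moreover have "maps_pairs ?K g"
    unfolding maps_pairs_Un comp_pairs maps_pairs_single using K(2) L(5) by blast
  moreover have "openin T (U \<inter> Q)" "x \<in> U \<inter> Q" using K L by auto
  moreover have "\<forall>k\<in>?A. maps_pairs ?K k \<longrightarrow> (\<forall>z\<in>(U \<inter> Q) \<inter> dom k. germ T k z \<in> ?W)"
  proof (intro ballI impI)
    fix k z assume k: "k \<in> ?A" and mk: "maps_pairs ?K k" and z: "z \<in> (U \<inter> Q) \<inter> dom k"
    have mk': "maps_pairs \<K> (f \<circ>\<^sub>m k)" "\<forall>x\<in>L. \<exists>y\<in>dom f. k x = Some y"
      using mk unfolding maps_pairs_Un comp_pairs maps_pairs_single by auto
    have "z \<in> L" using z L(4) by blast
    then have zd: "z \<in> dom (f \<circ>\<^sub>m k)" using mk'(2) by (force simp: dom_def map_comp_Some_iff)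
    have "germ T (f \<circ>\<^sub>m k) z \<in> W" using K(5) psg_comp[OF psgA k f] mk'(1) zd z by blast
    then show "germ T k z \<in> ?W" using k zd by blast
  qed
  ultimately show "germs_near T S g x ?W" unfolding germs_near_def by (intro exI conjI)
qed

lemma topspace_based_germs: "topspace (subtopology (germ_space T S) (based_germs T S t)) = based_germs T S t"
  unfolding topspace_subtopology topspace_germ_space by blast

lemma continuous_germ_push:
  assumes f: "f \<in> closure_star T S" "f t = Some t'"
  shows "continuous_map (subtopology (germ_space T S) (based_germs T S t))
           (subtopology (germ_space T S) (based_germs T S t')) (germ_push T f)"
proof -
  let ?A = "closure_star T S"
  have push: "germ_push T f (germ T g x) = germ T (f \<circ>\<^sub>m g) x" if "g \<in> ?A" "g x = Some y" for g x y
    using germ_push_germ[OF closure_star_loct[OF that(1)] that(2)] .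
  have maps: "germ_push T f \<gamma> \<in> based_germs T S t'" if "\<gamma> \<in> based_germs T S t" for \<gamma>
  proof -
    obtain g x where g: "\<gamma> = germ T g x" "g \<in> ?A" "g x = Some t" using \<open>\<gamma> \<in> based_germs T S t\<close> unfolding based_germs_def by blast
    have "f \<circ>\<^sub>m g \<in> ?A" "(f \<circ>\<^sub>m g) x = Some t'" using psg_comp[OF psgA g(2) f(1)] g(3) f(2) by auto
    then show ?thesis unfolding based_germs_def g(1) push[OF g(2,3)] by blast
  qed
  show ?thesis
    unfolding continuous_map_def topspace_based_germs
  proof (intro conjI allI impI)
    show "germ_push T f \<in> based_germs T S t \<rightarrow> based_germs T S t'" using maps by blast
    fix N assume "openin (subtopology (germ_space T S) (based_germs T S t')) N"
    then obtain W where W: "openin (germ_space T S) W" "N = W \<inter> based_germs T S t'"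
      unfolding openin_subtopology by blast
    let ?W = "{germ T g x | g x. g \<in> ?A \<and> x \<in> dom (f \<circ>\<^sub>m g) \<and> germ T (f \<circ>\<^sub>m g) x \<in> W}"
    have "{\<gamma> \<in> based_germs T S t. germ_push T f \<gamma> \<in> N} = ?W \<inter> based_germs T S t"
    proof (intro equalityI subsetI)
      fix \<gamma> assume \<gamma>: "\<gamma> \<in> {\<gamma> \<in> based_germs T S t. germ_push T f \<gamma> \<in> N}"
      then obtain g x where g: "\<gamma> = germ T g x" "g \<in> ?A" "g x = Some t" unfolding based_germs_def by blast
      have "germ T (f \<circ>\<^sub>m g) x \<in> W" using \<gamma> W(2) push[OF g(2,3)] g(1) by simp
      moreover have "x \<in> dom (f \<circ>\<^sub>m g)" using g(3) f(2) by (simp add: dom_def)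
      ultimately show "\<gamma> \<in> ?W \<inter> based_germs T S t" using g \<gamma> by blast
    next
      fix \<gamma> assume \<gamma>: "\<gamma> \<in> ?W \<inter> based_germs T S t"
      then obtain g x where g: "\<gamma> = germ T g x" "g \<in> ?A" "x \<in> dom (f \<circ>\<^sub>m g)" "germ T (f \<circ>\<^sub>m g) x \<in> W" by blast
      obtain y where "g x = Some y" using g(3) by (auto simp: map_comp_Some_iff dom_def)
      then have "germ_push T f \<gamma> \<in> W" using push[OF g(2)] g by simp
      then show "\<gamma> \<in> {\<gamma> \<in> based_germs T S t. germ_push T f \<gamma> \<in> N}" using \<gamma> maps W(2) by blast
    qed
    moreover have "openin (germ_space T S) ?W" by (rule openin_germ_push_preimage[OF f(1) W(1)])
    ultimately show "openin (subtopology (germ_space T S) (based_germs T S t)) {\<gamma> \<in> based_germs T S t. germ_push T f \<gamma> \<in> N}"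
      by (simp add: openin_subtopology_Int)
  qed
qed

lemma germ_push_linv:
  assumes f: "f \<in> closure_star T S" "f t = Some t'" and \<gamma>: "\<gamma> \<in> based_germs T S t"
  shows "germ_push T (linv f) (germ_push T f \<gamma>) = \<gamma>"
proof -
  let ?A = "closure_star T S"
  have fl: "f \<in> loct T" using closure_star_loct[OF f(1)] .
  obtain g x where g: "\<gamma> = germ T g x" "g \<in> ?A" "g x = Some t" using \<gamma> unfolding based_germs_def by blast
  have gl: "g \<in> loct T" using closure_star_loct[OF g(2)] .
  have fg: "(f \<circ>\<^sub>m g) x = Some t'" using g f by simp
  have "agree T (linv f \<circ>\<^sub>m (f \<circ>\<^sub>m g)) g x"
    unfolding map_comp_assoc3
    by (rule agree_trans[OF agree_comp_right[OF gl g(3) linv_comp_agree[OF fl f(2)]] lid_comp_agree[OF gl g(3)]])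
  then show ?thesis
    unfolding g(1) germ_push_germ[OF gl g(3)] germ_push_germ[OF map_comp_in_loct[OF gl fl] fg]
    by (rule germ_eq_agree)
qed

lemma homeomorphic_germ_push:
  assumes f: "f \<in> closure_star T S" "f t = Some t'"
  shows "homeomorphic_maps (subtopology (germ_space T S) (based_germs T S t))
           (subtopology (germ_space T S) (based_germs T S t')) (germ_push T f) (germ_push T (linv f))"
proof -
  have fl: "f \<in> loct T" using closure_star_loct[OF f(1)] .
  have lf: "linv f \<in> closure_star T S" "linv f t' = Some t"
    using psg_linv[OF psgA f(1)] linv_eq_Some[OF fl] f(2) by auto
  show ?thesis
    unfolding homeomorphic_maps_def topspace_based_germs
    using continuous_germ_push[OF f] continuous_germ_push[OF lf] germ_push_linv[OF f] germ_push_linv[OF lf]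
    unfolding linv_linv[OF fl] by blast
qed

lemma germ_push_source:
  assumes f: "f \<in> closure_star T S" "f t = Some t'" and \<gamma>: "\<gamma> \<in> based_germs T S t"
  shows "germ_source (germ_push T f \<gamma>) = germ_source \<gamma>"
proof -
  obtain g x where g: "\<gamma> = germ T g x" "g \<in> closure_star T S" "g x = Some t" using \<gamma> unfolding based_germs_def by blast
  have gl: "g \<in> loct T" using closure_star_loct[OF g(2)] .
  have fl: "f \<in> loct T" using closure_star_loct[OF f(1)] .
  have "(f \<circ>\<^sub>m g) x = Some t'" using g f by simp
  from germ_source_germ[OF map_comp_in_loct[OF gl fl] this] show ?thesis
    unfolding g(1) germ_push_germ[OF gl g(3)] germ_source_germ[OF gl g(3)] .
qed

text \<open>\<open>germ_push\<close> composes on the left and \<open>germ_lift\<close> on the right,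
  so they commute by associativity.\<close>

lemma germ_push_lift:
  assumes f: "f \<in> closure_star T S" "f t = Some t'" and \<gamma>: "\<gamma> \<in> based_germs T S t"
    and h: "h \<in> loct T" "germ_source \<gamma> \<in> dom h"
  shows "germ_push T f (germ_lift T h \<gamma>) = germ_lift T h (germ_push T f \<gamma>)"
proof -
  obtain g x where g: "\<gamma> = germ T g x" "g \<in> closure_star T S" "g x = Some t" using \<gamma> unfolding based_germs_def by blast
  have gl: "g \<in> loct T" using closure_star_loct[OF g(2)] .
  have fl: "f \<in> loct T" using closure_star_loct[OF f(1)] .
  have fg: "(f \<circ>\<^sub>m g) x = Some t'" using g f by simp
  obtain z where z: "h x = Some z" using h(2) germ_source_germ[OF gl g(3)] g(1) by auto
  have lz: "(g \<circ>\<^sub>m linv h) z = Some t" using z linv_eq_Some[OF h(1)] g(3) by simp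
  show ?thesis
    unfolding g(1) germ_push_germ[OF gl g(3)] germ_lift_germ[OF gl g(3) h(1) z]
      germ_lift_germ[OF map_comp_in_loct[OF gl fl] fg h(1) z]
      germ_push_germ[OF map_comp_in_loct[OF linv_in_loct[OF h(1)] gl] lz] map_comp_assoc3 ..
qed

text \<open>Applied to the cocycle maps with two equal indices; it makes the triple of a given index
  in a class unique.\<close>

lemma germ_lift_identity:
  assumes \<gamma>: "\<gamma> \<in> based_germs T S t" and h: "h \<in> loct T" "germ_source \<gamma> \<in> dom h"
    and id: "\<And>x. x \<in> dom h \<Longrightarrow> h x = Some x"
  shows "germ_lift T h \<gamma> = \<gamma>"
proof -
  obtain g x where g: "\<gamma> = germ T g x" "g \<in> closure_star T S" "g x = Some t" using \<gamma> unfolding based_germs_def by blast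
  have gl: "g \<in> loct T" using closure_star_loct[OF g(2)] .
  have x: "x \<in> dom h" using h(2) germ_source_germ[OF gl g(3)] g(1) by simp
  have "linv h z = Some z" if "z \<in> dom h" for z using id[OF that] linv_eq_Some[OF h(1)] by simp
  then have "agree T (g \<circ>\<^sub>m linv h) g x"
    unfolding agree_def using loct_dom[OF h(1)] x by (intro exI[of _ "dom h"]) (simp add: map_comp_def)
  then show ?thesis unfolding g(1) germ_lift_germ[OF gl g(3) h(1) id[OF x]] by (rule germ_eq_agree)
qed

end

section \<open>The induced foliated homeomorphism\<close>

lemma plaques_push:
  assumes W: "W' = \<theta> ` W" and sn: "\<And>\<xi>. \<xi> \<in> W \<Longrightarrow> snd (\<psi>' (\<theta> \<xi>)) = \<Theta> (snd (\<psi> \<xi>))"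
    and inj: "inj_on \<Theta> ((snd \<circ> \<psi>) ` W)"
  shows "plaques (W', \<psi>') = image \<theta> ` plaques (W, \<psi>)"
proof -
  have eq: "{\<eta> \<in> W'. snd (\<psi>' \<eta>) = \<Theta> y} = \<theta> ` {\<xi> \<in> W. snd (\<psi> \<xi>) = y}" if y: "y \<in> (snd \<circ> \<psi>) ` W" for y
  proof (intro equalityI subsetI)
    fix \<eta> assume "\<eta> \<in> {\<eta> \<in> W'. snd (\<psi>' \<eta>) = \<Theta> y}"
    then obtain \<xi> where \<xi>: "\<xi> \<in> W" "\<eta> = \<theta> \<xi>" "snd (\<psi>' (\<theta> \<xi>)) = \<Theta> y" unfolding W by blast
    have "\<Theta> (snd (\<psi> \<xi>)) = \<Theta> y" using sn[OF \<xi>(1)] \<xi>(3) by simp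
    then have "snd (\<psi> \<xi>) = y" by (rule inj_onD[OF inj]) (use y \<xi>(1) in auto)
    then show "\<eta> \<in> \<theta> ` {\<xi> \<in> W. snd (\<psi> \<xi>) = y}" using \<xi> by blast
  qed (use sn W in auto)
  have im: "(snd \<circ> \<psi>') ` W' = \<Theta> ` (snd \<circ> \<psi>) ` W"
    using sn unfolding W by (force simp: image_iff)
  have "plaques (W', \<psi>') = (\<lambda>y. {\<eta> \<in> W'. snd (\<psi>' \<eta>) = y}) ` (snd \<circ> \<psi>') ` W'"
    unfolding plaques_def by auto
  also have "\<dots> = (\<lambda>y. {\<eta> \<in> W'. snd (\<psi>' \<eta>) = \<Theta> y}) ` (snd \<circ> \<psi>) ` W"
    unfolding im by (simp add: image_image)
  also have "\<dots> = (\<lambda>y. \<theta> ` {\<xi> \<in> W. snd (\<psi> \<xi>) = y}) ` (snd \<circ> \<psi>) ` W"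
    by (rule image_cong) (use eq in auto)
  also have "\<dots> = image \<theta> ` plaques (W, \<psi>)"
    unfolding plaques_def by auto
  finally show ?thesis .
qed

lemma plaques_subset: "P \<in> plaques (W, \<psi>) \<Longrightarrow> P \<subseteq> W"
  unfolding plaques_def by auto

lemma homeomorphic_map_open_in_subset:
  assumes hm: "homeomorphic_map X Y f" and P: "P \<subseteq> topspace X" and Q: "openin (subtopology X P) Q"
  shows "openin (subtopology Y (f ` P)) (f ` Q)"
proof -
  obtain N where N: "openin X N" "Q = N \<inter> P" using Q unfolding openin_subtopology by blast
  have inj: "inj_on f (topspace X)" by (rule homeomorphic_imp_injective_map[OF hm])
  have "f ` Q = f ` N \<inter> f ` P"
    unfolding N(2) by (rule inj_on_image_Int[OF inj openin_subset[OF N(1)] P])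
  moreover have "openin Y (f ` N)"
    using homeomorphic_imp_open_map[OF hm] N(1) unfolding open_map_def by blast
  ultimately show ?thesis by (simp add: openin_subtopology_Int)
qed

text \<open>Compatibility is a condition on plaques alone, so the chart maps of \<open>c'\<close>
  and \<open>a'\<close> need not be related to those of \<open>c\<close> and \<open>a\<close> beyond
  their plaques.\<close>

lemma compatible_charts_push:
  assumes hm: "homeomorphic_map X Y f" and W: "fst c \<subseteq> topspace X" "fst a \<subseteq> topspace X"
    and c: "plaques c' = image f ` plaques c" and a: "plaques a' = image f ` plaques a"
    and compat: "compatible_charts X c a"
  shows "compatible_charts Y c' a'"
  unfolding compatible_charts_def c a
proof (intro ballI, elim imageE)
  fix P P' Q Q' assume P: "P = f ` Q" "Q \<in> plaques c" and P': "P' = f ` Q'" "Q' \<in> plaques a"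
  have sub: "Q \<subseteq> topspace X" "Q' \<subseteq> topspace X"
    using plaques_subset[of Q "fst c" "snd c"] plaques_subset[of Q' "fst a" "snd a"] P P' W by auto
  have inj: "inj_on f (topspace X)" by (rule homeomorphic_imp_injective_map[OF hm])
  have PP: "P \<inter> P' = f ` (Q \<inter> Q')"
    unfolding P P' using inj_on_image_Int[OF inj sub] by simp
  have "openin (subtopology X Q) (Q \<inter> Q')" "openin (subtopology X Q') (Q \<inter> Q')"
    using compat[unfolded compatible_charts_def, rule_format, OF P(2) P'(2)] by auto
  then show "openin (subtopology Y P) (P \<inter> P') \<and> openin (subtopology Y P') (P \<inter> P')"
    unfolding PP unfolding P(1) P'(1)
    using homeomorphic_map_open_in_subset[OF hm sub(1)] homeomorphic_map_open_in_subset[OF hm sub(2)]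
    by simp
qed

section \<open>The map induced on classes of triples\<close>

definition triple_map :: "('c \<Rightarrow> 'd) \<Rightarrow> 'a \<times> 'b \<times> 'c \<Rightarrow> 'a \<times> 'b \<times> 'd" where
  "triple_map \<Theta> = (\<lambda>(i, x, \<gamma>). (i, x, \<Theta> \<gamma>))"

locale germ_homeomorphism =
  fixes X :: "'x topology" and Z :: "'z topology" and I :: "'i set"
    and U :: "'i \<Rightarrow> 'x set" and \<phi> :: "'i \<Rightarrow> 'x \<Rightarrow> (nat \<Rightarrow> real) \<times> 'z" and h :: "'i \<Rightarrow> 'i \<Rightarrow> 'z \<Rightarrow> 'z"
    and E E' :: "('i, 'z) trgerm topology" and \<Theta> \<Theta>' :: "('i, 'z) trgerm \<Rightarrow> ('i, 'z) trgerm"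
  assumes U_sub: "\<And>i. i \<in> I \<Longrightarrow> U i \<subseteq> topspace X"
    and hm: "homeomorphic_maps E E' \<Theta> \<Theta>'"
    and src: "\<And>\<gamma>. \<gamma> \<in> topspace E \<Longrightarrow> germ_source (\<Theta> \<gamma>) = germ_source \<gamma>"
    and lift: "\<And>i j \<gamma>. i \<in> I \<Longrightarrow> j \<in> I \<Longrightarrow> \<gamma> \<in> topspace E \<Longrightarrow> germ_source \<gamma> \<in> dom (cocycle_map U \<phi> h i j) \<Longrightarrow>
       \<Theta> (germ_lift (transversal Z I U \<phi>) (cocycle_map U \<phi> h i j) \<gamma>) =
       germ_lift (transversal Z I U \<phi>) (cocycle_map U \<phi> h i j) (\<Theta> \<gamma>)"
    and lift': "\<And>i j \<gamma>. i \<in> I \<Longrightarrow> j \<in> I \<Longrightarrow> \<gamma> \<in> topspace E' \<Longrightarrow> germ_source \<gamma> \<in> dom (cocycle_map U \<phi> h i j) \<Longrightarrow>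
       \<Theta>' (germ_lift (transversal Z I U \<phi>) (cocycle_map U \<phi> h i j) \<gamma>) =
       germ_lift (transversal Z I U \<phi>) (cocycle_map U \<phi> h i j) (\<Theta>' \<gamma>)"
    and lift_refl: "\<And>i \<gamma>. i \<in> I \<Longrightarrow> \<gamma> \<in> topspace E \<Longrightarrow> germ_source \<gamma> \<in> dom (cocycle_map U \<phi> h i i) \<Longrightarrow>
       germ_lift (transversal Z I U \<phi>) (cocycle_map U \<phi> h i i) \<gamma> = \<gamma>"
    and lift_refl': "\<And>i \<gamma>. i \<in> I \<Longrightarrow> \<gamma> \<in> topspace E' \<Longrightarrow> germ_source \<gamma> \<in> dom (cocycle_map U \<phi> h i i) \<Longrightarrow>
       germ_lift (transversal Z I U \<phi>) (cocycle_map U \<phi> h i i) \<gamma> = \<gamma>"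
begin

lemma \<Theta>_in: "\<gamma> \<in> topspace E \<Longrightarrow> \<Theta> \<gamma> \<in> topspace E'"
  and \<Theta>'_in: "\<gamma> \<in> topspace E' \<Longrightarrow> \<Theta>' \<gamma> \<in> topspace E"
  and \<Theta>'\<Theta>: "\<gamma> \<in> topspace E \<Longrightarrow> \<Theta>' (\<Theta> \<gamma>) = \<gamma>"
  and \<Theta>\<Theta>': "\<gamma> \<in> topspace E' \<Longrightarrow> \<Theta> (\<Theta>' \<gamma>) = \<gamma>"
  using hm unfolding homeomorphic_maps_def continuous_map_def by auto

lemma src': "\<gamma> \<in> topspace E' \<Longrightarrow> germ_source (\<Theta>' \<gamma>) = germ_source \<gamma>"
  using src[OF \<Theta>'_in] \<Theta>\<Theta>' by simp

text \<open>The hypotheses are symmetric in the two spaces of germs, so every statement about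
  \<open>\<Theta>\<close> also holds for \<open>\<Theta>'\<close>, and the inverse needs no separate
  proof.\<close>

lemma swap: "germ_homeomorphism X Z I U \<phi> h E' E \<Theta>' \<Theta>"
proof (unfold_locales)
  show "homeomorphic_maps E' E \<Theta>' \<Theta>" using hm homeomorphic_maps_sym by blast
qed (fact U_sub src' lift lift' lift_refl lift_refl')+

abbreviation "tilde \<equiv> tilde_space X I U \<phi>"
abbreviation "cls \<equiv> hat_class X Z I U \<phi> h"
abbreviation "hat \<equiv> hat_space X Z I U \<phi> h"

lemma in_tilde:
  "(i, x, \<gamma>) \<in> topspace (tilde D) \<longleftrightarrow> i \<in> I \<and> x \<in> U i \<and> \<gamma> \<in> topspace D \<and> germ_source \<gamma> = (i, snd (\<phi> i x))"
  using U_sub by (auto simp: tilde_space_def check_space_def)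

lemma triple_map_in: "p \<in> topspace (tilde E) \<Longrightarrow> triple_map \<Theta> p \<in> topspace (tilde E')"
  by (cases p) (auto simp: triple_map_def in_tilde src \<Theta>_in)

lemma triple_map_in': "p \<in> topspace (tilde E') \<Longrightarrow> triple_map \<Theta>' p \<in> topspace (tilde E)"
  by (cases p) (auto simp: triple_map_def in_tilde src' \<Theta>'_in)

lemma triple_map_inverse: "p \<in> topspace (tilde E) \<Longrightarrow> triple_map \<Theta>' (triple_map \<Theta> p) = p"
  by (cases p) (auto simp: triple_map_def in_tilde \<Theta>'\<Theta>)

lemma triple_map_inverse': "p \<in> topspace (tilde E') \<Longrightarrow> triple_map \<Theta> (triple_map \<Theta>' p) = p"
  by (cases p) (auto simp: triple_map_def in_tilde \<Theta>\<Theta>')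

lemma in_tilde_rel:
  "((i, x, \<gamma>), (j, y, \<delta>)) \<in> tilde_rel X Z I U \<phi> h D \<longleftrightarrow>
     (i, x, \<gamma>) \<in> topspace (tilde D) \<and> (j, y, \<delta>) \<in> topspace (tilde D) \<and>
        x = y \<and> \<gamma> = germ_lift (transversal Z I U \<phi>) (cocycle_map U \<phi> h j i) \<delta>"
  unfolding tilde_rel_def by auto

lemma source_in_cocycle_dom:
  assumes "(i, x, \<gamma>) \<in> topspace (tilde D)" "x \<in> U j"
  shows "germ_source \<gamma> \<in> dom (cocycle_map U \<phi> h i j)"
  using assms by (auto simp: in_tilde cocycle_map_def dom_def)

lemma triple_map_rel:
  assumes "(p, q) \<in> tilde_rel X Z I U \<phi> h E"
  shows "(triple_map \<Theta> p, triple_map \<Theta> q) \<in> tilde_rel X Z I U \<phi> h E'"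
proof -
  obtain i x \<gamma> where p: "p = (i, x, \<gamma>)" by (cases p) auto
  obtain j y \<delta> where q: "q = (j, y, \<delta>)" by (cases q) auto
  note R = assms[unfolded p q in_tilde_rel]
  have src: "germ_source \<delta> \<in> dom (cocycle_map U \<phi> h j i)"
    by (rule source_in_cocycle_dom[of j y \<delta> E]) (use R in \<open>auto simp: in_tilde\<close>)
  have "\<Theta> \<gamma> = germ_lift (transversal Z I U \<phi>) (cocycle_map U \<phi> h j i) (\<Theta> \<delta>)"
    using lift[OF _ _ _ src] R by (auto simp: in_tilde)
  moreover have "triple_map \<Theta> p \<in> topspace (tilde E')" "triple_map \<Theta> q \<in> topspace (tilde E')"
    using R triple_map_in p q by blast+
  ultimately show ?thesis
    using R unfolding p q triple_map_def prod.case in_tilde_rel by blast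
qed

text \<open>\<open>\<Theta>\<close> preserves sources, so on the summand of index \<open>i\<close>
  the map is the product of an identity with a restriction of \<open>\<Theta>\<close>.\<close>

lemma continuous_triple_map: "continuous_map (tilde E) (tilde E') (triple_map \<Theta>)"
proof -
  let ?A = "\<lambda>D i. {\<gamma> \<in> topspace D. germ_source \<gamma> \<in> {i} \<times> (snd \<circ> \<phi> i) ` U i}"
  let ?P = "\<lambda>D i. prod_topology (subtopology X (U i)) (subtopology D (?A D i))"
  have cE: "continuous_map E E' \<Theta>" using hm unfolding homeomorphic_maps_def by blast
  have cP: "continuous_map (?P E i) (?P E' i) (\<lambda>(x, \<gamma>). (x, \<Theta> \<gamma>))" for i
  proof -
    have "continuous_map (subtopology E (?A E i)) (subtopology E' (?A E' i)) \<Theta>"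
      by (rule continuous_map_into_subtopology[OF continuous_map_from_subtopology[OF cE]])
        (use src \<Theta>_in in auto)
    then show ?thesis unfolding continuous_map_prod_top by simp
  qed
  have ts: "topspace (check_space X I U \<phi> D) = Sigma I (\<lambda>i. topspace (?P D i))" for D
    unfolding check_space_def topspace_sum_topology by (simp add: comp_def)
  have into: "triple_map \<Theta> p \<in> topspace (check_space X I U \<phi> E')" if p: "p \<in> topspace (check_space X I U \<phi> E)" for p
  proof -
    obtain i x \<gamma> where pe: "p = (i, x, \<gamma>)" by (cases p) auto
    have "i \<in> I" "(x, \<gamma>) \<in> topspace (?P E i)" using p unfolding ts pe by auto
    moreover have "(x, \<Theta> \<gamma>) \<in> topspace (?P E' i)"
      using continuous_map_image_subset_topspace[OF cP[of i]] calculation(2) by force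
    ultimately show ?thesis unfolding ts pe triple_map_def by simp
  qed
  have "continuous_map (check_space X I U \<phi> E) (check_space X I U \<phi> E') (triple_map \<Theta>)"
    unfolding continuous_map_def
  proof (intro conjI allI impI)
    show "triple_map \<Theta> \<in> topspace (check_space X I U \<phi> E) \<rightarrow> topspace (check_space X I U \<phi> E')"
      using into by blast
    fix W assume W: "openin (check_space X I U \<phi> E') W"
    let ?W = "{p \<in> topspace (check_space X I U \<phi> E). triple_map \<Theta> p \<in> W}"
    have "openin (?P E i) {q. (i, q) \<in> ?W}" if i: "i \<in> I" for i
    proof -
      have "openin (?P E' i) {q. (i, q) \<in> W}"
        using W i unfolding check_space_def openin_sum_topology by blast
      then have "openin (?P E i) {q \<in> topspace (?P E i). (\<lambda>(x, \<gamma>). (x, \<Theta> \<gamma>)) q \<in> {q. (i, q) \<in> W}}"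
        by (rule openin_continuous_map_preimage[OF cP])
      moreover have "{q \<in> topspace (?P E i). (\<lambda>(x, \<gamma>). (x, \<Theta> \<gamma>)) q \<in> {q. (i, q) \<in> W}} = {q. (i, q) \<in> ?W}"
        unfolding ts triple_map_def using i by (auto simp del: topspace_prod_topology)
      ultimately show ?thesis by simp
    qed
    moreover have "?W \<subseteq> Sigma I (topspace \<circ> ?P E)" unfolding ts by auto
    ultimately show "openin (check_space X I U \<phi> E) ?W"
      unfolding check_space_def[of X I U \<phi> E] openin_sum_topology by (simp add: check_space_def)
  qed
  then have "continuous_map (tilde E) (check_space X I U \<phi> E') (triple_map \<Theta>)"
    unfolding tilde_space_def by (rule continuous_map_from_subtopology)
  moreover have "triple_map \<Theta> p \<in> {(i, x, \<gamma>). (i, snd (\<phi> i x)) = germ_source \<gamma>}" if "p \<in> topspace (tilde E)" for p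
    using triple_map_in[OF that] unfolding tilde_space_def by simp
  ultimately show ?thesis
    unfolding tilde_space_def[of _ _ _ _ E'] by (intro continuous_map_into_subtopology) auto
qed

text \<open>The induced map on the quotient can be taken as the image of a class as a set, which
  avoids choosing representatives. That no element of the target class is missed follows from the
  inverse.\<close>

lemma image_class:
  assumes p: "p \<in> topspace (tilde E)"
  shows "triple_map \<Theta> ` cls E p = cls E' (triple_map \<Theta> p)"
proof (intro equalityI subsetI)
  fix q assume "q \<in> triple_map \<Theta> ` cls E p"
  then show "q \<in> cls E' (triple_map \<Theta> p)"
    using triple_map_rel unfolding hat_class_def by auto
next
  fix q assume "q \<in> cls E' (triple_map \<Theta> p)"
  then have r: "(triple_map \<Theta> p, q) \<in> tilde_rel X Z I U \<phi> h E'" unfolding hat_class_def by simp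
  interpret sw: germ_homeomorphism X Z I U \<phi> h E' E \<Theta>' \<Theta> by (rule swap)
  have q: "q \<in> topspace (tilde E')" using r unfolding tilde_rel_def by auto
  have "(p, triple_map \<Theta>' q) \<in> tilde_rel X Z I U \<phi> h E"
    using sw.triple_map_rel[OF r] triple_map_inverse[OF p] by simp
  then have "triple_map \<Theta>' q \<in> cls E p" unfolding hat_class_def by simp
  then show "q \<in> triple_map \<Theta> ` cls E p" using triple_map_inverse'[OF q] by (metis imageI)
qed

lemma topspace_hat: "topspace (hat D) = cls D ` topspace (tilde D)"
  unfolding hat_space_def by simp

lemma continuous_hat: "continuous_map (hat E) (hat E') (image (triple_map \<Theta>))"
proof -
  have q: "quotient_map (tilde D) (hat D) (cls D)" for D
    unfolding hat_space_def by (rule quotient_map_quotient_topology)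
  have "continuous_map (tilde E) (hat E') (cls E' \<circ> triple_map \<Theta>)"
    by (rule continuous_map_compose[OF continuous_triple_map quotient_imp_continuous_map[OF q]])
  then have "continuous_map (tilde E) (hat E') (image (triple_map \<Theta>) \<circ> cls E)"
    by (rule continuous_map_eq) (simp add: image_class)
  then show ?thesis by (rule continuous_compose_quotient_map[OF q])
qed

lemma image_inverse:
  assumes "\<xi> \<in> topspace (hat E)"
  shows "triple_map \<Theta>' ` triple_map \<Theta> ` \<xi> = \<xi>"
proof -
  obtain p where p: "p \<in> topspace (tilde E)" "\<xi> = cls E p" using assms unfolding topspace_hat by blast
  have "cls E p \<subseteq> topspace (tilde E)" unfolding hat_class_def tilde_rel_def by auto
  then show ?thesis unfolding p(2) using triple_map_inverse by (force simp: image_image)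
qed

lemma homeomorphic_hat:
  "homeomorphic_maps (hat E) (hat E') (image (triple_map \<Theta>)) (image (triple_map \<Theta>'))"
proof -
  interpret sw: germ_homeomorphism X Z I U \<phi> h E' E \<Theta>' \<Theta> by (rule swap)
  show ?thesis unfolding homeomorphic_maps_def
    using continuous_hat sw.continuous_hat image_inverse sw.image_inverse by blast
qed

lemma hat_proj_image: "hat_proj (triple_map \<Theta> ` \<xi>) = hat_proj \<xi>"
proof -
  have "(\<exists>i \<gamma>. (i, x, \<gamma>) \<in> triple_map \<Theta> ` \<xi>) \<longleftrightarrow> (\<exists>i \<gamma>. (i, x, \<gamma>) \<in> \<xi>)" for x
    unfolding triple_map_def by force
  then show ?thesis unfolding hat_proj_def by simp
qed

text \<open>Equivalent triples with the same index \<open>i\<close> are related by the lift of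
  \<open>h i i\<close>, which fixes germs. This justifies the definite description in
  \<open>hat_chart\<close>.\<close>

lemma class_unique:
  assumes p: "(i, x, \<gamma>) \<in> topspace (tilde E)"
  shows "(i, x', \<gamma>') \<in> cls E (i, x, \<gamma>) \<longleftrightarrow> x' = x \<and> \<gamma>' = \<gamma>"
proof -
  have refl: "germ_lift (transversal Z I U \<phi>) (cocycle_map U \<phi> h i i) \<delta> = \<delta>"
    if "(i, y, \<delta>) \<in> topspace (tilde E)" for y \<delta>
  proof (rule lift_refl)
    show "germ_source \<delta> \<in> dom (cocycle_map U \<phi> h i i)"
      by (rule source_in_cocycle_dom[OF that]) (use that in \<open>simp add: in_tilde\<close>)
  qed (use that in \<open>auto simp: in_tilde\<close>)
  show ?thesis
    unfolding hat_class_def Image_singleton_iff in_tilde_rel using p refl by auto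
qed

abbreviation "hchart \<equiv> hat_chart X Z I U \<phi> h"

lemma fst_hat_chart: "fst (hchart D i) = {cls D (i, x, \<gamma>) | x \<gamma>. (i, x, \<gamma>) \<in> topspace (tilde D)}"
  unfolding hat_chart_def by simp

lemma snd_hat_chart:
  assumes "(i, x, \<gamma>) \<in> topspace (tilde E)"
  shows "snd (hchart E i) (cls E (i, x, \<gamma>)) = (fst (\<phi> i x), \<gamma>)"
proof -
  have "(THE (x', \<gamma>'). (i, x', \<gamma>') \<in> cls E (i, x, \<gamma>)) = (x, \<gamma>)"
    unfolding class_unique[OF assms] by (rule the_equality) auto
  then show ?thesis unfolding hat_chart_def by simp
qed

lemma plaques_hat_chart: "plaques (hchart E' i) = image (image (triple_map \<Theta>)) ` plaques (hchart E i)"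
proof -
  interpret sw: germ_homeomorphism X Z I U \<phi> h E' E \<Theta>' \<Theta> by (rule swap)
  have "plaques (fst (hchart E' i), snd (hchart E' i)) =
      image (image (triple_map \<Theta>)) ` plaques (fst (hchart E i), snd (hchart E i))"
  proof (rule plaques_push[where \<Theta> = \<Theta>])
    show "fst (hchart E' i) = image (triple_map \<Theta>) ` fst (hchart E i)"
    proof (intro equalityI subsetI)
      fix \<eta> assume "\<eta> \<in> fst (hchart E' i)"
      then obtain x \<gamma> where e: "\<eta> = cls E' (i, x, \<gamma>)" "(i, x, \<gamma>) \<in> topspace (tilde E')"
        unfolding fst_hat_chart by blast
      let ?p = "triple_map \<Theta>' (i, x, \<gamma>)"
      have p: "?p \<in> topspace (tilde E)" by (rule triple_map_in'[OF e(2)])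
      have "\<eta> = triple_map \<Theta> ` cls E ?p"
        unfolding image_class[OF p] triple_map_inverse'[OF e(2)] e(1) ..
      moreover have "cls E ?p \<in> fst (hchart E i)"
        using p unfolding fst_hat_chart triple_map_def by auto
      ultimately show "\<eta> \<in> image (triple_map \<Theta>) ` fst (hchart E i)" by blast
    next
      fix \<eta> assume "\<eta> \<in> image (triple_map \<Theta>) ` fst (hchart E i)"
      then obtain x \<gamma> where e: "\<eta> = triple_map \<Theta> ` cls E (i, x, \<gamma>)" "(i, x, \<gamma>) \<in> topspace (tilde E)"
        unfolding fst_hat_chart by blast
      have "\<eta> = cls E' (i, x, \<Theta> \<gamma>)" "(i, x, \<Theta> \<gamma>) \<in> topspace (tilde E')"
        using image_class[OF e(2)] triple_map_in[OF e(2)] e(1) unfolding triple_map_def by auto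
      then show "\<eta> \<in> fst (hchart E' i)" unfolding fst_hat_chart by blast
    qed
    show "snd (snd (hchart E' i) (triple_map \<Theta> ` \<xi>)) = \<Theta> (snd (snd (hchart E i) \<xi>))" if "\<xi> \<in> fst (hchart E i)" for \<xi>
    proof -
      obtain x \<gamma> where e: "\<xi> = cls E (i, x, \<gamma>)" "(i, x, \<gamma>) \<in> topspace (tilde E)"
        using \<open>\<xi> \<in> fst (hchart E i)\<close> unfolding fst_hat_chart by blast
      have "(i, x, \<Theta> \<gamma>) \<in> topspace (tilde E')" using triple_map_in[OF e(2)] unfolding triple_map_def by simp
      from sw.snd_hat_chart[OF this] snd_hat_chart[OF e(2)] image_class[OF e(2)] show ?thesis
        unfolding e(1) triple_map_def by simp
    qed
    show "inj_on \<Theta> ((snd \<circ> snd (hchart E i)) ` fst (hchart E i))"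
    proof (rule inj_on_inverseI)
      fix \<gamma> assume "\<gamma> \<in> (snd \<circ> snd (hchart E i)) ` fst (hchart E i)"
      then obtain x \<delta> where "(i, x, \<delta>) \<in> topspace (tilde E)" "\<gamma> = snd (snd (hchart E i) (cls E (i, x, \<delta>)))"
        unfolding fst_hat_chart by auto
      then have "\<gamma> \<in> topspace E" using snd_hat_chart by (simp add: in_tilde)
      then show "\<Theta>' (\<Theta> \<gamma>) = \<gamma>" by (rule \<Theta>'\<Theta>)
    qed
  qed
  then show ?thesis by simp
qed

text \<open>Every chart of the maximal structure has to be transported, since the leaf topology is
  generated by the plaques of all of them.\<close>

lemma structure_push:
  assumes c: "c \<in> hat_structure X n Z I U \<phi> h E"
  obtains c' where "c' \<in> hat_structure X n Z I U \<phi> h E'"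
    "plaques c' = image (image (triple_map \<Theta>)) ` plaques c"
proof -
  let ?\<theta> = "image (triple_map \<Theta>)" and ?\<theta>' = "image (triple_map \<Theta>')"
  obtain W \<psi> where cW: "c = (W, \<psi>)" by (cases c)
  have fc: "foliated_chart (hat E) n E (W, \<psi>)" and cc: "\<forall>i\<in>I. compatible_charts (hat E) (W, \<psi>) (hchart E i)"
    using c unfolding hat_structure_def structure_of_atlas_def cW by auto
  obtain b r A where b: "openin (hat E) W" "b \<in> topspace (Euclidean_space n)" "0 < r" "openin E A"
    "homeomorphic_map (subtopology (hat E) W)
          (prod_topology (subtopology (Euclidean_space n) (euclidean_ball n b r)) (subtopology E A)) \<psi>"
    using fc unfolding foliated_chart_def by auto
  let ?B = "subtopology (Euclidean_space n) (euclidean_ball n b r)"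
  \<comment> \<open>The chart transported along both homeomorphisms; its transverse model is the
    image of \<open>A\<close> under \<open>\<Theta>\<close>, an open set of
    \<open>E'\<close>.\<close>
  let ?\<psi> = "(\<lambda>(e, \<gamma>). (e, \<Theta> \<gamma>)) \<circ> \<psi> \<circ> ?\<theta>'"
  let ?c = "(?\<theta> ` W, ?\<psi>)"
  have hmh: "homeomorphic_map (hat E) (hat E') ?\<theta>" and hmh': "homeomorphic_map (hat E') (hat E) ?\<theta>'"
    using homeomorphic_hat homeomorphic_maps_map by blast+
  have Wsub: "W \<subseteq> topspace (hat E)" using openin_subset[OF b(1)] .
  have inv: "?\<theta>' (?\<theta> \<xi>) = \<xi>" if "\<xi> \<in> W" for \<xi> using image_inverse that Wsub by blast
  have hmE: "homeomorphic_map E E' \<Theta>" using hm homeomorphic_maps_map by blast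
  have Asub: "A \<subseteq> topspace E" using openin_subset[OF b(4)] .
  have o1: "openin (hat E') (?\<theta> ` W)" using homeomorphic_imp_open_map[OF hmh] b(1) unfolding open_map_def by blast
  have o2: "openin E' (\<Theta> ` A)" using homeomorphic_imp_open_map[OF hmE] b(4) unfolding open_map_def by blast
  have \<psi>im: "\<psi> ` W = topspace ?B \<times> A"
    using homeomorphic_imp_surjective_map[OF b(5)] Wsub Asub by (simp add: inf.absorb2)
  have "homeomorphic_map (subtopology (hat E') (?\<theta> ` W)) (prod_topology ?B (subtopology E' (\<Theta> ` A))) ?\<psi>"
  proof -
    have "homeomorphic_map (subtopology (hat E') (?\<theta> ` W)) (subtopology (hat E) W) ?\<theta>'"
    proof (rule homeomorphic_map_subtopologies[OF hmh'])
      have "topspace (hat E') \<inter> ?\<theta> ` W = ?\<theta> ` W" using openin_subset[OF o1] by blast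
      moreover have "?\<theta>' ` ?\<theta> ` W = W" unfolding image_image[of ?\<theta>' ?\<theta>] using inv by simp
      ultimately show "?\<theta>' ` (topspace (hat E') \<inter> ?\<theta> ` W) = topspace (hat E) \<inter> W" using Wsub by auto
    qed
    moreover have "homeomorphic_map (prod_topology ?B (subtopology E A)) (prod_topology ?B (subtopology E' (\<Theta> ` A))) (\<lambda>(e, \<gamma>). (e, \<Theta> \<gamma>))"
    proof -
      have "homeomorphic_maps (subtopology E A) (subtopology E' (\<Theta> ` A)) \<Theta> \<Theta>'"
      proof (rule homeomorphic_maps_subtopologies[OF hm])
        show "\<Theta> ` (topspace E \<inter> A) = topspace E' \<inter> \<Theta> ` A"
          using Asub openin_subset[OF o2] by (simp add: inf.absorb2)
      qed
      moreover have "homeomorphic_maps ?B ?B (\<lambda>e. e) (\<lambda>e. e)"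
        unfolding homeomorphic_maps_def by simp
      ultimately have "homeomorphic_maps (prod_topology ?B (subtopology E A)) (prod_topology ?B (subtopology E' (\<Theta> ` A)))
          (\<lambda>(e, \<gamma>). (e, \<Theta> \<gamma>)) (\<lambda>(e, \<gamma>). (e, \<Theta>' \<gamma>))"
        by (simp add: homeomorphic_maps_prod)
      then show ?thesis using homeomorphic_maps_map by blast
    qed
    ultimately show ?thesis using b(5) by (intro homeomorphic_map_compose)
  qed
  then have fc': "foliated_chart (hat E') n E' ?c"
    unfolding foliated_chart_def using o1 o2 b(2,3) by auto
  have pl: "plaques ?c = image ?\<theta> ` plaques (W, \<psi>)"
  proof (rule plaques_push[where \<Theta> = \<Theta>])
    show "snd (?\<psi> (?\<theta> \<xi>)) = \<Theta> (snd (\<psi> \<xi>))" if "\<xi> \<in> W" for \<xi>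
      using inv[OF that] by (simp add: split_beta)
    have "(snd \<circ> \<psi>) ` W \<subseteq> topspace E"
    proof
      fix \<gamma> assume "\<gamma> \<in> (snd \<circ> \<psi>) ` W"
      then obtain \<xi> where \<xi>: "\<xi> \<in> W" "\<gamma> = snd (\<psi> \<xi>)" by auto
      then have "\<psi> \<xi> \<in> topspace ?B \<times> A" using \<psi>im by blast
      then show "\<gamma> \<in> topspace E" using \<xi>(2) Asub by auto
    qed
    then show "inj_on \<Theta> ((snd \<circ> \<psi>) ` W)" using \<Theta>'\<Theta> by (intro inj_on_inverseI[of _ \<Theta>']) blast
  qed simp
  have cc': "compatible_charts (hat E') ?c (hchart E' i)" if i: "i \<in> I" for i
  proof (rule compatible_charts_push[OF hmh _ _ pl plaques_hat_chart])
    show "fst (W, \<psi>) \<subseteq> topspace (hat E)" using Wsub by simp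
    show "fst (hchart E i) \<subseteq> topspace (hat E)" unfolding fst_hat_chart topspace_hat by blast
    show "compatible_charts (hat E) (W, \<psi>) (hchart E i)" using cc i by blast
  qed
  show thesis
  proof (rule that)
    show "?c \<in> hat_structure X n Z I U \<phi> h E'"
      unfolding hat_structure_def structure_of_atlas_def using fc' cc' by blast
    show "plaques ?c = image ?\<theta> ` plaques c" using pl unfolding cW .
  qed
qed

lemma hat_structure_plaque_subset:
  assumes "c \<in> hat_structure X n Z I U \<phi> h D" "P \<in> plaques c"
  shows "P \<subseteq> topspace (hat D)"
proof -
  obtain W \<psi> where c: "c = (W, \<psi>)" by (cases c)
  have "openin (hat D) W"
    using assms(1) unfolding hat_structure_def structure_of_atlas_def foliated_chart_def c by auto
  then show ?thesis using plaques_subset[of P W \<psi>] assms(2) openin_subset unfolding c by blast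
qed

text \<open>The preimage of a plaque under a bijection is its image under the inverse, which is a
  plaque by \<open>structure_push\<close> in the opposite direction; plaques generate the leaf
  topology.\<close>

lemma continuous_leaf_topology:
  "continuous_map (leaf_topology (hat_structure X n Z I U \<phi> h E))
     (leaf_topology (hat_structure X n Z I U \<phi> h E')) (image (triple_map \<Theta>))"
proof -
  interpret sw: germ_homeomorphism X Z I U \<phi> h E' E \<Theta>' \<Theta> by (rule swap)
  let ?\<theta> = "image (triple_map \<Theta>)" and ?\<theta>' = "image (triple_map \<Theta>')"
  let ?F = "\<lambda>D. hat_structure X n Z I U \<phi> h D"
  let ?L = "leaf_topology (?F E)"
  have ts: "topspace ?L = \<Union>(\<Union>c\<in>?F E. plaques c)" unfolding leaf_topology_def by simp
  have tsub: "topspace ?L \<subseteq> topspace (hat E)" unfolding ts using hat_structure_plaque_subset by blast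
  have open_plaque: "openin ?L P" if "c \<in> ?F E" "P \<in> plaques c" for c P
    unfolding leaf_topology_def by (rule topology_generated_by_Basis) (use that in blast)
  have pre: "openin ?L (?\<theta> -` P' \<inter> topspace ?L)" if P': "P' \<in> (\<Union>c\<in>?F E'. plaques c)" for P'
  proof -
    obtain c' where c': "c' \<in> ?F E'" "P' \<in> plaques c'" using P' by blast
    obtain c where c: "c \<in> ?F E" "plaques c = image ?\<theta>' ` plaques c'"
      using sw.structure_push[OF c'(1)] by blast
    have P: "?\<theta>' ` P' \<in> plaques c" using c'(2) c(2) by blast
    have "?\<theta> -` P' \<inter> topspace ?L = ?\<theta>' ` P'"
    proof (intro equalityI subsetI)
      fix \<xi> assume "\<xi> \<in> ?\<theta> -` P' \<inter> topspace ?L"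
      then have "\<xi> \<in> topspace (hat E)" "?\<theta> \<xi> \<in> P'" using tsub by auto
      then show "\<xi> \<in> ?\<theta>' ` P'" using image_inverse by (metis imageI)
    next
      fix \<xi> assume \<xi>: "\<xi> \<in> ?\<theta>' ` P'"
      then obtain \<eta> where \<eta>: "\<eta> \<in> P'" "\<xi> = ?\<theta>' \<eta>" by blast
      have "\<eta> \<in> topspace (hat E')" using hat_structure_plaque_subset[OF c'] \<eta>(1) by blast
      then have "?\<theta> \<xi> = \<eta>" using sw.image_inverse \<eta>(2) by simp
      moreover have "\<xi> \<in> topspace ?L" using P \<xi> c(1) unfolding ts by blast
      ultimately show "\<xi> \<in> ?\<theta> -` P' \<inter> topspace ?L" using \<eta>(1) by simp
    qed
    then show ?thesis using open_plaque[OF c(1) P] by simp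
  qed
  have im: "?\<theta> ` topspace ?L \<subseteq> \<Union>(\<Union>c\<in>?F E'. plaques c)"
  proof
    fix \<eta> assume "\<eta> \<in> ?\<theta> ` topspace ?L"
    then obtain c P \<xi> where c: "c \<in> ?F E" "P \<in> plaques c" "\<xi> \<in> P" "\<eta> = ?\<theta> \<xi>" unfolding ts by blast
    obtain c' where c': "c' \<in> ?F E'" "plaques c' = image ?\<theta> ` plaques c"
      using structure_push[OF c(1)] by blast
    then show "\<eta> \<in> \<Union>(\<Union>c\<in>?F E'. plaques c)" using c by blast
  qed
  show ?thesis
    unfolding leaf_topology_def[of "?F E'"] continuous_on_generated_topo_iff using pre im by blast
qed

lemma foliated_hat:
  "foliated_map (hat E) (hat_structure X n Z I U \<phi> h E) (hat E') (hat_structure X n Z I U \<phi> h E')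
     (image (triple_map \<Theta>))"
  unfolding foliated_map_def
proof (intro conjI ballI continuous_hat)
  let ?F = "\<lambda>D. hat_structure X n Z I U \<phi> h D"
  fix L assume L: "L \<in> leaves (?F E)"
  have "connectedin (leaf_topology (?F E)) L"
    using L connectedin_connected_components_of unfolding leaves_def by blast
  then have con: "connectedin (leaf_topology (?F E')) (image (triple_map \<Theta>) ` L)"
    by (rule connectedin_continuous_map_image[OF continuous_leaf_topology])
  \<comment> \<open>A leaf is non-empty, which rules out the trivial topology, where no component
    could contain its image.\<close>
  have "L \<noteq> {}" using L nonempty_connected_components_of unfolding leaves_def by blast
  then have "topspace (leaf_topology (?F E')) \<noteq> {}" using connectedin_subset_topspace[OF con] by blast
  then have "leaf_topology (?F E') \<noteq> trivial_topology" by auto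
  then show "\<exists>L'\<in>leaves (?F E'). image (triple_map \<Theta>) ` L \<subseteq> L'"
    using exists_connected_component_of_superset[OF con] unfolding leaves_def by blast
qed

lemma foliated_homeomorphism_hat:
  "foliated_homeomorphism (hat E) (hat_structure X n Z I U \<phi> h E) (hat E') (hat_structure X n Z I U \<phi> h E')
     (image (triple_map \<Theta>))"
proof -
  interpret sw: germ_homeomorphism X Z I U \<phi> h E' E \<Theta>' \<Theta> by (rule swap)
  show ?thesis unfolding foliated_homeomorphism_def
    using homeomorphic_hat foliated_hat sw.foliated_hat by blast
qed

end

section \<open>Independence of the base point\<close>

theorem proposition4p12:
  fixes X :: "'x topology" and n :: nat and Z :: "'z topology"
    and F :: "('x, 'z) chart set"
    and I :: "'i set" and U :: "'i \<Rightarrow> 'x set"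
    and \<phi> :: "'i \<Rightarrow> 'x \<Rightarrow> (nat \<Rightarrow> real) \<times> 'z"
    and h :: "'i \<Rightarrow> 'i \<Rightarrow> 'z \<Rightarrow> 'z"
    and T :: "('i \<times> 'z) topology" and H :: "(('i \<times> 'z) \<rightharpoonup> ('i \<times> 'z)) set"
    and x0 x1 :: 'x and i0 i1 :: 'i and t0 t1 :: "'i \<times> 'z"
    and V0 V1 :: "('i \<times> 'z) set" and \<C>0 \<C>1 :: "('i \<times> 'z) metric set"
    and S0 S1 :: "(('i \<times> 'z) \<rightharpoonup> ('i \<times> 'z)) set"
    and E0 E1 :: "('i, 'z) trgerm topology"
  assumes "lc_polish_space X" and "lc_polish_space Z"
    and "foliated_structure X n Z F"
    and "compact_space X"
    and "regular_foliated_atlas X F I U \<phi>"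
    and "defining_cocycle Z I U \<phi> h"
    and "T = transversal Z I U \<phi>"
    and "H = holonomy_pseudogroup Z I U \<phi> h"
    and "minimal_pseudogroup T H"
    and "equicontinuous_pseudogroup T H"
    and "has_strongly_quasi_analytic_closure T H"
    and "i0 \<in> I" and "x0 \<in> U i0" and "t0 = (i0, snd (\<phi> i0 x0))"
    and "i1 \<in> I" and "x1 \<in> U i1" and "t1 = (i1, snd (\<phi> i1 x1))"
    and "admissible_choice T H t0 V0 \<C>0 S0"
    and "admissible_choice T H t1 V1 \<C>1 S1"
    and "E0 = germ_space_at T S0 t0" and "E1 = germ_space_at T S1 t1"
  shows "\<exists>\<theta>. foliated_homeomorphism
               (hat_space X Z I U \<phi> h E0) (hat_structure X n Z I U \<phi> h E0)
               (hat_space X Z I U \<phi> h E1) (hat_structure X n Z I U \<phi> h E1) \<theta> \<and>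
             (\<forall>\<xi>\<in>topspace (hat_space X Z I U \<phi> h E0). hat_proj (\<theta> \<xi>) = hat_proj \<xi>)"
proof -
  have open_chart: "openin X (U i)" if "i \<in> I" for i
  proof -
    have "(U i, \<phi> i) \<in> F" using assms(5) that unfolding regular_foliated_atlas_def by (elim conjE) blast
    then have "foliated_chart X n Z (U i, \<phi> i)"
      using assms(3) unfolding foliated_structure_def foliated_atlas_def by (elim conjE) blast
    then show ?thesis unfolding foliated_chart_def by auto
  qed
  have T: "metrizable_space T" "locally_compact_space T"
    unfolding assms(7) using transversal_metrizable_locally_compact[OF assms(2,3,5)] by auto
  obtain M d where M: "Metric_space M d" "T = Metric_space.mtopology M d"
    using T(1) unfolding metrizable_space_def by blast
  have tsT: "topspace T = M" unfolding M(2) by (rule Metric_space.topspace_mtopology[OF M(1)])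
  note adm0 = assms(18) and adm1 = assms(19)
  note psg0 = admissible_psg[OF adm0] and psg1 = admissible_psg[OF adm1]
  note pgH = admissible_pseudogroup[OF adm0]
  have H_loct: "g \<in> loct T" if "g \<in> H" for g using psg_loct[OF pseudogroup_psg[OF pgH] that] .
  let ?S = "S0 \<inter> S1"
  note eqc = admissible_equicontinuous[OF adm0, unfolded equicontinuous_with_def]
  interpret M: Metric_space M d by (rule M(1))
  \<comment> \<open>The cover and the set \<open>V0\<close> of the first choice serve for the
    intersection, since equicontinuity passes from \<open>S0\<close> to a subset; generation does
    not, and is checked on germs.\<close>
  interpret equi_pg M d T \<C>0 ?S H V0
  proof (unfold_locales)
    show "T = M.mtopology" by (rule M(2))
    show "quasi_locally_equal_cover M \<C>0" using eqc unfolding tsT by (elim conjE)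
    show "cover_induces_topology T \<C>0" using eqc by (elim conjE)
    have "equicontinuous_family \<C>0 S0" unfolding equicontinuous_family_def using eqc by (elim conjE)
    then show "equicontinuous_family \<C>0 ?S" by (rule equicontinuous_family_mono) blast
    show "locally_compact_space T" by (rule T(2))
    show "pseudogroup T H" by (rule pgH)
    show "compactly_generated_with T H V0" by (rule admissible_compactly_generated[OF adm0])
    show "pseudo_star_group T ?S"
      using psg0 psg1 unfolding pseudo_star_group_def by auto
    show "restriction_closed T ?S"
      using admissible_restriction_closed[OF adm0] admissible_restriction_closed[OF adm1]
      unfolding restriction_closed_def by auto
    show "?S \<subseteq> H" using admissible_subset[OF adm0] by blast
    fix g x y assume g: "g \<in> H" "g x = Some y"
    obtain s0 where s0: "s0 \<in> S0" "agree T s0 g x" using admissible_germ[OF adm0 g] by blast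
    obtain s1 where s1: "s1 \<in> S1" "agree T s1 g x" using admissible_germ[OF adm1 g] by blast
    \<comment> \<open>The two representatives coincide near \<open>x\<close>; closure under
      restriction puts their common restriction into both \<open>S0\<close> and
      \<open>S1\<close>.\<close>
    have "agree T s0 s1 x" by (rule agree_trans[OF s0(2) agree_sym[OF s1(2)]])
    then obtain W where W: "openin T W" "x \<in> W" "\<And>z. z \<in> W \<Longrightarrow> s0 z = s1 z"
      unfolding agree_def by blast
    let ?W = "W \<inter> dom s0"
    have d0: "openin T (dom s0)" using loct_dom[OF psg_loct[OF psg0 s0(1)]] .
    have Wo: "openin T ?W" using W(1) d0 by (rule openin_Int)
    have "?W \<subseteq> dom s1" using W(3) by auto
    then have "s1 |` ?W \<in> S1" using admissible_restriction_closed[OF adm1] s1(1) Wo unfolding restriction_closed_def by blast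
    moreover have "s1 |` ?W = s0 |` ?W" using W(3) by (auto simp: restrict_map_def fun_eq_iff)
    moreover have "s0 |` ?W \<in> S0" using admissible_restriction_closed[OF adm0] s0(1) Wo unfolding restriction_closed_def by blast
    ultimately have "s0 |` ?W \<in> ?S" by simp
    moreover have "x \<in> ?W" using W(2) agree_eq[OF s0(2)] g(2) by (simp add: domI)
    then have "agree T (s0 |` ?W) g x" using agree_trans[OF agree_restrict[OF Wo] s0(2)] by blast
    ultimately show "\<exists>s\<in>?S. agree T s g x" by blast
  qed
  note qa0 = admissible_quasi_analytic[OF adm0] and qa1 = admissible_quasi_analytic[OF adm1]
  have sub0: "?S \<subseteq> S0" and sub1: "?S \<subseteq> S1" by auto
  note ctx0 = psg0 sub0 admissible_subset[OF adm0] qa0 and ctx1 = psg1 sub1 admissible_subset[OF adm1] qa1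
  \<comment> \<open>\<open>closure_star T S'\<close> generates
    \<open>closure_pseudogroup T S'\<close>, so both have the same germs.\<close>
  have based: "{germ T g x | g x. g \<in> closure_pseudogroup T S' \<and> g x = Some t} = based_germs T S' t"
    if adm: "admissible_choice T H t' V' \<C>' S'" for t t' V' \<C>' S'
  proof (intro equalityI subsetI)
    fix \<gamma> assume "\<gamma> \<in> {germ T g x | g x. g \<in> closure_pseudogroup T S' \<and> g x = Some t}"
    then obtain g x where g: "\<gamma> = germ T g x" "g \<in> closure_pseudogroup T S'" "g x = Some t" by blast
    obtain s where s: "s \<in> closure_star T S'" "agree T s g x" using admissible_closure_germ[OF adm g(2,3)] by blast
    have "\<gamma> = germ T s x" "s x = Some t" using germ_eq_agree[OF s(2)] agree_eq[OF s(2)] g by auto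
    then show "\<gamma> \<in> based_germs T S' t" using s(1) unfolding based_germs_def by blast
  next
    fix \<gamma> assume "\<gamma> \<in> based_germs T S' t"
    then obtain g x where g: "\<gamma> = germ T g x" "g \<in> closure_star T S'" "g x = Some t" unfolding based_germs_def by blast
    have "g \<in> closure_pseudogroup T S'" using admissible_closure_subset[OF adm] g(2) by blast
    then show "\<gamma> \<in> {germ T g x | g x. g \<in> closure_pseudogroup T S' \<and> g x = Some t}" using g by blast
  qed
  have E0: "E0 = subtopology (germ_space T S0) (based_germs T S0 t0)"
    unfolding assms(20) germ_space_at_def based[OF adm0] ..
  \<comment> \<open>Both are equal to the space of germs of the intersection.\<close>
  have "germ_space T S1 = germ_space T S0"
    unfolding germ_space_eq[OF ctx0] germ_space_eq[OF ctx1] ..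
  moreover have "based_germs T S1 t1 = based_germs T S0 t1"
    unfolding based_germs_eq[OF ctx0] based_germs_eq[OF ctx1] ..
  ultimately have E1: "E1 = subtopology (germ_space T S0) (based_germs T S0 t1)"
    unfolding assms(21) germ_space_at_def based[OF adm1] by simp
  have V: "t0 \<in> V0" "t1 \<in> V1" using adm0 adm1 unfolding admissible_choice_def by auto
  have "V0 \<subseteq> M" "V1 \<subseteq> M"
    using admissible_compactly_generated[OF adm0] admissible_compactly_generated[OF adm1] openin_subset
    unfolding compactly_generated_with_def tsT[symmetric] by blast+
  then have t: "t0 \<in> M" "t1 \<in> M" using V by auto
  have "t1 \<in> T closure_of orbit H t0"
    using assms(9) t unfolding minimal_pseudogroup_def tsT by blast
  then obtain f where f2: "f \<in> closure_star T ?S" "f t0 = Some t1"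
    using transitive_closure_star[OF quasi_analytic_mono[OF qa0 sub0] t(1)] by blast
  have f: "f \<in> closure_star T S0" using closure_star_subset[OF ctx0] f2(1) by blast
  interpret closure_psg T S0
  proof
    show "S0 \<subseteq> loct T" using psg_loct[OF psg0] by blast
    show "pseudo_star_group T (closure_star T S0)" by (rule admissible_closure_psg[OF adm0])
    show "\<exists>K Q. compactin T K \<and> openin T Q \<and> x \<in> Q \<and> Q \<subseteq> K \<and> K \<subseteq> N" if "openin T N" "x \<in> N" for N x
      using compact_neighbourhood[OF that] by metis
  qed
  have lf: "linv f \<in> closure_star T S0" "linv f t1 = Some t0"
    using psg_linv[OF psgA f] linv_eq_Some[OF closure_star_loct[OF f]] f2(2) by auto
  have cm: "cocycle_map U \<phi> h i j \<in> loct T" if "i \<in> I" "j \<in> I" for i j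
  proof (rule H_loct)
    have "cocycle_map U \<phi> h i j \<in> {cocycle_map U \<phi> h i j | i j. i \<in> I \<and> j \<in> I}" using that by blast
    then show "cocycle_map U \<phi> h i j \<in> H"
      unfolding assms(8) holonomy_pseudogroup_def by (rule subsetD[OF generated_pseudogroup_superset])
  qed
  \<comment> \<open>For equal indices the cocycle relation on \<open>U i\<close> says that
    \<open>h i i\<close> fixes every value of the submersion.\<close>
  have cm_id: "cocycle_map U \<phi> h i i x = Some x" if i: "i \<in> I" and x: "x \<in> dom (cocycle_map U \<phi> h i i)" for i x
  proof -
    obtain u where u: "u \<in> U i" "x = (i, snd (\<phi> i u))"
      using x by (cases x) (auto simp: cocycle_map_def split: if_splits)
    have "h i i (snd (\<phi> i u)) = snd (\<phi> i u)"
      using assms(6) i u(1) unfolding defining_cocycle_def by blast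
    then show ?thesis using u by (auto simp: cocycle_map_def)
  qed
  have ts: "topspace E0 = based_germs T S0 t0" "topspace E1 = based_germs T S0 t1"
    unfolding E0 E1 topspace_based_germs by auto
  interpret G: germ_homeomorphism X Z I U \<phi> h E0 E1 "germ_push T f" "germ_push T (linv f)"
  proof (unfold_locales, unfold ts assms(7)[symmetric])
    show "U i \<subseteq> topspace X" if "i \<in> I" for i using openin_subset[OF open_chart[OF that]] .
    show "homeomorphic_maps E0 E1 (germ_push T f) (germ_push T (linv f))"
      unfolding E0 E1 by (rule homeomorphic_germ_push[OF f f2(2)])
    show "germ_source (germ_push T f \<gamma>) = germ_source \<gamma>" if "\<gamma> \<in> based_germs T S0 t0" for \<gamma>
      by (rule germ_push_source[OF f f2(2) that])
    show "germ_push T f (germ_lift T (cocycle_map U \<phi> h i j) \<gamma>) = germ_lift T (cocycle_map U \<phi> h i j) (germ_push T f \<gamma>)"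
      if "i \<in> I" "j \<in> I" "\<gamma> \<in> based_germs T S0 t0" "germ_source \<gamma> \<in> dom (cocycle_map U \<phi> h i j)" for i j \<gamma>
      by (rule germ_push_lift[OF f f2(2) that(3) cm[OF that(1,2)] that(4)])
    show "germ_push T (linv f) (germ_lift T (cocycle_map U \<phi> h i j) \<gamma>) = germ_lift T (cocycle_map U \<phi> h i j) (germ_push T (linv f) \<gamma>)"
      if "i \<in> I" "j \<in> I" "\<gamma> \<in> based_germs T S0 t1" "germ_source \<gamma> \<in> dom (cocycle_map U \<phi> h i j)" for i j \<gamma>
      by (rule germ_push_lift[OF lf that(3) cm[OF that(1,2)] that(4)])
    show "germ_lift T (cocycle_map U \<phi> h i i) \<gamma> = \<gamma>"
      if "i \<in> I" "\<gamma> \<in> based_germs T S0 t0" "germ_source \<gamma> \<in> dom (cocycle_map U \<phi> h i i)" for i \<gamma>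
      by (rule germ_lift_identity[OF that(2) cm[OF that(1,1)] that(3) cm_id[OF that(1)]])
    show "germ_lift T (cocycle_map U \<phi> h i i) \<gamma> = \<gamma>"
      if "i \<in> I" "\<gamma> \<in> based_germs T S0 t1" "germ_source \<gamma> \<in> dom (cocycle_map U \<phi> h i i)" for i \<gamma>
      by (rule germ_lift_identity[OF that(2) cm[OF that(1,1)] that(3) cm_id[OF that(1)]])
  qed
  show ?thesis
    using G.foliated_homeomorphism_hat G.hat_proj_image by blast
qed

end
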